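(* Let $w\in C^2(-2,2)$, $\eta>0$, $\mu>0$, $\gamma>0$, $f,f_r,f_p\in L^2(-1,1)$ and $0<\beta\le\alpha\le2\beta$. (I) Let $u$ be a minimizer of $$E_1(v)=\alpha\,\sharp(S_v)+\beta\,\sharp(S_{\dot v}\setminus S_v)+\int_{-1}^1\big(\eta|\ddot v|^2-fv\big)\,dx+\mu\int_{-1}^1|v-w|^2\,dx$$ over the functions $v\in\mathbf{H}^2(-2,2)$ with $v=w$ a.e. in $(-2,-1)\cup(1,2)$. Then: (a) $\eta u''''+\mu(u-w)=f/2$ in $(-1,1)\setminus(S_u\cup S_{\dot u})$; (b) $\ddot u^+=\ddot u^-=\dddot u^+=\dddot u^-=0$ on $S_u\setminus\{\pm1\}$; (c) $\ddot u^+=\ddot u^-=[\dddot u]=0$ on $S_{\dot u}\setminus(S_u\cup\{\pm1\})$; (d) $\ddot u\in H^2(-1,1)$ and $\eta(\ddot u)''+\mu(u-w)=f/2$ in $\mathcal{D}'(-1,1)$; (e) $\ddot u^+(-1)=\dddot u^+(-1)=0$ if $-1\in S_u\setminus S_{\dot u}$, and $\ddot u^-(1)=\dddot u^-(1)=0$ if $1\in S_u\setminus S_{\dot u}$; (f) $\ddot u^+(-1)=0$ if $-1\in S_{\dot u}\setminus S_u$, and $\ddot u^-(1)=0$ if $1\in S_{\dot u}\setminus S_u$; (g) if $\alpha=\beta$, the conditions (b), (c), (e), (f) altogether are improved as follows: $\ddot u^+=\ddot u^-=\dddot u^+=\dddot u^-=0$ on $S_u\cup S_{\dot u}$. (II)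 Let $(u_r,u_p)$ be a minimizer of $$\begin{aligned}F_1(v_r,v_p)=\;&\alpha\,\sharp(S_{v_r})+\beta\,\sharp(S_{\dot v_r}\setminus S_{v_r})+\int_{-1}^1\big(\eta|\ddot v_r|^2-f_rv_r\big)\,dx\\&+\mu\int_{-1}^1|v_r-v_p|^2\,dx+\int_{-1}^1\big(\gamma|v_p''|^2-f_pv_p\big)\,dx\end{aligned}$$ over the pairs $(v_r,v_p)\in\mathbf{H}^2(-2,2)\times H^2(-2,2)$ with $v_r=v_p=w$ in $(-2,-1)\cup(1,2)$. Then: (a) $\eta u_r''''+\mu(u_r-u_p)=f_r/2$ in $(-1,1)\setminus(S_{u_r}\cup S_{\dot u_r})$; (b) $\gamma u_p''''+\mu(u_p-u_r)=f_p/2$ in $\mathcal{D}'(-1,1)$; (c) $\eta u_r''''+\gamma u_p''''=(f_r+f_p)/2$ in $(-1,1)\setminus(S_{u_r}\cup S_{\dot u_r})$; (d) $\ddot u_r^+=\ddot u_r^-=\dddot u_r^+=\dddot u_r^-=0$ on $S_{u_r}\setminus\{\pm1\}$; (e) $\ddot u_r^+=\ddot u_r^-=[\dddot u_r]=0$ on $S_{\dot u_r}\setminus(S_{u_r}\cup\{\pm1\})$; (f) hence $\ddot u_r\in H^2(-1,1)$, and in $\mathcal{D}'(-1,1)$: $\eta(\ddot u_r)''+\mu(u_r-u_p)=f_r/2$ and $\eta(\ddot u_r)''+\gamma u_p''''=(f_r+f_p)/2$, which together give $2\eta(\ddot u_r)''+\mu(u_r-u_p)+\gamma u_p''''=f_r+\tfrac12f_p$;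 (g) $\ddot u_r^+(-1)=\dddot u_r^+(-1)=0$ if $-1\in S_{u_r}\setminus S_{\dot u_r}$, and $\ddot u_r^-(1)=\dddot u_r^-(1)=0$ if $1\in S_{u_r}\setminus S_{\dot u_r}$; (h) $\ddot u_r^+(-1)=0$ if $-1\in S_{\dot u_r}\setminus S_{u_r}$, and $\ddot u_r^-(1)=0$ if $1\in S_{\dot u_r}\setminus S_{u_r}$; (i) if $\alpha=\beta$, the conditions (d), (e), (g), (h) altogether are improved as follows: $\ddot u_r^+=\ddot u_r^-=\dddot u_r^+=\dddot u_r^-=0$ on $S_{u_r}\cup S_{\dot u_r}$.
   Context: $H^2$ is the usual Sobolev space; $\mathcal{D}'$ denotes distributions. $\mathbf{H}^2(-2,2)$ is the set of functions $v:(-2,2)\to\mathbb{R}$ that are piecewise $H^2$, i.e. made of finitely many $H^2$ pieces: there is a finite partition $-2=s_0<\dots<s_n=2$ with $v\in H^2(s_{i-1},s_i)$ for each $i$. $\dot v$ is the absolutely continuous part of the distributional derivative $v'$, $\ddot v$ is the absolutely continuous part of $(\dot v)'$, and $\dddot v$ is the absolutely continuous part of $(\ddot v)'$; $S_v$ and $S_{\dot v}$ are the sets of discontinuity points of $v$ and $\dot v$ in $(-2,2)$ (for the admissible functions they are contained in $[-1,1]$ and may include the points $\pm1$); $\sharp$ is the counting measure. Superscripts $+$ and $-$ denote right and left limits, and $[z]=z^+-z^-$.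
   Formalization: In (I)(g) and (II)(i), at the points ±1 only the traces from inside (-1,1) are asserted to vanish; the outer trace of the second derivative there is w''(±1), which need not be zero, and the outer third-derivative trace may be undefined. *)

theory Defs
  imports "HOL-Analysis.Analysis"
begin

text \<open>
  Functions on an open set \<open>\<Omega> \<subseteq> \<real>\<close> are total functions on the reals whose values outside \<open>\<Omega>\<close>
  are irrelevant. Elements of Lebesgue and Sobolev spaces are represented by arbitrary Lebesgue
  measurable representatives; the notions below that are applied to them are invariant under changes
  on null sets.
\<close>

definition Ck_on :: "nat \<Rightarrow> real set \<Rightarrow> (real \<Rightarrow> real) \<Rightarrow> bool" where
  "Ck_on k \<Omega> f \<longleftrightarrow>
     (\<forall>j<k. \<forall>x\<in>\<Omega>. ((deriv ^^ j) f) differentiable (at x)) \<and> continuous_on \<Omega> ((deriv ^^ k) f)"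

definition L2 :: "real set \<Rightarrow> (real \<Rightarrow> real) set" where
  "L2 \<Omega> = {f. f \<in> borel_measurable (lebesgue_on \<Omega>) \<and> integrable (lebesgue_on \<Omega>) (\<lambda>x. (f x)\<^sup>2)}"

definition locally_integrable :: "real set \<Rightarrow> (real \<Rightarrow> real) \<Rightarrow> bool" where
  "locally_integrable \<Omega> f \<longleftrightarrow> (\<forall>K. compact K \<and> K \<subseteq> \<Omega> \<longrightarrow> f absolutely_integrable_on K)"


subsection \<open>Distributions\<close>

definition test_function :: "real set \<Rightarrow> (real \<Rightarrow> real) \<Rightarrow> bool" where
  "test_function \<Omega> \<phi> \<longleftrightarrow>
     (\<forall>k. Ck_on k UNIV \<phi>) \<and> compact (closure {x. \<phi> x \<noteq> 0}) \<and> closure {x. \<phi> x \<noteq> 0} \<subseteq> \<Omega>"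

text \<open>A distribution is given by its action; only its values on test functions matter.\<close>

type_synonym distribution = "(real \<Rightarrow> real) \<Rightarrow> real"

definition distr_of :: "(real \<Rightarrow> real) \<Rightarrow> distribution" where
  "distr_of f = (\<lambda>\<phi>. LINT x|lebesgue. f x * \<phi> x)"

definition distr_deriv :: "distribution \<Rightarrow> distribution" where
  "distr_deriv T = (\<lambda>\<phi>. - T (deriv \<phi>))"

definition distr_eq_on :: "real set \<Rightarrow> distribution \<Rightarrow> distribution \<Rightarrow> bool" where
  "distr_eq_on \<Omega> T S \<longleftrightarrow> (\<forall>\<phi>. test_function \<Omega> \<phi> \<longrightarrow> T \<phi> = S \<phi>)"


subsection \<open>Sobolev and piecewise Sobolev functions\<close>

definition is_weak_deriv :: "real set \<Rightarrow> (real \<Rightarrow> real) \<Rightarrow> (real \<Rightarrow> real) \<Rightarrow> bool" where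
  "is_weak_deriv \<Omega> v g \<longleftrightarrow> locally_integrable \<Omega> v \<and> locally_integrable \<Omega> g \<and>
     distr_eq_on \<Omega> (distr_deriv (distr_of v)) (distr_of g)"

definition weak_deriv :: "real set \<Rightarrow> (real \<Rightarrow> real) \<Rightarrow> real \<Rightarrow> real" where
  "weak_deriv \<Omega> v = (SOME g. is_weak_deriv \<Omega> v g)"

primrec sobolev_H :: "nat \<Rightarrow> real set \<Rightarrow> (real \<Rightarrow> real) set" where
  "sobolev_H 0 \<Omega> = L2 \<Omega>"
| "sobolev_H (Suc k) \<Omega> = {v \<in> L2 \<Omega>. \<exists>g \<in> sobolev_H k \<Omega>. is_weak_deriv \<Omega> v g}"

definition piecewise_H2 :: "real \<Rightarrow> real \<Rightarrow> (real \<Rightarrow> real) set" where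
  "piecewise_H2 a b = {v. \<exists>(n::nat) s. s 0 = a \<and> s n = b \<and>
     (\<forall>i<n. s i < s (Suc i) \<and> v \<in> sobolev_H 2 {s i<..<s (Suc i)})}"


subsection \<open>Absolutely continuous part of the distributional derivative\<close>

text \<open>
  The distributional derivative of \<open>v\<close> on \<open>\<Omega>\<close> is a finite signed measure whose Lebesgue
  decomposition is \<open>g dx + (M - N)\<close>, with \<open>M\<close>, \<open>N\<close> finite positive Borel measures carried by a
  Lebesgue null set. This determines \<open>g\<close> almost everywhere in \<open>\<Omega>\<close>.
\<close>

definition is_ac_deriv :: "real set \<Rightarrow> (real \<Rightarrow> real) \<Rightarrow> (real \<Rightarrow> real) \<Rightarrow> bool" where
  "is_ac_deriv \<Omega> v g \<longleftrightarrow> locally_integrable \<Omega> v \<and> g absolutely_integrable_on \<Omega> \<and>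
     (\<exists>M N :: real measure.
        finite_measure M \<and> sets M = sets borel \<and> finite_measure N \<and> sets N = sets borel \<and>
        (\<exists>Z \<in> null_sets lborel. emeasure M (- Z) = 0 \<and> emeasure N (- Z) = 0) \<and>
        distr_eq_on \<Omega> (distr_deriv (distr_of v))
          (\<lambda>\<phi>. distr_of g \<phi> + ((LINT x|M. \<phi> x) - (LINT x|N. \<phi> x))))"

definition ac_deriv :: "real set \<Rightarrow> (real \<Rightarrow> real) \<Rightarrow> real \<Rightarrow> real" where
  "ac_deriv \<Omega> v = (SOME g. is_ac_deriv \<Omega> v g)"

definition dot :: "(real \<Rightarrow> real) \<Rightarrow> real \<Rightarrow> real" where
  "dot v = ac_deriv {-2<..<2} v"

definition ddot :: "(real \<Rightarrow> real) \<Rightarrow> real \<Rightarrow> real" where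
  "ddot v = ac_deriv {-2<..<2} (dot v)"

text \<open>
  The third derivative is taken in \<open>(-1,1)\<close> only: outside \<open>[-1,1]\<close> the second derivative of an
  admissible function is that of the datum \<open>w\<close>, which is merely continuous, so that its
  distributional derivative need not be a measure there.
\<close>

definition dddot :: "(real \<Rightarrow> real) \<Rightarrow> real \<Rightarrow> real" where
  "dddot v = ac_deriv {-1<..<1} (ddot v)"


subsection \<open>One-sided limits and discontinuity points of functions defined almost everywhere\<close>

definition ess_tendsto :: "(real \<Rightarrow> real) \<Rightarrow> real \<Rightarrow> real filter \<Rightarrow> bool" where
  "ess_tendsto z l F \<longleftrightarrow> (\<exists>g. (AE x in lebesgue. g x = z x) \<and> (g \<longlongrightarrow> l) F)"

text \<open>\<open>right_lim z x l\<close> says that \<open>z\<^sup>+(x)\<close> exists and equals \<open>l\<close>, similarly for the others.\<close>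

definition right_lim :: "(real \<Rightarrow> real) \<Rightarrow> real \<Rightarrow> real \<Rightarrow> bool" where
  "right_lim z x l \<longleftrightarrow> ess_tendsto z l (at_right x)"

definition left_lim :: "(real \<Rightarrow> real) \<Rightarrow> real \<Rightarrow> real \<Rightarrow> bool" where
  "left_lim z x l \<longleftrightarrow> ess_tendsto z l (at_left x)"

definition jump :: "(real \<Rightarrow> real) \<Rightarrow> real \<Rightarrow> real \<Rightarrow> bool" where
  "jump z x j \<longleftrightarrow> (\<exists>a b. right_lim z x a \<and> left_lim z x b \<and> j = a - b)"

definition disc :: "(real \<Rightarrow> real) \<Rightarrow> real set" where
  "disc v = {x \<in> {-2<..<2}. \<not> (\<exists>l. ess_tendsto v l (at x))}"


subsection \<open>The functionals\<close>

text \<open>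
  For admissible \<open>v\<close> the sets \<open>disc v\<close> and \<open>disc (dot v)\<close> consist of partition points, hence are
  finite and \<open>card\<close> is the counting measure.
\<close>

definition E1 :: "real \<Rightarrow> real \<Rightarrow> real \<Rightarrow> real \<Rightarrow> (real \<Rightarrow> real) \<Rightarrow> (real \<Rightarrow> real) \<Rightarrow>
    (real \<Rightarrow> real) \<Rightarrow> real" where
  "E1 \<alpha> \<beta> \<eta> \<mu> w f v =
     \<alpha> * real (card (disc v)) + \<beta> * real (card (disc (dot v) - disc v))
     + (LINT x:{-1<..<1}|lebesgue. \<eta> * \<bar>ddot v x\<bar>\<^sup>2 - f x * v x)
     + \<mu> * (LINT x:{-1<..<1}|lebesgue. \<bar>v x - w x\<bar>\<^sup>2)"

definition admissible_E1 :: "(real \<Rightarrow> real) \<Rightarrow> (real \<Rightarrow> real) \<Rightarrow> bool" where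
  "admissible_E1 w v \<longleftrightarrow> v \<in> piecewise_H2 (-2) 2 \<and>
     (AE x in lebesgue. x \<in> {-2<..<-1} \<union> {1<..<2} \<longrightarrow> v x = w x)"

definition F1 :: "real \<Rightarrow> real \<Rightarrow> real \<Rightarrow> real \<Rightarrow> real \<Rightarrow> (real \<Rightarrow> real) \<Rightarrow> (real \<Rightarrow> real) \<Rightarrow>
    (real \<Rightarrow> real) \<times> (real \<Rightarrow> real) \<Rightarrow> real" where
  "F1 \<alpha> \<beta> \<eta> \<mu> \<gamma> fr fp = (\<lambda>(vr, vp).
     \<alpha> * real (card (disc vr)) + \<beta> * real (card (disc (dot vr) - disc vr))
     + (LINT x:{-1<..<1}|lebesgue. \<eta> * \<bar>ddot vr x\<bar>\<^sup>2 - fr x * vr x)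
     + \<mu> * (LINT x:{-1<..<1}|lebesgue. \<bar>vr x - vp x\<bar>\<^sup>2)
     + (LINT x:{-1<..<1}|lebesgue.
          \<gamma> * \<bar>weak_deriv {-2<..<2} (weak_deriv {-2<..<2} vp) x\<bar>\<^sup>2 - fp x * vp x))"

definition admissible_F1 :: "(real \<Rightarrow> real) \<Rightarrow> (real \<Rightarrow> real) \<times> (real \<Rightarrow> real) \<Rightarrow> bool" where
  "admissible_F1 w = (\<lambda>(vr, vp). vr \<in> piecewise_H2 (-2) 2 \<and> vp \<in> sobolev_H 2 {-2<..<2} \<and>
     (AE x in lebesgue. x \<in> {-2<..<-1} \<union> {1<..<2} \<longrightarrow> vr x = w x \<and> vp x = w x))"

end

theory Submission
  imports Defs
begin

text \<open>
  Piecewise \<open>H\<^sup>2\<close> functions on \<open>(-2,2)\<close> are exactly those obtained by integrating an \<open>L\<^sup>2\<close> function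
  \<open>h\<close> twice, a step function with finitely many jumps being added after each integration. Taking
  the absolutely continuous part of a derivative just drops the jumps.

  Testing minimality with \<open>u + t \<phi>\<close>, \<open>\<phi>\<close> smooth with compact support in \<open>(-1,1)\<close>, leaves the jumps
  unchanged and gives the Euler equation for \<open>h\<close> in the sense of distributions. By the lemma of
  du Bois-Reymond \<open>h\<close> agrees with an \<open>H\<^sup>2\<close> function \<open>U\<close>. Testing with a cubic polynomial cut off at a
  jump point \<open>x\<close> of \<open>u\<close> or of its derivative, which vanishes to second order at the far end of the
  interval, does not increase the counting terms, and integration by parts leaves only the
  boundary terms \<open>U(x) \<phi>'(x) = U'(x) \<phi>(x)\<close>.
  The smoothness of \<open>U\<close> across \<open>x\<close> gives both one-sided conditions at once. In part (II) the same
  argument applies to \<open>u\<^sub>r\<close> with \<open>u\<^sub>p\<close> in the role of \<open>w\<close>.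
\<close>

section \<open>Smooth functions and test functions\<close>

text \<open>\<open>ac_deriv\<close> and \<open>weak_deriv\<close> are choice operators, determined
  up to null sets only, so nothing can be said about \<open>dot u\<close> or \<open>ddot u\<close>
  before uniqueness is known. For \<open>ac_deriv\<close> this is uniqueness of the Lebesgue
  decomposition, for identities that are merely tested against smooth functions; this is where the
  bumps and a Dynkin class argument come in. Absolute continuity is encoded by an integral formula,
  and integration by parts then amounts to Fubini on a triangle. The counting terms are not
  differentiable. The variations are such that for every real t no point costs more for
  \<open>u + t * \<phi>\<close> than for \<open>u\<close>; all other terms are quadratic in t, so
  minimality kills the linear coefficient. Where \<open>u\<close> jumps, the full price \<alpha> is
  paid already and, as \<beta> \<le> \<alpha>, value and slope may both be varied. At a mere crease
  the price is \<beta>, and only the slope may be varied unless \<alpha> = \<beta>. This is why the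
  third derivative is shown to vanish at fewer points than the second, and why equality of \<alpha>
  and \<beta> removes the difference.\<close>

definition smooth_fun :: "(real \<Rightarrow> real) \<Rightarrow> bool" where
  "smooth_fun f \<longleftrightarrow> (\<forall>k x. ((deriv ^^ k) f) differentiable (at x))"

text \<open>A coinduction principle: in a family closed under differentiation every iterated
  derivative stays in the family, so no formula for the k-th derivative is ever needed.\<close>

lemma smooth_fun_coinduct:
  assumes "f \<in> F"
    and "\<And>g. g \<in> F \<Longrightarrow> \<exists>g'\<in>F. \<forall>x. (g has_real_derivative g' x) (at x)"
  shows "smooth_fun f"
proof -
  have *: "(\<forall>x. g differentiable at x) \<and> deriv g \<in> F" if g: "g \<in> F" for g
  proof -
    obtain g' where g': "g' \<in> F" "\<forall>x. (g has_real_derivative g' x) (at x)"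
      using assms(2)[OF g] by blast
    have "deriv g = g'" using g'(2) by (auto simp: DERIV_imp_deriv)
    with g' show ?thesis by (auto simp: real_differentiable_def)
  qed
  have "(deriv ^^ k) f \<in> F" for k
    by (induction k) (use assms(1) * in auto)
  with * show ?thesis by (auto simp: smooth_fun_def)
qed

lemma smooth_fun_deriv: "smooth_fun f \<Longrightarrow> smooth_fun (deriv f)"
  unfolding smooth_fun_def by (metis funpow_Suc_right comp_apply)

lemma smooth_fun_has_deriv:
  "smooth_fun f \<Longrightarrow> (f has_real_derivative deriv f x) (at x)"
  unfolding smooth_fun_def using DERIV_deriv_iff_real_differentiable[of f x]
  by (metis funpow_0)

lemma smooth_fun_continuous: "smooth_fun f \<Longrightarrow> continuous_on S f"
  by (meson DERIV_isCont continuous_at_imp_continuous_on smooth_fun_has_deriv)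

lemma smooth_fun_antideriv:
  assumes "smooth_fun g" "\<And>x. (f has_real_derivative g x) (at x)"
  shows "smooth_fun f"
  by (rule smooth_fun_coinduct[of _ "insert f (Collect smooth_fun)"])
    (use assms smooth_fun_has_deriv smooth_fun_deriv in blast)+

lemma smooth_fun_affine:
  assumes "smooth_fun f" shows "smooth_fun (\<lambda>x. c * f (a * x + b))"
proof (rule smooth_fun_coinduct[of _ "{\<lambda>x. c * g (a * x + b) |c g. smooth_fun g}"])
  show "(\<lambda>x. c * f (a * x + b)) \<in> {\<lambda>x. c * g (a * x + b) |c g. smooth_fun g}"
    using assms by auto
next
  fix h assume "h \<in> {\<lambda>x. c * g (a * x + b) |c g. smooth_fun g}"
  then obtain c g where h: "h = (\<lambda>x. c * g (a * x + b))" "smooth_fun g" by blast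
  have "(h has_real_derivative (c * a) * deriv g (a * x + b)) (at x)" for x
    unfolding h by (rule derivative_eq_intros DERIV_chain2[OF smooth_fun_has_deriv[OF h(2)]] refl)+ simp
  then show "\<exists>g'\<in>{\<lambda>x. c * g (a * x + b) |c g. smooth_fun g}. \<forall>x. (h has_real_derivative g' x) (at x)"
    using smooth_fun_deriv[OF h(2)] by (intro bexI[of _ "\<lambda>x. (c * a) * deriv g (a * x + b)"]) auto
qed

lemma smooth_fun_add:
  assumes "smooth_fun f" "smooth_fun g" shows "smooth_fun (\<lambda>x. f x + g x)"
proof (rule smooth_fun_coinduct[of _ "{\<lambda>x. f x + g x |f g. smooth_fun f \<and> smooth_fun g}"])
  fix h assume "h \<in> {\<lambda>x. f x + g x |f g. smooth_fun f \<and> smooth_fun g}"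
  then obtain f g where h: "h = (\<lambda>x. f x + g x)" "smooth_fun f" "smooth_fun g" by blast
  show "\<exists>g'\<in>{\<lambda>x. f x + g x |f g. smooth_fun f \<and> smooth_fun g}. \<forall>x. (h has_real_derivative g' x) (at x)"
    unfolding h(1) using h(2,3)
    by (intro bexI[of _ "\<lambda>x. deriv f x + deriv g x"])
      (auto intro!: DERIV_add smooth_fun_has_deriv smooth_fun_deriv)
qed (use assms in auto)

text \<open>The Leibniz rule turns a product into a sum of two products. Finite sums of products are
  closed under differentiation and so fit \<open>smooth_fun_coinduct\<close>.\<close>

inductive_set prod_span :: "(real \<Rightarrow> real) set" where
  prod: "smooth_fun f \<Longrightarrow> smooth_fun g \<Longrightarrow> (\<lambda>x. f x * g x) \<in> prod_span"
| add: "h \<in> prod_span \<Longrightarrow> k \<in> prod_span \<Longrightarrow> (\<lambda>x. h x + k x) \<in> prod_span"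

lemma smooth_fun_mult:
  assumes "smooth_fun f" "smooth_fun g" shows "smooth_fun (\<lambda>x. f x * g x)"
proof (rule smooth_fun_coinduct[of _ prod_span])
  show "(\<lambda>x. f x * g x) \<in> prod_span" using assms by (rule prod_span.prod)
next
  fix h assume "h \<in> prod_span"
  then show "\<exists>g'\<in>prod_span. \<forall>x. (h has_real_derivative g' x) (at x)"
  proof induction
    case (prod f g)
    have "((\<lambda>x. f x * g x) has_real_derivative deriv f x * g x + deriv g x * f x) (at x)" for x
      by (intro DERIV_mult smooth_fun_has_deriv prod)
    moreover have "(\<lambda>x. deriv f x * g x + deriv g x * f x) \<in> prod_span"
      by (intro prod_span.intros smooth_fun_deriv prod)
    ultimately show ?case by (intro bexI) auto
  next
    case (add h k)
    then obtain h' k' where "h' \<in> prod_span" "k' \<in> prod_span"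
      "\<forall>x. (h has_real_derivative h' x) (at x)" "\<forall>x. (k has_real_derivative k' x) (at x)" by blast
    then show ?case
      by (intro bexI[of _ "\<lambda>x. h' x + k' x"]) (auto intro: DERIV_add prod_span.add)
  qed
qed

text \<open>The polynomial factors in \<open>1 / x\<close> make the family closed under
  differentiation; \<open>flat 1\<close> is the classical smooth function that vanishes exactly on
  the nonpositive half-line.\<close>

definition flat :: "real poly \<Rightarrow> real \<Rightarrow> real" where
  "flat p x = (if x > 0 then poly p (1 / x) * exp (- 1 / x) else 0)"

lemma poly_exp_tendsto: "((\<lambda>y. poly p y * exp (- y)) \<longlongrightarrow> 0) (at_top :: real filter)"
proof -
  have "((\<lambda>y. \<Sum>i\<le>degree p. coeff p i * (y ^ i / exp y)) \<longlongrightarrow> (\<Sum>i\<le>degree p. coeff p i * 0)) at_top"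
    by (intro tendsto_intros tendsto_power_div_exp_0)
  then show ?thesis
    by (simp add: poly_altdef exp_minus divide_inverse sum_distrib_right mult.assoc)
qed

text \<open>For x > 0 the chain rule yields the factor 1/x^2 times \<open>p - pderiv p\<close> at
  1/x, and \<open>[:0, 0, 1:]\<close> is the polynomial X^2. At 0 the exponential beats every power
  of 1/x.\<close>

lemma flat_has_deriv:
  "(flat p has_real_derivative flat ([:0, 0, 1:] * (p - pderiv p)) x) (at x)"
proof -
  consider "x > 0" | "x < 0" | "x = 0" by linarith
  then show ?thesis
  proof cases
    case 1
    have i: "((\<lambda>x. 1 / x) has_real_derivative - (1 / x * (1 / x))) (at x)"
      using 1 by (auto intro!: derivative_eq_intros simp: power2_eq_square)
    have "((\<lambda>x. poly p (1 / x) * exp (- (1 / x))) has_real_derivative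
        (poly (pderiv p) (1 / x) * - (1 / x * (1 / x))) * exp (- (1 / x))
        + exp (- (1 / x)) * - (- (1 / x * (1 / x))) * poly p (1 / x)) (at x)"
      by (intro DERIV_mult DERIV_chain2[OF poly_DERIV i] DERIV_chain2[OF DERIV_exp] DERIV_minus i)
    then have "((\<lambda>x. poly p (1 / x) * exp (- 1 / x)) has_real_derivative
        flat ([:0, 0, 1:] * (p - pderiv p)) x) (at x)"
      using 1 by (simp add: flat_def algebra_simps)
    moreover have "\<forall>\<^sub>F y in nhds x. flat p y = poly p (1 / y) * exp (- 1 / y)"
      using 1 by (auto simp: eventually_nhds flat_def intro!: exI[of _ "{0<..}"])
    ultimately show ?thesis
      using DERIV_cong_ev[of x x "flat p" "\<lambda>y. poly p (1 / y) * exp (- 1 / y)"] by blast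
  next
    case 2
    have "\<forall>\<^sub>F y in nhds x. flat p y = 0"
      using 2 by (auto simp: eventually_nhds flat_def intro!: exI[of _ "{..<0}"])
    then show ?thesis
      using 2 DERIV_cong_ev[of x x "flat p" "\<lambda>_. 0" "flat ([:0, 0, 1:] * (p - pderiv p)) x" 0]
      by (auto simp: flat_def)
  next
    case 3
    have "((\<lambda>y. (flat p y - flat p 0) / (y - 0)) \<longlongrightarrow> 0) (at 0)"
    proof (rule filterlim_split_at)
      show "((\<lambda>y. (flat p y - flat p 0) / (y - 0)) \<longlongrightarrow> 0) (at_left 0)"
      proof (rule tendsto_eventually)
        show "\<forall>\<^sub>F y in at_left 0. (flat p y - flat p 0) / (y - 0) = 0"
          by (auto simp: eventually_at_filter flat_def)
      qed
      \<comment> \<open>Dividing by y multiplies the polynomial in 1/y by X, so the difference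
        quotient is again a function of the family, with polynomial
        \<open>pCons 0 p\<close>.\<close>
      have "((\<lambda>y. poly (pCons 0 p) (inverse y) * exp (- inverse y)) \<longlongrightarrow> 0) (at_right 0)"
        by (rule filterlim_compose[OF poly_exp_tendsto filterlim_inverse_at_top_right])
      moreover have "\<forall>\<^sub>F y in at_right 0. poly (pCons 0 p) (inverse y) * exp (- inverse y)
          = (flat p y - flat p 0) / (y - 0)"
        by (auto simp: eventually_at_filter flat_def field_simps)
      ultimately show "((\<lambda>y. (flat p y - flat p 0) / (y - 0)) \<longlongrightarrow> 0) (at_right 0)"
        by (rule Lim_transform_eventually)
    qed
    moreover have "flat ([:0, 0, 1:] * (p - pderiv p)) 0 = 0" by (simp add: flat_def)
    ultimately show ?thesis unfolding 3 has_field_derivative_iff by (simp only:)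
  qed
qed

lemma smooth_fun_flat: "smooth_fun (flat p)"
  by (rule smooth_fun_coinduct[of _ "range flat"]) (use flat_has_deriv in blast)+

section \<open>Test functions on an interval\<close>

lemma test_function_iff:
  "test_function \<Omega> \<phi> \<longleftrightarrow> smooth_fun \<phi> \<and> compact (closure {x. \<phi> x \<noteq> 0}) \<and> closure {x. \<phi> x \<noteq> 0} \<subseteq> \<Omega>"
proof -
  have "(\<forall>k. Ck_on k UNIV \<phi>) \<longleftrightarrow> smooth_fun \<phi>"
  proof
    assume "\<forall>k. Ck_on k UNIV \<phi>"
    then show "smooth_fun \<phi>" unfolding Ck_on_def smooth_fun_def by (meson UNIV_I lessI)
  next
    assume "smooth_fun \<phi>"
    then show "\<forall>k. Ck_on k UNIV \<phi>"
      unfolding Ck_on_def smooth_fun_def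
      by (auto intro!: continuous_at_imp_continuous_on differentiable_imp_continuous_within)
  qed
  then show ?thesis by (auto simp: test_function_def)
qed

lemma test_function_mono: "test_function S \<phi> \<Longrightarrow> S \<subseteq> T \<Longrightarrow> test_function T \<phi>"
  by (auto simp: test_function_def)

lemma test_function_smooth: "test_function S \<phi> \<Longrightarrow> smooth_fun \<phi>"
  by (auto simp: test_function_iff)

lemma test_function_has_deriv:
  "test_function S \<phi> \<Longrightarrow> (\<phi> has_real_derivative deriv \<phi> x) (at x)"
  by (rule smooth_fun_has_deriv[OF test_function_smooth])

lemma test_function_continuous: "test_function S \<phi> \<Longrightarrow> continuous_on T \<phi>"
  by (rule smooth_fun_continuous[OF test_function_smooth])

lemma test_function_zero: "test_function S \<phi> \<Longrightarrow> x \<notin> S \<Longrightarrow> \<phi> x = 0"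
  using closure_subset[of "{x. \<phi> x \<noteq> 0}"] unfolding test_function_def by blast

lemma test_function_interval: "test_function {A<..<B} \<phi> \<Longrightarrow> \<phi> x \<noteq> 0 \<Longrightarrow> A < x \<and> x < B"
  using test_function_zero[of "{A<..<B}" \<phi> x] by auto

lemma test_function_deriv:
  assumes "test_function S \<phi>" shows "test_function S (deriv \<phi>)"
proof -
  have "deriv \<phi> x = 0" if x: "x \<notin> closure {x. \<phi> x \<noteq> 0}" for x
  proof -
    have "\<forall>\<^sub>F y in nhds x. \<phi> y = 0"
      unfolding eventually_nhds using x closure_subset[of "{x. \<phi> x \<noteq> 0}"]
      by (intro exI[of _ "- closure {x. \<phi> x \<noteq> 0}"]) auto
    then have "(\<phi> has_real_derivative 0) (at x)"
      using DERIV_cong_ev[of x x "\<phi>" "\<lambda>_. 0" 0 0] by auto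
    then show ?thesis by (rule DERIV_imp_deriv)
  qed
  then have "{x. deriv \<phi> x \<noteq> 0} \<subseteq> closure {x. \<phi> x \<noteq> 0}" by blast
  then have "closure {x. deriv \<phi> x \<noteq> 0} \<subseteq> closure {x. \<phi> x \<noteq> 0}"
    by (metis closure_closed closed_closure closure_mono)
  with assms show ?thesis
    unfolding test_function_iff
    by (meson bounded_subset closed_closure compact_eq_bounded_closed smooth_fun_deriv subset_trans)
qed

lemma test_functionI:
  assumes "smooth_fun \<phi>" "\<And>x. x \<notin> {c..d} \<Longrightarrow> \<phi> x = 0" "{c..d} \<subseteq> S"
  shows "test_function S \<phi>"
proof -
  have "{x. \<phi> x \<noteq> 0} \<subseteq> {c..d}" using assms(2) by blast
  then have *: "closure {x. \<phi> x \<noteq> 0} \<subseteq> {c..d}" by (simp add: closure_minimal)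
  then have "compact (closure {x. \<phi> x \<noteq> 0})"
    by (meson bounded_closed_interval bounded_subset closed_closure compact_eq_bounded_closed)
  with * assms show ?thesis by (auto simp: test_function_iff)
qed

lemma test_function_support:
  assumes "test_function {A<..<B} \<phi>" "A < B"
  obtains c d where "A < c" "c \<le> d" "d < B" "\<And>x. x \<notin> {c..d} \<Longrightarrow> \<phi> x = 0"
proof (cases "{x. \<phi> x \<noteq> 0} = {}")
  case True
  then show ?thesis using that[of "(A+B)/2" "(A+B)/2"] assms by (auto simp: field_simps)
next
  case False
  define K where "K = closure {x. \<phi> x \<noteq> 0}"
  have K: "compact K" "K \<noteq> {}" "K \<subseteq> {A<..<B}"
    using assms(1) False by (auto simp: test_function_def K_def)
  obtain c where c: "c \<in> K" "\<forall>x\<in>K. c \<le> x" using compact_attains_inf[OF K(1,2)] by blast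
  obtain d where d: "d \<in> K" "\<forall>x\<in>K. x \<le> d" using compact_attains_sup[OF K(1,2)] by blast
  have nz: "x \<in> K" if "\<phi> x \<noteq> 0" for x
    using that closure_subset[of "{x. \<phi> x \<noteq> 0}"] unfolding K_def by blast
  show ?thesis
  proof (rule that[of c d])
    show "A < c" "d < B" "c \<le> d" using c d K(3) by auto
    show "\<phi> x = 0" if "x \<notin> {c..d}" for x
      using that nz[of x] c(2) d(2) by auto
  qed
qed

text \<open>Since \<open>exp (-1/y) \<longlonglongrightarrow> 1\<close> for \<open>y \<longlonglongrightarrow> \<infinity>\<close>, these bumps exhaust the indicator of \<open>(c,d)\<close>.\<close>

definition bump :: "real \<Rightarrow> real \<Rightarrow> nat \<Rightarrow> real \<Rightarrow> real" where
  "bump c d n x = flat 1 (real n * (x - c) - 1) * flat 1 (real n * (d - x) - 1)"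

lemma flat1_bounds: "0 \<le> flat 1 x" "flat 1 x \<le> 1"
  by (auto simp: flat_def)

lemma bump_bounds: "0 \<le> bump c d n x" "bump c d n x \<le> 1"
  using flat1_bounds by (auto simp: bump_def intro!: mult_le_one)

lemma test_function_bump:
  assumes "{c<..<d} \<subseteq> S" shows "test_function S (bump c d n)"
proof (cases "n = 0")
  case True
  then have "bump c d n = (\<lambda>x. 0)" by (auto simp: bump_def flat_def)
  moreover have "smooth_fun (\<lambda>x. 0)"
    by (rule smooth_fun_coinduct[of _ "{\<lambda>x. 0}"]) auto
  \<comment> \<open>The empty interval from 1 to 0 serves as the support of the zero
    function.\<close>
  ultimately show ?thesis by (intro test_functionI[of _ 1 0]) auto
next
  case False
  have "smooth_fun (bump c d n)"
  proof -
    have "smooth_fun (\<lambda>x. (1 * flat 1 (real n * x + (- real n * c - 1))) * (1 * flat 1 ((- real n) * x + (real n * d - 1))))"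
      by (intro smooth_fun_mult smooth_fun_affine smooth_fun_flat)
    then show ?thesis by (simp add: bump_def[abs_def] algebra_simps)
  qed
  then show ?thesis
  proof (rule test_functionI)
    \<comment> \<open>Each factor vanishes unless its argument is positive, so the support keeps the
      distance 1/n from both ends.\<close>
    show "bump c d n x = 0" if "x \<notin> {c + 1 / real n..d - 1 / real n}" for x
      using that False by (auto simp: bump_def flat_def field_simps)
    show "{c + 1 / real n..d - 1 / real n} \<subseteq> S"
    proof
      fix x assume "x \<in> {c + 1 / real n..d - 1 / real n}"
      moreover have "1 / real n > 0" using False by simp
      ultimately have "x \<in> {c<..<d}" unfolding atLeastAtMost_iff greaterThanLessThan_iff by linarith
      then show "x \<in> S" using assms by blast
    qed
  qed
qed

lemma flat1_tendsto: "y > 0 \<Longrightarrow> (\<lambda>n. flat 1 (real n * y - 1)) \<longlonglongrightarrow> 1"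
proof -
  assume y: "y > 0"
  have lim: "filterlim (\<lambda>n. real n * y - 1) at_top sequentially"
    using filterlim_tendsto_add_at_top[OF tendsto_const[of "- 1"]
        filterlim_at_top_mult_tendsto_pos[OF tendsto_const y filterlim_real_sequentially]]
    by simp
  have "((\<lambda>z::real. exp (- inverse z)) \<longlongrightarrow> exp (- 0)) at_top"
    by (rule tendsto_exp[OF tendsto_minus[OF tendsto_inverse_0_at_top[OF filterlim_ident]]])
  then have "((\<lambda>z::real. exp (- 1 / z)) \<longlongrightarrow> 1) at_top" by (simp add: divide_inverse)
  from filterlim_compose[OF this lim]
  have "(\<lambda>n. exp (- 1 / (real n * y - 1))) \<longlonglongrightarrow> 1" .
  moreover have "\<forall>\<^sub>F n in sequentially. exp (- 1 / (real n * y - 1)) = flat 1 (real n * y - 1)"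
    using filterlim_at_top_dense[THEN iffD1, OF lim, rule_format, of 0]
    by eventually_elim (simp add: flat_def)
  ultimately show ?thesis by (rule Lim_transform_eventually)
qed

lemma bump_tendsto: "(\<lambda>n. bump c d n x) \<longlonglongrightarrow> indicator {c<..<d} x"
proof (cases "x \<in> {c<..<d}")
  case True
  then show ?thesis
    using tendsto_mult[OF flat1_tendsto[of "x - c"] flat1_tendsto[of "d - x"]]
    by (simp add: bump_def)
next
  case False
  have "bump c d n x = 0" for n
  proof -
    have "real n * (x - c) \<le> 0 \<or> real n * (d - x) \<le> 0"
      using False by (auto simp: mult_le_0_iff)
    then show ?thesis by (auto simp: bump_def flat_def)
  qed
  then show ?thesis using False by simp
qed

lemma test_function_add:
  assumes "test_function {A<..<B} \<phi>" "test_function {A<..<B} \<psi>" "A < B"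
  shows "test_function {A<..<B} (\<lambda>x. \<phi> x + k * \<psi> x)"
proof -
  obtain c d where c: "A < c" "c \<le> d" "d < B" "\<And>x. x \<notin> {c..d} \<Longrightarrow> \<phi> x = 0"
    using test_function_support[OF assms(1,3)] by metis
  obtain c' d' where d: "A < c'" "c' \<le> d'" "d' < B" "\<And>x. x \<notin> {c'..d'} \<Longrightarrow> \<psi> x = 0"
    using test_function_support[OF assms(2,3)] by metis
  have "smooth_fun (\<lambda>x. \<phi> x + k * \<psi> (1 * x + 0))"
    by (intro smooth_fun_add smooth_fun_affine test_function_smooth) (use assms in auto)
  then show ?thesis
    by (intro test_functionI[of _ "min c c'" "max d d'"])
      (use c(1,3) d(1,3) in \<open>auto simp: c(4) d(4) min_def max_def split: if_splits\<close>)
qed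

text \<open>The primitive starting at A vanishes to the left of the support anyway; the zero mean
  makes it vanish to the right as well, so that its support is compact in the open interval.\<close>

lemma test_function_antideriv:
  assumes "test_function {A<..<B} \<theta>" "A < B" "integral {A..B} \<theta> = 0"
  obtains \<phi> where "test_function {A<..<B} \<phi>" "deriv \<phi> = \<theta>"
proof -
  obtain c d where c: "A < c" "c \<le> d" "d < B" and z: "\<And>x. x \<notin> {c..d} \<Longrightarrow> \<theta> x = 0"
    using test_function_support[OF assms(1,2)] by metis
  have cont: "continuous_on S \<theta>" for S by (rule test_function_continuous[OF assms(1)])
  define \<phi> where "\<phi> x = (if x \<ge> A then integral {A..x} \<theta> else 0)" for x
  have 1: "\<phi> x = 0" if "x < c" for x
  proof -
    have "integral {A..x} \<theta> = integral {A..x} (\<lambda>x. 0)"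
      by (rule integral_cong) (use z that in auto)
    then show ?thesis by (simp add: \<phi>_def)
  qed
  have 2: "\<phi> x = 0" if "x > d" for x
  proof (cases "x \<le> B")
    case True
    have "integral {x..B} \<theta> = integral {x..B} (\<lambda>x. 0)"
      by (rule integral_cong) (use z that in auto)
    moreover have "integral {A..x} \<theta> + integral {x..B} \<theta> = integral {A..B} \<theta>"
      by (rule Henstock_Kurzweil_Integration.integral_combine)
        (use that c True cont in \<open>auto intro: integrable_continuous_real\<close>)
    ultimately show ?thesis using assms(3) by (simp add: \<phi>_def)
  next
    case False
    have "integral {B..x} \<theta> = integral {B..x} (\<lambda>x. 0)"
      by (rule integral_cong) (use z c in auto)
    moreover have "integral {A..B} \<theta> + integral {B..x} \<theta> = integral {A..x} \<theta>"
      by (rule Henstock_Kurzweil_Integration.integral_combine)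
        (use that c False cont in \<open>auto intro: integrable_continuous_real\<close>)
    ultimately show ?thesis using assms(3) by (simp add: \<phi>_def)
  qed
  have D: "(\<phi> has_real_derivative \<theta> x) (at x)" for x
  proof (cases "x < c")
    case True
    have "\<forall>\<^sub>F y in nhds x. \<phi> y = 0"
      using True 1 by (auto simp: eventually_nhds intro!: exI[of _ "{..<c}"])
    then show ?thesis
      using DERIV_cong_ev[of x x \<phi> "\<lambda>_. 0" 0 0] z[of x] True by auto
  next
    case False
    have "((\<lambda>u. integral {A..u} \<theta>) has_real_derivative \<theta> x) (at x within {A..x+1})"
      by (rule integral_has_real_derivative) (use False c cont in auto)
    then have "((\<lambda>u. integral {A..u} \<theta>) has_real_derivative \<theta> x) (at x)"
      using at_within_interior[of x "{A..x+1}"] False c by (auto simp: interior_atLeastAtMost_real)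
    moreover have "\<forall>\<^sub>F y in nhds x. \<phi> y = integral {A..y} \<theta>"
      using False c by (auto simp: eventually_nhds \<phi>_def intro!: exI[of _ "{A<..}"])
    ultimately show ?thesis
      using DERIV_cong_ev[of x x \<phi> "\<lambda>u. integral {A..u} \<theta>"  "\<theta> x" "\<theta> x"] by auto
  qed
  show ?thesis
  proof
    show "test_function {A<..<B} \<phi>"
      by (rule test_functionI[of _ c d])
        (use smooth_fun_antideriv[OF test_function_smooth[OF assms(1)] D] 1 2 c in auto)
    show "deriv \<phi> = \<theta>" using D by (auto simp: DERIV_imp_deriv)
  qed
qed

section \<open>Singular measures and absolutely continuous functions\<close>

lemma absolutely_integrable_open_iff:
  fixes f :: "real \<Rightarrow> real"
  shows "f absolutely_integrable_on {A<..<B} \<longleftrightarrow> f absolutely_integrable_on {A..B}"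
proof (rule absolutely_integrable_spike_set_eq)
  show "negligible {x \<in> {A<..<B} - {A..B}. f x \<noteq> 0}" by (rule negligible_subset[of "{}"]) auto
  show "negligible {x \<in> {A..B} - {A<..<B}. f x \<noteq> 0}" by (rule negligible_subset[of "{A, B}"]) auto
qed

lemma absolutely_integrable_AE_cong:
  fixes f g :: "real \<Rightarrow> real"
  assumes "f absolutely_integrable_on {A..B}" "AE x in lebesgue. x \<in> {A<..<B} \<longrightarrow> f x = g x"
  shows "g absolutely_integrable_on {A..B}" and "integral {A..B} f = integral {A..B} g"
proof -
  have n: "negligible ({x. \<not> (x \<in> {A<..<B} \<longrightarrow> f x = g x)} \<union> {A, B})"
  proof -
    obtain N where "N \<in> null_sets lebesgue" "{x. \<not> (x \<in> {A<..<B} \<longrightarrow> f x = g x)} \<subseteq> N"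
      using assms(2) unfolding eventually_ae_filter space_completion by auto
    then show ?thesis
      by (meson negligible_Un negligible_finite finite.emptyI finite.insertI negligible_iff_null_sets negligible_subset)
  qed
  show "g absolutely_integrable_on {A..B}"
    by (rule absolutely_integrable_spike[OF assms(1) n]) auto
  show "integral {A..B} f = integral {A..B} g"
    by (rule integral_spike[OF n]) auto
qed

lemma absolutely_integrable_mult_continuous:
  fixes f \<phi> :: "real \<Rightarrow> real"
  assumes "f absolutely_integrable_on {A..B}" "continuous_on {A..B} \<phi>"
  shows "(\<lambda>x. f x * \<phi> x) absolutely_integrable_on {A..B}"
proof -
  have "(\<lambda>x. \<phi> x * f x) absolutely_integrable_on {A..B}"
  proof (rule absolutely_integrable_bounded_measurable_product_real[OF _ _ _ assms(1)])
    show "\<phi> \<in> borel_measurable (lebesgue_on {A..B})"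
      using assms(2) by (rule continuous_imp_measurable_on_sets_lebesgue) auto
    show "bounded (\<phi> ` {A..B})"
      using assms(2) by (simp add: compact_continuous_image compact_imp_bounded)
  qed auto
  then show ?thesis by (simp add: mult.commute)
qed

lemma distr_of_eq_integral:
  fixes f \<phi> :: "real \<Rightarrow> real"
  assumes f: "f absolutely_integrable_on {A..B}" and \<phi>: "test_function {A<..<B} \<phi>"
  shows "distr_of f \<phi> = integral {A..B} (\<lambda>x. f x * \<phi> x)"
proof -
  have "distr_of f \<phi> = (LINT x:{A..B}|lebesgue. f x * \<phi> x)"
    unfolding distr_of_def set_lebesgue_integral_def
    by (rule Bochner_Integration.integral_cong) (use test_function_interval[OF \<phi>] in \<open>force simp: indicator_def\<close>)+
  also have "\<dots> = integral {A..B} (\<lambda>x. f x * \<phi> x)"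
    by (intro set_lebesgue_integral_eq_integral absolutely_integrable_mult_continuous f
        test_function_continuous[OF \<phi>])
  finally show ?thesis .
qed

lemma locally_integrableI:
  fixes f :: "real \<Rightarrow> real"
  assumes "f absolutely_integrable_on {A..B}" shows "locally_integrable {A<..<B} f"
  unfolding locally_integrable_def
proof safe
  fix K :: "real set" assume K: "compact K" "K \<subseteq> {A<..<B}"
  have "K \<in> sets lebesgue" using K(1) by (simp add: borel_compact)
  then show "f absolutely_integrable_on K"
    using K(2) by (intro set_integrable_subset[OF assms]) auto
qed

lemma borel_measurable_indicator_mult:
  fixes f :: "real \<Rightarrow> real"
  shows "f \<in> borel_measurable lebesgue \<Longrightarrow> S \<in> sets borel \<Longrightarrow>
    (\<lambda>x. indicator S x * f x) \<in> borel_measurable lebesgue"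
  by (intro borel_measurable_times borel_measurable_indicator) auto

text \<open>\<open>density_zero\<close> is applied over \<open>lborel\<close>, while
  \<open>H\<close> is only Lebesgue measurable; a Borel representative of \<open>H\<close> mediates
  between the two.\<close>

lemma AE_zero_from_borel_integrals:
  fixes H :: "real \<Rightarrow> real"
  assumes "integrable lebesgue H"
    and "\<And>S. S \<in> sets borel \<Longrightarrow> (LINT x:S|lebesgue. H x) = 0"
  shows "AE x in lebesgue. H x = 0"
proof -
  obtain H' where H': "H' \<in> borel_measurable lborel" and eq: "AE x in lborel. H x = H' x"
    using completion_ex_borel_measurable_real[of H lborel] assms(1) by auto
  then have eq': "AE x in lebesgue. H x = H' x" by (simp add: AE_completion)
  have [measurable]: "H' \<in> borel_measurable borel" using H' by simp
  have "integrable lebesgue H'"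
    by (rule Bochner_Integration.integrable_cong_AE_imp[OF assms(1)])
      (use eq' H' in \<open>auto simp: measurable_completion\<close>)
  then have int: "integrable lborel H'" using H' by (simp add: integrable_completion)
  have "AE x in lborel. H' x = 0"
  proof (rule sigma_finite_measure.density_zero[OF lborel.sigma_finite_measure_axioms int])
    fix S :: "real set" assume S: "S \<in> sets lborel"
    have "(LINT x:S|lborel. H' x) = (LINT x:S|lebesgue. H' x)"
      unfolding set_lebesgue_integral_def using S by (intro integral_completion[symmetric]) auto
    also have "\<dots> = (LINT x:S|lebesgue. H x)"
      unfolding set_lebesgue_integral_def
      by (rule integral_cong_AE) (use eq' S assms(1) H' in \<open>auto simp: measurable_completion intro!: borel_measurable_indicator_mult\<close>)
    finally show "(LINT x:S|lborel. H' x) = 0" using assms(2) S by simp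
  qed
  then have "AE x in lebesgue. H' x = 0" by (rule AE_completion)
  with eq' show ?thesis by auto
qed

section \<open>Uniqueness of the Lebesgue decomposition\<close>

definition signed :: "real measure \<Rightarrow> real measure \<Rightarrow> real measure \<Rightarrow> real measure \<Rightarrow> real set \<Rightarrow> real" where
  "signed M N M' N' S = measure M S - measure N S - (measure M' S - measure N' S)"

text \<open>Here \<open>h\<close> stands for the difference of two densities, the four measures for
  the two singular parts. The bumps carry the identity over to open intervals, a Dynkin class
  argument from there to Borel sets. A Borel set minus \<open>Z\<close> has measure zero for all
  four measures, while removing the Lebesgue null set \<open>Z\<close> does not change the integral
  of \<open>h\<close>.\<close>

lemma AE_zero_from_singular_measures:
  fixes h :: "real \<Rightarrow> real"
  assumes h: "h absolutely_integrable_on {A..B}"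
    and fin: "finite_measure M" "finite_measure N" "finite_measure M'" "finite_measure N'"
    and sets: "sets M = sets borel" "sets N = sets borel" "sets M' = sets borel" "sets N' = sets borel"
    and Z: "Z \<in> null_sets lborel" "emeasure M (- Z) = 0" "emeasure N (- Z) = 0"
      "emeasure M' (- Z) = 0" "emeasure N' (- Z) = 0"
    and eq: "\<And>\<phi>. test_function {A<..<B} \<phi> \<Longrightarrow> distr_of h \<phi> =
      (LINT x|M. \<phi> x) - (LINT x|N. \<phi> x) - ((LINT x|M'. \<phi> x) - (LINT x|N'. \<phi> x))"
  shows "AE x in lebesgue. x \<in> {A<..<B} \<longrightarrow> h x = 0"
proof -
  define H where "H x = indicator {A<..<B} x * h x" for x
  let ?\<nu> = "signed M N M' N'"
  have intH: "integrable lebesgue H"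
    using absolutely_integrable_open_iff[THEN iffD2, OF h]
    unfolding set_integrable_def by (simp add: H_def[abs_def])
  have [measurable]: "H \<in> borel_measurable lebesgue" using intH by auto
  have lim: "(\<lambda>n. LINT x|L. bump c d n x) \<longlonglongrightarrow> measure L {c<..<d}"
    if "finite_measure L" "sets L = sets borel" for L :: "real measure" and c d
  proof -
    interpret finite_measure L by fact
    note [measurable_cong] = that(2)
    have [measurable]: "bump c d n \<in> borel_measurable borel" for n
      by (intro borel_measurable_continuous_onI test_function_continuous[OF test_function_bump[OF subset_UNIV]])
    have "(\<lambda>n. LINT x|L. bump c d n x) \<longlonglongrightarrow> (LINT x|L. indicator {c<..<d} x)"
    proof (rule integral_dominated_convergence[where w = "\<lambda>_. 1"])
      show "AE x in L. (\<lambda>n. bump c d n x) \<longlonglongrightarrow> indicator {c<..<d} x" by (simp add: bump_tendsto)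
      show "AE x in L. norm (bump c d n x) \<le> 1" for n
        using bump_bounds[of c d n] by simp
    qed auto
    then show ?thesis using sets_eq_imp_space_eq[OF that(2)] by simp
  qed
  have intervals: "(LINT x:{c<..<d}|lebesgue. H x) = ?\<nu> ({c<..<d} \<inter> {A<..<B})" for c d
  proof -
    \<comment> \<open>The bumps must be supported in (A,B), so an arbitrary interval is first cut
      down to it; hence the intersection in the set function.\<close>
    define c' d' where "c' = max c A" and "d' = min d B"
    have cd: "{c<..<d} \<inter> {A<..<B} = {c'<..<d'}" by (auto simp: c'_def d'_def)
    have test: "test_function {A<..<B} (bump c' d' n)" for n
      by (rule test_function_bump) (auto simp: c'_def d'_def)
    have "(\<lambda>n. LINT x|lebesgue. H x * bump c' d' n x) \<longlonglongrightarrow> (LINT x|lebesgue. H x * indicator {c'<..<d'} x)"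
    proof (rule integral_dominated_convergence[where w = "\<lambda>x. \<bar>H x\<bar>"])
      show "AE x in lebesgue. (\<lambda>n. H x * bump c' d' n x) \<longlonglongrightarrow> H x * indicator {c'<..<d'} x"
        by (auto intro!: tendsto_intros bump_tendsto)
      show "AE x in lebesgue. norm (H x * bump c' d' n x) \<le> \<bar>H x\<bar>" for n
        using bump_bounds[of c' d' n] by (auto simp: abs_mult mult_left_le)
      show "(\<lambda>x. H x * bump c' d' n x) \<in> borel_measurable lebesgue" for n
      proof -
        have "bump c' d' n \<in> borel_measurable borel"
          by (intro borel_measurable_continuous_onI test_function_continuous[OF test])
        then show ?thesis by (intro borel_measurable_times) (auto simp: measurable_completion)
      qed
    next
      have "(\<lambda>x. H x * indicator {c'<..<d'} x) = (\<lambda>x. indicator {c'<..<d'} x *\<^sub>R H x)" by auto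
      then show "(\<lambda>x. H x * indicator {c'<..<d'} x) \<in> borel_measurable lebesgue"
        using intH by (simp only:) (intro borel_measurable_scaleR borel_measurable_indicator; auto)
    qed (use intH in auto)
    moreover have "(LINT x|lebesgue. H x * bump c' d' n x) = distr_of h (bump c' d' n)" for n
      unfolding distr_of_def
      by (rule Bochner_Integration.integral_cong)
        (use test_function_interval[OF test] in \<open>auto simp: H_def indicator_def\<close>)
    moreover have "(\<lambda>n. distr_of h (bump c' d' n)) \<longlonglongrightarrow> ?\<nu> {c'<..<d'}"
      unfolding eq[OF test] signed_def by (intro tendsto_intros lim fin sets)
    ultimately have "(LINT x|lebesgue. H x * indicator {c'<..<d'} x) = ?\<nu> {c'<..<d'}"
      using LIMSEQ_unique by simp
    moreover have "(LINT x:{c<..<d}|lebesgue. H x) = (LINT x|lebesgue. H x * indicator {c'<..<d'} x)"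
      unfolding set_lebesgue_integral_def cd[symmetric]
      by (rule Bochner_Integration.integral_cong) (auto simp: H_def indicator_def)
    ultimately show ?thesis using cd by simp
  qed
  have setH: "set_integrable lebesgue S H" if "S \<in> sets borel" for S
    unfolding set_integrable_def real_scaleR_def mult.commute[of "indicator S _"]
    using that by (intro integrable_real_mult_indicator intH) auto
  have borel: "(LINT x:S|lebesgue. H x) = ?\<nu> (S \<inter> {A<..<B})" if "S \<in> sets borel" for S
  proof -
    let ?G = "range (\<lambda>(c, d). {c<..<d::real})"
    have G: "sets borel = sigma_sets UNIV ?G"
      by (subst borel_eq_box) (auto simp: box_real split_beta' full_SetCompr_eq image_def intro!: arg_cong[where f = "sigma_sets UNIV"])
    have "\<exists>e f. {a<..<b} \<inter> {c<..<d} = {e<..<f}" for a b c d :: real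
      by (intro exI[of _ "max a c"] exI[of _ "min b d"]) auto
    then have "Int_stable ?G"
      by (auto simp: Int_stable_def image_iff)
    moreover have "?G \<subseteq> Pow UNIV" by simp
    ultimately show ?thesis using that[unfolded G]
    proof (induct rule: sigma_sets_induct_disjoint)
      case (basic S)
      then show ?case using intervals by auto
    next
      case empty
      then show ?case by (simp add: signed_def set_lebesgue_integral_def)
    next
      case (compl S)
      then have S: "S \<in> sets borel" using G by simp
      \<comment> \<open>\<open>H\<close> vanishes outside (A,B), so its total integral is that over
        a single generating interval; subtraction then settles complements.\<close>
      have "(LINT x:UNIV|lebesgue. H x) = (LINT x:{A<..<B}|lebesgue. H x)"
        unfolding set_lebesgue_integral_def
        by (rule Bochner_Integration.integral_cong) (auto simp: H_def indicator_def)
      then have U: "(LINT x:UNIV|lebesgue. H x) = ?\<nu> {A<..<B}" using intervals[of A B] by simp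
      have "(LINT x:S \<union> (UNIV - S)|lebesgue. H x) = (LINT x:S|lebesgue. H x) + (LINT x:UNIV - S|lebesgue. H x)"
        using S by (intro set_integral_Un setH) auto
      then have "(LINT x:UNIV - S|lebesgue. H x) = ?\<nu> {A<..<B} - ?\<nu> (S \<inter> {A<..<B})"
        using U compl by simp
      moreover have "measure L ((UNIV - S) \<inter> {A<..<B}) = measure L {A<..<B} - measure L (S \<inter> {A<..<B})"
        if "finite_measure L" "sets L = sets borel" for L
      proof -
        have "(UNIV - S) \<inter> {A<..<B} = {A<..<B} - S \<inter> {A<..<B}" by blast
        then show ?thesis using S that by (simp add: finite_measure.finite_measure_Diff)
      qed
      ultimately show ?case using fin sets by (simp add: signed_def)
    next
      case (union F)
      then have F: "F i \<in> sets borel" for i unfolding G by auto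
      have "(LINT x:(\<Union>i. F i)|lebesgue. H x) = (\<Sum>i. LINT x:F i|lebesgue. H x)"
        using union(1) F by (intro lebesgue_integral_countable_add setH) (auto simp: disjoint_family_on_def)
      also have "\<dots> = (\<Sum>i. ?\<nu> (F i \<inter> {A<..<B}))" using union by simp
      also have "(\<lambda>i. ?\<nu> (F i \<inter> {A<..<B})) sums ?\<nu> (\<Union>i. F i \<inter> {A<..<B})"
        unfolding signed_def
      proof (intro sums_diff finite_measure.finite_measure_UNION fin)
        have "disjoint_family (\<lambda>i. F i \<inter> {A<..<B})"
          using union(1) by (auto simp: disjoint_family_on_def)
        then show "disjoint_family (\<lambda>i. F i \<inter> {A<..<B})" "disjoint_family (\<lambda>i. F i \<inter> {A<..<B})"
          "disjoint_family (\<lambda>i. F i \<inter> {A<..<B})" "disjoint_family (\<lambda>i. F i \<inter> {A<..<B})" by auto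
      qed (use F sets in auto)
      then have "(\<Sum>i. ?\<nu> (F i \<inter> {A<..<B})) = ?\<nu> ((\<Union>i. F i) \<inter> {A<..<B})"
        by (simp add: sums_iff)
      finally show ?case .
    qed
  qed
  have "AE x in lebesgue. H x = 0"
  proof (rule AE_zero_from_borel_integrals[OF intH])
    fix S :: "real set" assume S: "S \<in> sets borel"
    have Zb: "Z \<in> sets borel" "AE x in lebesgue. x \<notin> Z"
      using Z(1) by (auto simp: null_sets_completionI AE_not_in)
    have zero: "measure L ((S - Z) \<inter> {A<..<B}) = 0" if "sets L = sets borel" "emeasure L (- Z) = 0" for L
    proof -
      have "emeasure L ((S - Z) \<inter> {A<..<B}) \<le> emeasure L (- Z)"
        using Zb(1) that by (intro emeasure_mono) auto
      then show ?thesis using that by (simp add: measure_def)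
    qed
    have "(LINT x:S|lebesgue. H x) = (LINT x:S - Z|lebesgue. H x)"
      unfolding set_lebesgue_integral_def
    proof (rule integral_cong_AE)
      show "AE x in lebesgue. indicator S x *\<^sub>R H x = indicator (S - Z) x *\<^sub>R H x"
        using Zb(2) by eventually_elim (auto simp: indicator_def)
    qed (use Zb S in \<open>auto intro!: borel_measurable_indicator_mult\<close>)
    also have "\<dots> = ?\<nu> ((S - Z) \<inter> {A<..<B})" using S Zb by (intro borel) auto
    also have "\<dots> = 0" using zero sets Z by (simp add: signed_def)
    finally show "(LINT x:S|lebesgue. H x) = 0" .
  qed
  then show ?thesis by (auto simp: H_def)
qed


text \<open>Absolute continuity of \<open>F\<close> on [a,b] with derivative \<open>f\<close> almost
  everywhere. In the integral form \<open>f\<close> may be changed on null sets, and nothing is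
  asked of \<open>F\<close> outside the interval.\<close>

definition is_prim :: "real \<Rightarrow> real \<Rightarrow> (real \<Rightarrow> real) \<Rightarrow> (real \<Rightarrow> real) \<Rightarrow> bool" where
  "is_prim a b F f \<longleftrightarrow> f absolutely_integrable_on {a..b} \<and> (\<forall>x\<in>{a..b}. F x - F a = integral {a..x} f)"

lemma is_prim_eq: "is_prim a b F f \<Longrightarrow> x \<in> {a..b} \<Longrightarrow> F x = F a + integral {a..x} f"
  unfolding is_prim_def by (metis add.commute diff_add_cancel)

lemma absolutely_integrable_sub:
  fixes f :: "real \<Rightarrow> real"
  shows "f absolutely_integrable_on {a..b} \<Longrightarrow> a \<le> c \<Longrightarrow> d \<le> b \<Longrightarrow> f absolutely_integrable_on {c..d}"
  by (erule set_integrable_subset) auto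

lemma is_prim_ac: "is_prim a b F f \<Longrightarrow> f absolutely_integrable_on {a..b}"
  by (simp add: is_prim_def)

lemma is_prim_continuous: "is_prim a b F f \<Longrightarrow> continuous_on {a..b} F"
proof -
  assume F: "is_prim a b F f"
  have "continuous_on {a..b} (\<lambda>x. F a + integral {a..x} f)"
    by (intro continuous_intros indefinite_integral_continuous_1 set_lebesgue_integral_eq_integral is_prim_ac[OF F])
  then show ?thesis by (rule continuous_on_eq) (simp add: is_prim_eq[OF F, symmetric])
qed

lemma is_prim_diff:
  assumes "is_prim a b F f" "a \<le> c" "c \<le> d" "d \<le> b"
  shows "F d = F c + integral {c..d} f"
proof -
  have "integral {a..c} f + integral {c..d} f = integral {a..d} f"
    using assms by (intro Henstock_Kurzweil_Integration.integral_combine set_lebesgue_integral_eq_integral(1)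
        absolutely_integrable_sub[OF is_prim_ac[OF assms(1)]]) auto
  then show ?thesis
    using assms is_prim_eq[OF assms(1), of c] is_prim_eq[OF assms(1), of d] by auto
qed

lemma is_prim_subinterval:
  assumes "is_prim a b F f" "a \<le> c" "d \<le> b"
  shows "is_prim c d F f"
  unfolding is_prim_def
proof (intro conjI ballI)
  show "f absolutely_integrable_on {c..d}"
    by (rule absolutely_integrable_sub[OF is_prim_ac[OF assms(1)] assms(2,3)])
  show "F x - F c = integral {c..x} f" if "x \<in> {c..d}" for x
    using that assms is_prim_diff[OF assms(1), of c x] by auto
qed

lemma is_prim_lin:
  assumes "is_prim a b F f" "is_prim a b G g"
  shows "is_prim a b (\<lambda>x. F x + t * G x) (\<lambda>x. f x + t * g x)"
proof -
  have i: "integral {a..x} (\<lambda>x. f x + t * g x) = integral {a..x} f + t * integral {a..x} g"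
    if "x \<in> {a..b}" for x
  proof -
    have "f integrable_on {a..x}" "g integrable_on {a..x}"
      using assms that by (auto simp: is_prim_def intro!: set_lebesgue_integral_eq_integral(1)
          absolutely_integrable_sub[of a b _ a x])
    then show ?thesis
      by (subst Henstock_Kurzweil_Integration.integral_add) (auto intro: integrable_on_mult_right)
  qed
  show ?thesis
    unfolding is_prim_def
  proof (intro conjI ballI)
    show "(\<lambda>x. f x + t * g x) absolutely_integrable_on {a..b}"
      using assms by (intro set_integral_add(1)) (auto simp: is_prim_def)
    fix x assume x: "x \<in> {a..b}"
    show "F x + t * G x - (F a + t * G a) = integral {a..x} (\<lambda>x. f x + t * g x)"
      using i[OF x] is_prim_eq[OF assms(1) x] is_prim_eq[OF assms(2) x] by (simp add: ring_distribs)
  qed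
qed

lemma is_prim_AE_cong:
  assumes "is_prim a b F f" "AE x in lebesgue. x \<in> {a<..<b} \<longrightarrow> f x = g x"
  shows "is_prim a b F g"
proof -
  have "integral {a..x} f = integral {a..x} g" if "x \<in> {a..b}" for x
  proof (rule absolutely_integrable_AE_cong(2))
    show "f absolutely_integrable_on {a..x}"
      using that by (intro absolutely_integrable_sub[OF is_prim_ac[OF assms(1)]]) auto
    show "AE y in lebesgue. y \<in> {a<..<x} \<longrightarrow> f y = g y"
      using assms(2) by eventually_elim (use that in auto)
  qed
  then show ?thesis
    using assms absolutely_integrable_AE_cong(1)[OF is_prim_ac[OF assms(1)] assms(2)] by (auto simp: is_prim_def)
qed

lemma is_prim_integral:
  "f absolutely_integrable_on {a..b} \<Longrightarrow> is_prim a b (\<lambda>x. c + integral {a..x} f) f"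
  by (auto simp: is_prim_def)

lemma is_prim_FTC:
  assumes "\<And>x. x \<in> {a..b} \<Longrightarrow> (F has_real_derivative f x) (at x within {a..b})" "continuous_on {a..b} f"
  shows "is_prim a b F f"
  unfolding is_prim_def
proof safe
  show "f absolutely_integrable_on {a..b}" using assms(2) by (rule absolutely_integrable_continuous_real)
  fix x assume x: "x \<in> {a..b}"
  have "(f has_integral (F x - F a)) {a..x}"
  proof (rule fundamental_theorem_of_calculus)
    show "(F has_vector_derivative f y) (at y within {a..x})" if "y \<in> {a..x}" for y
      unfolding has_real_derivative_iff_has_vector_derivative[symmetric]
      by (rule DERIV_subset[of F _ _ "{a..b}"]) (use assms(1)[of y] x that in auto)
  qed (use x in auto)
  then show "F x - F a = integral {a..x} f" by (simp add: integral_unique)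
qed

lemma is_prim_test_function: "test_function S \<phi> \<Longrightarrow> is_prim a b \<phi> (deriv \<phi>)"
  by (intro is_prim_FTC has_field_derivative_at_within[OF test_function_has_deriv]
      test_function_continuous[OF test_function_deriv])

text \<open>Fubini for f(t) g(x) on the triangle t \<le> x: integrating over t first gives the first
  term, over x first the product of the total integrals minus the second term. This is integration
  by parts for primitives that vanish at a.\<close>

lemma double_integral_by_parts:
  fixes f g :: "real \<Rightarrow> real"
  assumes f: "f absolutely_integrable_on {a..b}" and g: "g absolutely_integrable_on {a..b}"
  shows "integral {a..b} (\<lambda>x. integral {a..x} f * g x) + integral {a..b} (\<lambda>x. f x * integral {a..x} g)
    = integral {a..b} f * integral {a..b} g"
proof -
  \<comment> \<open>Measurability on the product space calls for Borel functions, so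
    \<open>f\<close> and \<open>g\<close>, cut off outside [a,b], are replaced by Borel
    representatives.\<close>
  have ex: "\<exists>k0\<in>borel_measurable borel. integrable lborel k0 \<and> (AE x in lebesgue. indicator {a..b} x * k x = k0 x)"
    if k: "k absolutely_integrable_on {a..b}" for k :: "real \<Rightarrow> real"
  proof -
    have int: "integrable lebesgue (\<lambda>x. indicator {a..b} x * k x)"
      using k by (simp add: set_integrable_def)
    then obtain k0 where k0: "k0 \<in> borel_measurable lborel" "AE x in lborel. indicator {a..b} x * k x = k0 x"
      using completion_ex_borel_measurable_real[of "\<lambda>x. indicator {a..b} x * k x" lborel] by auto
    then have ae: "AE x in lebesgue. indicator {a..b} x * k x = k0 x" by (simp add: AE_completion)
    have "integrable lebesgue k0"
      by (rule Bochner_Integration.integrable_cong_AE_imp[OF int])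
        (use ae k0 in \<open>auto simp: measurable_completion\<close>)
    with k0 ae show ?thesis by (auto simp: integrable_completion)
  qed
  obtain f0 where f0: "f0 \<in> borel_measurable borel" "integrable lborel f0"
    "AE x in lebesgue. indicator {a..b} x * f x = f0 x" using ex[OF f] by auto
  obtain g0 where g0: "g0 \<in> borel_measurable borel" "integrable lborel g0"
    "AE x in lebesgue. indicator {a..b} x * g x = g0 x" using ex[OF g] by auto
  note [measurable] = f0(1) g0(1)
  define P where "P k0 x = (LINT t|lborel. (if t \<le> x then k0 t else 0))" for k0 :: "real \<Rightarrow> real" and x :: real
  have Pmeas [measurable]: "P k0 \<in> borel_measurable borel" if [measurable]: "k0 \<in> borel_measurable borel" for k0
    unfolding P_def by measurable
  have int_if: "integrable lborel (\<lambda>t. if t \<le> x then k0 t else 0)"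
    if "integrable lborel k0" for k0 :: "real \<Rightarrow> real" and x
    by (rule Bochner_Integration.integrable_bound[OF that]) (use that in auto)
  have bound: "\<bar>P k0 x\<bar> \<le> (LINT t|lborel. \<bar>k0 t\<bar>)" if "integrable lborel k0" for k0 x
  proof -
    have "\<bar>P k0 x\<bar> \<le> (LINT t|lborel. \<bar>if t \<le> x then k0 t else 0\<bar>)"
      unfolding P_def by (rule integral_abs_bound)
    also have "\<dots> \<le> (LINT t|lborel. \<bar>k0 t\<bar>)"
      by (rule integral_mono) (use that int_if[OF that, of x] in auto)
    finally show ?thesis .
  qed
  have Pint: "integral {a..x} k = P k0 x"
    if k: "k absolutely_integrable_on {a..b}" and k0: "k0 \<in> borel_measurable borel"
      and eq: "AE x in lebesgue. indicator {a..b} x * k x = k0 x" and x: "x \<in> {a..b}"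
    for k k0 :: "real \<Rightarrow> real" and x
  proof -
    have kx: "k absolutely_integrable_on {a..x}" by (rule absolutely_integrable_sub[OF k]) (use x in auto)
    have m: "(\<lambda>t. if t \<le> x then k0 t else 0) \<in> borel_measurable lborel" using k0 by measurable
    have "integral {a..x} k = (LINT t|lebesgue. indicator {a..x} t *\<^sub>R k t)"
      using set_lebesgue_integral_eq_integral(2)[OF kx] by (simp add: set_lebesgue_integral_def)
    also have "\<dots> = (LINT t|lebesgue. (if t \<le> x then k0 t else 0))"
    proof (rule integral_cong_AE)
      show "(\<lambda>t. indicator {a..x} t *\<^sub>R k t) \<in> borel_measurable lebesgue"
        using kx unfolding set_integrable_def by (rule borel_measurable_integrable)
      show "AE t in lebesgue. indicator {a..x} t *\<^sub>R k t = (if t \<le> x then k0 t else 0)"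
        using eq by eventually_elim (use x in \<open>auto simp: indicator_def split: if_splits\<close>)
    qed (rule measurable_completion[OF m])
    also have "\<dots> = P k0 x" unfolding P_def by (rule integral_completion[OF m])
    finally show ?thesis .
  qed
  have Pprod: "integral {a..b} (\<lambda>x. integral {a..x} k * l x) = (LINT x|lborel. P k0 x * l0 x)"
    if k: "k absolutely_integrable_on {a..b}" and k0: "k0 \<in> borel_measurable borel"
      and keq: "AE x in lebesgue. indicator {a..b} x * k x = k0 x"
      and l: "l absolutely_integrable_on {a..b}" and l0: "l0 \<in> borel_measurable borel"
      and leq: "AE x in lebesgue. indicator {a..b} x * l x = l0 x"
    for k k0 l l0 :: "real \<Rightarrow> real"
  proof -
    have "continuous_on {a..b} (\<lambda>x. integral {a..x} k)"
      by (rule indefinite_integral_continuous_1[OF set_lebesgue_integral_eq_integral(1)[OF k]])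
    then have kl: "(\<lambda>x. integral {a..x} k * l x) absolutely_integrable_on {a..b}"
      using absolutely_integrable_mult_continuous[OF l, of "\<lambda>x. integral {a..x} k"]
      by (simp add: mult.commute)
    have m: "(\<lambda>x. P k0 x * l0 x) \<in> borel_measurable lborel" using k0 l0 by measurable
    have "integral {a..b} (\<lambda>x. integral {a..x} k * l x)
        = (LINT x|lebesgue. indicator {a..b} x *\<^sub>R (integral {a..x} k * l x))"
      using set_lebesgue_integral_eq_integral(2)[OF kl] by (simp add: set_lebesgue_integral_def)
    also have "\<dots> = (LINT x|lebesgue. P k0 x * l0 x)"
    proof (rule integral_cong_AE)
      show "(\<lambda>x. indicator {a..b} x *\<^sub>R (integral {a..x} k * l x)) \<in> borel_measurable lebesgue"
        using kl unfolding set_integrable_def by (rule borel_measurable_integrable)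
      show "AE x in lebesgue. indicator {a..b} x *\<^sub>R (integral {a..x} k * l x) = P k0 x * l0 x"
        using leq by eventually_elim (use Pint[OF k k0 keq] in \<open>auto simp: indicator_def split: if_splits\<close>)
    qed (rule measurable_completion[OF m])
    also have "\<dots> = (LINT x|lborel. P k0 x * l0 x)" by (rule integral_completion[OF m])
    finally show ?thesis .
  qed
  have tot: "integral {a..b} k = (LINT x|lborel. k0 x)"
    if k: "k absolutely_integrable_on {a..b}" and k0: "k0 \<in> borel_measurable borel"
      and keq: "AE x in lebesgue. indicator {a..b} x * k x = k0 x" for k k0 :: "real \<Rightarrow> real"
  proof -
    have "integral {a..b} k = (LINT x|lebesgue. indicator {a..b} x *\<^sub>R k x)"
      using set_lebesgue_integral_eq_integral(2)[OF k] by (simp add: set_lebesgue_integral_def)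
    also have "\<dots> = (LINT x|lebesgue. k0 x)"
    proof (rule integral_cong_AE)
      show "(\<lambda>x. indicator {a..b} x *\<^sub>R k x) \<in> borel_measurable lebesgue"
        using k unfolding set_integrable_def by (rule borel_measurable_integrable)
      show "k0 \<in> borel_measurable lebesgue" using k0 by (simp add: measurable_completion)
    qed (use keq in simp)
    also have "\<dots> = (LINT x|lborel. k0 x)" using k0 by (intro integral_completion) simp
    finally show ?thesis .
  qed
  define K where "K t x = (if t \<le> x then f0 t * g0 x else 0)" for t x
  have Kint: "integrable (lborel \<Otimes>\<^sub>M lborel) (case_prod K)"
  proof (rule lborel_pair.Fubini_integrable)
    show "case_prod K \<in> borel_measurable (lborel \<Otimes>\<^sub>M lborel)"
      unfolding K_def by measurable
    have in1: "integrable lborel (\<lambda>x. \<bar>if t \<le> x then f0 t * g0 x else 0\<bar>)" for t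
      by (rule Bochner_Integration.integrable_bound[of _ "\<lambda>x. f0 t * g0 x"]) (use g0 in auto)
    show "AE t in lborel. integrable lborel (\<lambda>x. case_prod K (t, x))"
    proof (rule AE_I2)
      fix t show "integrable lborel (\<lambda>x. case_prod K (t, x))"
        unfolding K_def by (rule Bochner_Integration.integrable_bound[of _ "\<lambda>x. f0 t * g0 x"]) (use g0 in auto)
    qed
    show "integrable lborel (\<lambda>t. LINT x|lborel. norm (case_prod K (t, x)))"
    proof (rule Bochner_Integration.integrable_bound[of _ "\<lambda>t. \<bar>f0 t\<bar> * (LINT x|lborel. \<bar>g0 x\<bar>)"])
      show "integrable lborel (\<lambda>t. \<bar>f0 t\<bar> * (LINT x|lborel. \<bar>g0 x\<bar>))" using f0 by auto
      show "(\<lambda>t. LINT x|lborel. norm (case_prod K (t, x))) \<in> borel_measurable lborel"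
        unfolding K_def by measurable
      show "AE t in lborel. norm (LINT x|lborel. norm (case_prod K (t, x)))
          \<le> norm (\<bar>f0 t\<bar> * (LINT x|lborel. \<bar>g0 x\<bar>))"
      proof (rule AE_I2)
        fix t
        have "(LINT x|lborel. norm (case_prod K (t, x))) \<le> (LINT x|lborel. \<bar>f0 t\<bar> * \<bar>g0 x\<bar>)"
          by (rule integral_mono) (use in1 g0 in \<open>auto simp: K_def abs_mult\<close>)
        then show "norm (LINT x|lborel. norm (case_prod K (t, x)))
          \<le> norm (\<bar>f0 t\<bar> * (LINT x|lborel. \<bar>g0 x\<bar>))" by simp
      qed
    qed
  qed
  have "(LINT x|lborel. LINT t|lborel. K t x) = (LINT t|lborel. LINT x|lborel. K t x)"
    by (rule lborel_pair.Fubini_integral[OF Kint])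
  moreover have "(LINT t|lborel. K t x) = P f0 x * g0 x" for x
  proof -
    have "(LINT t|lborel. K t x) = (LINT t|lborel. (if t \<le> x then f0 t else 0) * g0 x)"
      by (rule Bochner_Integration.integral_cong) (auto simp: K_def)
    then show ?thesis by (simp add: P_def)
  qed
  moreover have "(LINT x|lborel. K t x) = f0 t * (LINT x|lborel. g0 x) - P g0 t * f0 t" for t
  proof -
    \<comment> \<open>The half-lines x \<ge> t and x > t differ by the single point t, which is a
      null set.\<close>
    have "(LINT x|lborel. K t x) = (LINT x|lborel. f0 t * (g0 x - (if x \<le> t then g0 x else 0)))"
    proof (rule integral_cong_AE)
      have "AE x in lborel. x \<noteq> t" by (rule AE_lborel_singleton)
      then show "AE x in lborel. K t x = f0 t * (g0 x - (if x \<le> t then g0 x else 0))"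
        by eventually_elim (auto simp: K_def)
    qed (unfold K_def, measurable)
    also have "\<dots> = f0 t * ((LINT x|lborel. g0 x) - P g0 t)"
      using g0(2) int_if[OF g0(2), of t] by (simp add: P_def)
    finally show ?thesis by (simp add: algebra_simps)
  qed
  moreover have "(LINT t|lborel. f0 t * (LINT x|lborel. g0 x) - P g0 t * f0 t)
      = (LINT t|lborel. f0 t) * (LINT x|lborel. g0 x) - (LINT t|lborel. P g0 t * f0 t)"
  proof -
    have "integrable lborel (\<lambda>t. P g0 t * f0 t)"
    proof (rule Bochner_Integration.integrable_bound[of _ "\<lambda>t. (LINT t|lborel. \<bar>g0 t\<bar>) * f0 t"])
      show "AE t in lborel. norm (P g0 t * f0 t) \<le> norm ((LINT t|lborel. \<bar>g0 t\<bar>) * f0 t)"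
        using bound[OF g0(2)] by (auto simp: abs_mult intro!: mult_right_mono order.trans[OF bound[OF g0(2)]])
    qed (use f0 in auto)
    then show ?thesis using f0 by simp
  qed
  ultimately have "(LINT x|lborel. P f0 x * g0 x) + (LINT t|lborel. P g0 t * f0 t)
      = (LINT t|lborel. f0 t) * (LINT x|lborel. g0 x)" by simp
  moreover have "integral {a..b} (\<lambda>x. f x * integral {a..x} g) = (LINT t|lborel. P g0 t * f0 t)"
    using Pprod[OF g g0(1,3) f f0(1,3)] by (simp add: mult.commute)
  ultimately show ?thesis
    using Pprod[OF f f0(1,3) g g0(1,3)] tot[OF f f0(1,3)] tot[OF g g0(1,3)] by simp
qed

text \<open>Splitting off the constants \<open>F a\<close> and \<open>G a\<close> reduces to
  primitives that vanish at a, where \<open>double_integral_by_parts\<close> applies.\<close>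

lemma is_prim_by_parts:
  assumes F: "is_prim a b F f" and G: "is_prim a b G g" and "a \<le> b"
  shows "integral {a..b} (\<lambda>x. F x * g x) = F b * G b - F a * G a - integral {a..b} (\<lambda>x. f x * G x)"
proof -
  have f: "f absolutely_integrable_on {a..b}" and g: "g absolutely_integrable_on {a..b}"
    using F G by (auto simp: is_prim_def)
  let ?I = "\<lambda>k x. integral {a..x} k"
  have cont: "continuous_on {a..b} (?I k)" if "k absolutely_integrable_on {a..b}" for k :: "real \<Rightarrow> real"
    by (rule indefinite_integral_continuous_1[OF set_lebesgue_integral_eq_integral(1)[OF that]])
  have int: "(\<lambda>x. l x * ?I k x) integrable_on {a..b}" "l integrable_on {a..b}"
    if "k absolutely_integrable_on {a..b}" "l absolutely_integrable_on {a..b}" for k l :: "real \<Rightarrow> real"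
    using that by (auto intro!: set_lebesgue_integral_eq_integral(1) absolutely_integrable_mult_continuous cont)
  have "integral {a..b} (\<lambda>x. F x * g x) = integral {a..b} (\<lambda>x. F a * g x + g x * ?I f x)"
    by (rule integral_cong) (use is_prim_eq[OF F] in \<open>metis add.commute distrib_right mult.commute\<close>)
  also have "\<dots> = F a * ?I g b + integral {a..b} (\<lambda>x. g x * ?I f x)"
    using int[OF f g] by (subst Henstock_Kurzweil_Integration.integral_add) (auto intro: integrable_on_mult_right)
  finally have 1: "integral {a..b} (\<lambda>x. F x * g x) = F a * ?I g b + integral {a..b} (\<lambda>x. g x * ?I f x)" .
  have "integral {a..b} (\<lambda>x. f x * G x) = integral {a..b} (\<lambda>x. G a * f x + f x * ?I g x)"
    by (rule integral_cong) (use is_prim_eq[OF G] in \<open>metis distrib_left mult.commute\<close>)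
  also have "\<dots> = G a * ?I f b + integral {a..b} (\<lambda>x. f x * ?I g x)"
    using int[OF g f] by (subst Henstock_Kurzweil_Integration.integral_add) (auto intro: integrable_on_mult_right)
  finally have 2: "integral {a..b} (\<lambda>x. f x * G x) = G a * ?I f b + integral {a..b} (\<lambda>x. f x * ?I g x)" .
  have "integral {a..b} (\<lambda>x. g x * ?I f x) + integral {a..b} (\<lambda>x. f x * ?I g x) = ?I f b * ?I g b"
    using double_integral_by_parts[OF f g] by (simp add: mult.commute)
  moreover have "F b = F a + ?I f b" "G b = G a + ?I g b"
    using is_prim_eq[OF F, of b] is_prim_eq[OF G, of b] \<open>a \<le> b\<close> by auto
  ultimately show ?thesis using 1 2 by (simp add: algebra_simps)
qed

section \<open>Weak derivatives\<close>

lemma distr_of_diff: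
  assumes "f absolutely_integrable_on {A..B}" "g absolutely_integrable_on {A..B}" "test_function {A<..<B} \<phi>"
  shows "distr_of (\<lambda>x. f x - g x) \<phi> = distr_of f \<phi> - distr_of g \<phi>"
proof -
  have i: "(\<lambda>x. k x * \<phi> x) integrable_on {A..B}" if "k absolutely_integrable_on {A..B}" for k :: "real \<Rightarrow> real"
    by (intro set_lebesgue_integral_eq_integral(1) absolutely_integrable_mult_continuous that
        test_function_continuous[OF assms(3)])
  have "(\<lambda>x. f x - g x) absolutely_integrable_on {A..B}"
    using assms by (intro set_integral_diff(1))
  then show ?thesis
    using assms i[OF assms(1)] i[OF assms(2)]
    by (simp add: distr_of_eq_integral[of A B] left_diff_distrib Henstock_Kurzweil_Integration.integral_diff)
qed

text \<open>This makes the choice in \<open>ac_deriv\<close> harmless. Subtracting two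
  decompositions leaves a density equal to a singular signed measure, carried by the union of the
  two null sets.\<close>

lemma is_ac_deriv_unique:
  assumes "is_ac_deriv {A<..<B} v g" "is_ac_deriv {A<..<B} v k"
  shows "AE x in lebesgue. x \<in> {A<..<B} \<longrightarrow> g x = k x"
proof -
  obtain M N Z where 1: "finite_measure M" "sets M = sets borel" "finite_measure N" "sets N = sets borel"
      "Z \<in> null_sets lborel" "emeasure M (- Z) = 0" "emeasure N (- Z) = 0"
    and e1: "distr_eq_on {A<..<B} (distr_deriv (distr_of v))
          (\<lambda>\<phi>. distr_of g \<phi> + ((LINT x|M. \<phi> x) - (LINT x|N. \<phi> x)))"
    using assms(1) unfolding is_ac_deriv_def by blast
  obtain M' N' Z' where 2: "finite_measure M'" "sets M' = sets borel" "finite_measure N'" "sets N' = sets borel"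
      "Z' \<in> null_sets lborel" "emeasure M' (- Z') = 0" "emeasure N' (- Z') = 0"
    and e2: "distr_eq_on {A<..<B} (distr_deriv (distr_of v))
          (\<lambda>\<phi>. distr_of k \<phi> + ((LINT x|M'. \<phi> x) - (LINT x|N'. \<phi> x)))"
    using assms(2) unfolding is_ac_deriv_def by blast
  have g: "g absolutely_integrable_on {A..B}" and k: "k absolutely_integrable_on {A..B}"
    using assms unfolding is_ac_deriv_def absolutely_integrable_open_iff by blast+
  have z: "emeasure L (- (Z \<union> Z')) = 0"
    if "sets L = sets borel" "emeasure L (- Z) = 0 \<or> emeasure L (- Z') = 0" for L
  proof -
    have "Z \<in> sets borel" "Z' \<in> sets borel" using 1(5) 2(5) by (simp_all add: null_sets_def)
    then have "- Z \<in> sets L" "- Z' \<in> sets L" unfolding that(1) by auto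
    then have "emeasure L (- (Z \<union> Z')) \<le> emeasure L (- Z)" "emeasure L (- (Z \<union> Z')) \<le> emeasure L (- Z')"
      by (intro emeasure_mono; blast)+
    then show ?thesis using that(2) by (metis le_zero_eq)
  qed
  have "AE x in lebesgue. x \<in> {A<..<B} \<longrightarrow> g x - k x = 0"
  \<comment> \<open>The difference g - k equals (M' - N') - (M - N), so the measures of the second
    decomposition come first.\<close>
  proof (rule AE_zero_from_singular_measures[of A B _ M' N' M N "Z \<union> Z'"])
    show "(\<lambda>x. g x - k x) absolutely_integrable_on {A..B}" using g k by (intro set_integral_diff(1))
    show "distr_of (\<lambda>x. g x - k x) \<phi> = (LINT x|M'. \<phi> x) - (LINT x|N'. \<phi> x) - ((LINT x|M. \<phi> x) - (LINT x|N. \<phi> x))"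
      if \<phi>: "test_function {A<..<B} \<phi>" for \<phi>
    proof -
      have "distr_of g \<phi> + ((LINT x|M. \<phi> x) - (LINT x|N. \<phi> x)) = distr_of k \<phi> + ((LINT x|M'. \<phi> x) - (LINT x|N'. \<phi> x))"
        using e1 e2 \<phi> unfolding distr_eq_on_def by metis
      then show ?thesis using distr_of_diff[OF g k \<phi>] by linarith
    qed
    show "Z \<union> Z' \<in> null_sets lborel" using 1(5) 2(5) by (rule null_sets.Un)
  qed (use 1(1-4,6,7) 2(1-4,6,7) z in simp_all)
  then show ?thesis by eventually_elim auto
qed

text \<open>The fundamental lemma of the calculus of variations, as the case of vanishing singular
  parts.\<close>

lemma AE_zero_from_tests:
  fixes h :: "real \<Rightarrow> real"
  assumes "h absolutely_integrable_on {A..B}"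
    and "\<And>\<phi>. test_function {A<..<B} \<phi> \<Longrightarrow> distr_of h \<phi> = 0"
  shows "AE x in lebesgue. x \<in> {A<..<B} \<longrightarrow> h x = 0"
  by (rule AE_zero_from_singular_measures[OF assms(1), of "null_measure borel" "null_measure borel"
        "null_measure borel" "null_measure borel" "{}"])
    (use assms(2) in \<open>auto intro!: finite_measureI\<close>)

text \<open>Weak derivatives are only locally integrable, so the fundamental lemma is applied on
  compact subintervals that exhaust (A,B).\<close>

lemma is_weak_deriv_unique:
  assumes "is_weak_deriv {A<..<B} v g" "is_weak_deriv {A<..<B} v k"
  shows "AE x in lebesgue. x \<in> {A<..<B} \<longrightarrow> g x = k x"
proof -
  let ?c = "\<lambda>n. A + 1 / real (Suc n)" and ?d = "\<lambda>n. B - 1 / real (Suc n)"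
  have "AE x in lebesgue. x \<in> {?c n<..<?d n} \<longrightarrow> g x - k x = 0" for n
  proof -
    have "0 < 1 / real (Suc n)" by simp
    then have sub: "{?c n..?d n} \<subseteq> {A<..<B}" "{?c n<..<?d n} \<subseteq> {A<..<B}"
      unfolding subset_iff atLeastAtMost_iff greaterThanLessThan_iff by (intro allI impI conjI; linarith)+
    have i: "g absolutely_integrable_on {?c n..?d n}" "k absolutely_integrable_on {?c n..?d n}"
      using assms sub unfolding is_weak_deriv_def locally_integrable_def by blast+
    show ?thesis
    proof (rule AE_zero_from_tests)
      show "(\<lambda>x. g x - k x) absolutely_integrable_on {?c n..?d n}" using i by (intro set_integral_diff(1))
      fix \<phi> assume \<phi>: "test_function {?c n<..<?d n} \<phi>"
      have "test_function {A<..<B} \<phi>" using test_function_mono[OF \<phi> sub(2)] .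
      then have "distr_of g \<phi> = distr_of k \<phi>"
        using assms unfolding is_weak_deriv_def distr_eq_on_def by metis
      then show "distr_of (\<lambda>x. g x - k x) \<phi> = 0" using distr_of_diff[OF i \<phi>] by simp
    qed
  qed
  then have "AE x in lebesgue. \<forall>n. x \<in> {?c n<..<?d n} \<longrightarrow> g x - k x = 0"
    by (intro AE_all_countable[THEN iffD2] allI)
  then show ?thesis
  proof eventually_elim
    case (elim x)
    show ?case
    proof
      assume x: "x \<in> {A<..<B}"
      then obtain n where "1 / real (Suc n) < min (x - A) (B - x)"
        using nat_approx_posE[of "min (x - A) (B - x)"] by auto
      then have "x \<in> {?c n<..<?d n}" by (auto simp: algebra_simps)
      then show "g x = k x" using elim by auto
    qed
  qed
qed

text \<open>The integrals of the bumps tend to B - A > 0, so one of them is positive and can be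
  normalised.\<close>

lemma exists_test_function_integral:
  assumes "A < B" obtains \<rho> where "test_function {A<..<B} \<rho>" "integral {A..B} \<rho> = 1"
proof -
  have t: "test_function {A<..<B} (bump A B n)" for n by (rule test_function_bump) simp
  have "(\<lambda>n. integral {A..B} (bump A B n)) \<longlonglongrightarrow> integral {A..B} (indicator {A<..<B} :: real \<Rightarrow> real)"
  proof (rule dominated_convergence(2)[where h = "\<lambda>_. 1"])
    show "bump A B n integrable_on {A..B}" for n
      by (intro integrable_continuous_real test_function_continuous[OF t])
    show "norm (bump A B n x) \<le> 1" for n x using bump_bounds[of A B n x] by simp
    show "(\<lambda>n. bump A B n x) \<longlonglongrightarrow> indicator {A<..<B} x" for x by (rule bump_tendsto)
  qed auto
  moreover have "integral {A..B} (indicator {A<..<B} :: real \<Rightarrow> real) = integral {A..B} (\<lambda>_. 1)"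
    by (rule integral_spike[of "{A, B}"]) auto
  ultimately have "(\<lambda>n. integral {A..B} (bump A B n)) \<longlonglongrightarrow> B - A" using assms by simp
  then have "\<forall>\<^sub>F n in sequentially. 0 < integral {A..B} (bump A B n)"
    using assms by (intro order_tendstoD(1)) auto
  then obtain n where n: "0 < integral {A..B} (bump A B n)"
    by (auto simp: eventually_sequentially)
  let ?I = "integral {A..B} (bump A B n)"
  show ?thesis
  proof
    \<comment> \<open>Scaling as a special case of \<open>test_function_add\<close>: 1 + (1/I - 1) =
      1/I.\<close>
    have "test_function {A<..<B} (\<lambda>x. bump A B n x + (1 / ?I - 1) * bump A B n x)"
      by (rule test_function_add[OF t t assms])
    then show "test_function {A<..<B} (\<lambda>x. bump A B n x * (1 / ?I))" by (simp add: algebra_simps)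
    show "integral {A..B} (\<lambda>x. bump A B n x * (1 / ?I)) = 1" using n by simp
  qed
qed

lemma distr_of_integrable:
  "f absolutely_integrable_on {A..B} \<Longrightarrow> test_function {A<..<B} \<phi> \<Longrightarrow> (\<lambda>x. f x * \<phi> x) integrable_on {A..B}"
  by (intro set_lebesgue_integral_eq_integral(1) absolutely_integrable_mult_continuous test_function_continuous)

lemma distr_of_lin_test:
  assumes "f absolutely_integrable_on {A..B}" "test_function {A<..<B} \<phi>" "test_function {A<..<B} \<psi>"
  shows "integral {A..B} (\<lambda>x. f x * (\<phi> x + k * \<psi> x)) = distr_of f \<phi> + k * distr_of f \<psi>"
proof -
  have "integral {A..B} (\<lambda>x. f x * (\<phi> x + k * \<psi> x)) = integral {A..B} (\<lambda>x. f x * \<phi> x + k * (f x * \<psi> x))"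
    by (simp add: algebra_simps)
  also have "\<dots> = integral {A..B} (\<lambda>x. f x * \<phi> x) + integral {A..B} (\<lambda>x. k * (f x * \<psi> x))"
    using assms by (intro Henstock_Kurzweil_Integration.integral_add integrable_on_mult_right distr_of_integrable)
  finally show ?thesis using assms by (simp add: distr_of_eq_integral[of A B])
qed

text \<open>The lemma of du Bois-Reymond: \<open>\<theta> - (\<integral>\<theta>) \<rho>\<close> is the derivative of a test function when \<open>\<integral>\<rho> = 1\<close>.\<close>

lemma const_if_weak_deriv_const:
  assumes z: "z absolutely_integrable_on {A..B}" and "A < B"
    and eq: "\<And>\<phi>. test_function {A<..<B} \<phi> \<Longrightarrow> distr_of z (deriv \<phi>) = m * integral {A..B} \<phi>"
  obtains c where "AE x in lebesgue. x \<in> {A<..<B} \<longrightarrow> z x = c - m * x"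
proof -
  obtain \<rho> where \<rho>: "test_function {A<..<B} \<rho>" "integral {A..B} \<rho> = 1"
    using exists_test_function_integral[OF assms(2)] by blast
  \<comment> \<open>By hypothesis the distributional derivative of \<open>z\<close> is the constant
    -m; adding m x reduces to derivative zero.\<close>
  define z' where "z' x = z x + m * x" for x
  have mx: "(\<lambda>x. m * x) absolutely_integrable_on {A..B}"
    by (intro absolutely_integrable_continuous_real continuous_intros)
  have z': "z' absolutely_integrable_on {A..B}"
    unfolding z'_def by (intro set_integral_add(1) z mx)
  have eq': "distr_of z' (deriv \<phi>) = 0" if \<phi>: "test_function {A<..<B} \<phi>" for \<phi>
  proof -
    have d: "test_function {A<..<B} (deriv \<phi>)" by (rule test_function_deriv[OF \<phi>])
    have "integral {A..B} (\<lambda>x. m * x * deriv \<phi> x) = m * B * \<phi> B - m * A * \<phi> A - integral {A..B} (\<lambda>x. m * \<phi> x)"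
    proof (rule is_prim_by_parts)
      show "is_prim A B (\<lambda>x. m * x) (\<lambda>x. m)"
        by (rule is_prim_FTC) (auto intro!: derivative_eq_intros)
      show "is_prim A B \<phi> (deriv \<phi>)" by (rule is_prim_test_function[OF \<phi>])
    qed (use assms(2) in simp)
    then have "integral {A..B} (\<lambda>x. m * x * deriv \<phi> x) = - m * integral {A..B} \<phi>"
      using test_function_zero[OF \<phi>] by simp
    moreover have "distr_of z' (deriv \<phi>) = distr_of z (deriv \<phi>) + integral {A..B} (\<lambda>x. m * x * deriv \<phi> x)"
      unfolding distr_of_eq_integral[OF z' d] distr_of_eq_integral[OF z d]
      using distr_of_integrable[OF z d] distr_of_integrable[OF mx d]
      by (simp add: z'_def ring_distribs Henstock_Kurzweil_Integration.integral_add)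
    ultimately show ?thesis using eq[OF \<phi>] by simp
  qed
  define c where "c = distr_of z' \<rho>"
  have cc: "(\<lambda>x. c) absolutely_integrable_on {A..B}"
    by (intro absolutely_integrable_continuous_real continuous_intros)
  have "AE x in lebesgue. x \<in> {A<..<B} \<longrightarrow> z' x - c = 0"
  proof (rule AE_zero_from_tests)
    show "(\<lambda>x. z' x - c) absolutely_integrable_on {A..B}" by (intro set_integral_diff(1) z' cc)
    fix \<theta> assume \<theta>: "test_function {A<..<B} \<theta>"
    define I where "I = integral {A..B} \<theta>"
    have t: "test_function {A<..<B} (\<lambda>x. \<theta> x + (- I) * \<rho> x)" by (rule test_function_add[OF \<theta> \<rho>(1) assms(2)])
    have "integral {A..B} (\<lambda>x. \<theta> x + (- I) * \<rho> x) = integral {A..B} \<theta> + integral {A..B} (\<lambda>x. (- I) * \<rho> x)"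
      by (intro Henstock_Kurzweil_Integration.integral_add integrable_on_mult_right integrable_continuous_real
          test_function_continuous[OF \<theta>] test_function_continuous[OF \<rho>(1)])
    then have "integral {A..B} (\<lambda>x. \<theta> x + (- I) * \<rho> x) = 0" using \<rho>(2) by (simp add: I_def)
    then obtain \<phi> where "test_function {A<..<B} \<phi>" "deriv \<phi> = (\<lambda>x. \<theta> x + (- I) * \<rho> x)"
      using test_function_antideriv[OF t assms(2)] by metis
    then have "distr_of z' (\<lambda>x. \<theta> x + (- I) * \<rho> x) = 0" using eq' by metis
    then have "distr_of z' \<theta> = I * c"
      using distr_of_lin_test[OF z' \<theta> \<rho>(1), of "- I"] distr_of_eq_integral[OF z' t] by (simp add: c_def)
    moreover have "distr_of (\<lambda>x. c) \<theta> = c * I"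
      using distr_of_eq_integral[OF cc \<theta>] by (simp add: I_def)
    ultimately show "distr_of (\<lambda>x. z' x - c) \<theta> = 0" using distr_of_diff[OF z' cc \<theta>] by simp
  qed
  then have "AE x in lebesgue. x \<in> {A<..<B} \<longrightarrow> z x = c - m * x"
    by eventually_elim (auto simp: z'_def)
  then show ?thesis using that by blast
qed

text \<open>The same correction one order higher:
  \<open>\<theta> - (\<integral>\<theta>) \<rho>\<close> is the derivative of a test function
  \<open>\<phi>\<close>, so the hypothesis at \<open>\<phi>\<close> relates the pairing with the
  derivative of \<open>\<theta>\<close> to that with the derivative of \<open>\<rho>\<close>. Hence
  the derivative of \<open>z\<close> is constant and \<open>const_if_weak_deriv_const\<close>
  applies.\<close>

lemma affine_if_second_weak_deriv_zero:
  assumes z: "z absolutely_integrable_on {A..B}" and "A < B"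
    and eq: "\<And>\<phi>. test_function {A<..<B} \<phi> \<Longrightarrow> distr_of z (deriv (deriv \<phi>)) = 0"
  obtains c m where "AE x in lebesgue. x \<in> {A<..<B} \<longrightarrow> z x = c + m * x"
proof -
  obtain \<rho> where \<rho>: "test_function {A<..<B} \<rho>" "integral {A..B} \<rho> = 1"
    using exists_test_function_integral[OF assms(2)] by blast
  define m where "m = distr_of z (deriv \<rho>)"
  have "distr_of z (deriv \<theta>) = m * integral {A..B} \<theta>" if \<theta>: "test_function {A<..<B} \<theta>" for \<theta>
  proof -
    define I where "I = integral {A..B} \<theta>"
    have t: "test_function {A<..<B} (\<lambda>x. \<theta> x + (- I) * \<rho> x)" by (rule test_function_add[OF \<theta> \<rho>(1) assms(2)])
    have "integral {A..B} (\<lambda>x. \<theta> x + (- I) * \<rho> x) = integral {A..B} \<theta> + integral {A..B} (\<lambda>x. (- I) * \<rho> x)"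
      by (intro Henstock_Kurzweil_Integration.integral_add integrable_on_mult_right integrable_continuous_real
          test_function_continuous[OF \<theta>] test_function_continuous[OF \<rho>(1)])
    then have "integral {A..B} (\<lambda>x. \<theta> x + (- I) * \<rho> x) = 0" using \<rho>(2) by (simp add: I_def)
    then obtain \<phi> where \<phi>: "test_function {A<..<B} \<phi>" "deriv \<phi> = (\<lambda>x. \<theta> x + (- I) * \<rho> x)"
      using test_function_antideriv[OF t assms(2)] by metis
    have "deriv (deriv \<phi>) = (\<lambda>x. deriv \<theta> x + (- I) * deriv \<rho> x)"
      unfolding \<phi>(2) by (intro ext DERIV_imp_deriv)
        (auto intro!: derivative_eq_intros test_function_has_deriv[OF \<theta>] test_function_has_deriv[OF \<rho>(1)])
    moreover have "test_function {A<..<B} (deriv (deriv \<phi>))" by (intro test_function_deriv \<phi>(1))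
    ultimately have "0 = integral {A..B} (\<lambda>x. z x * (deriv \<theta> x + (- I) * deriv \<rho> x))"
      using eq[OF \<phi>(1)] distr_of_eq_integral[OF z] by metis
    also have "\<dots> = distr_of z (deriv \<theta>) + (- I) * m"
      unfolding m_def by (intro distr_of_lin_test z test_function_deriv \<theta> \<rho>(1))
    finally show ?thesis by (simp add: I_def)
  qed
  then obtain c where "AE x in lebesgue. x \<in> {A<..<B} \<longrightarrow> z x = c - m * x"
    using const_if_weak_deriv_const[OF z assms(2)] by blast
  then show ?thesis using that[of c "- m"] by simp
qed

text \<open>On a bounded interval square integrability implies integrability, by |f| \<le> 1 + f^2.
  This form absorbs the measurability condition and passes to the closed interval.\<close>

lemma L2_iff:
  "f \<in> L2 {A<..<B} \<longleftrightarrow> f absolutely_integrable_on {A..B} \<and> (\<lambda>x. (f x)\<^sup>2) absolutely_integrable_on {A..B}"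
proof -
  have 1: "integrable (lebesgue_on {A<..<B}) g \<longleftrightarrow> g absolutely_integrable_on {A<..<B}" for g :: "real \<Rightarrow> real"
    unfolding set_integrable_def by (subst integrable_restrict_space) auto
  have 2: "f absolutely_integrable_on {A<..<B}"
    if "f \<in> borel_measurable (lebesgue_on {A<..<B})" "(\<lambda>x. (f x)\<^sup>2) absolutely_integrable_on {A<..<B}"
  proof (rule measurable_bounded_by_integrable_imp_absolutely_integrable[OF that(1)])
    have "(\<lambda>x. 1 :: real) absolutely_integrable_on {A..B}"
      by (intro absolutely_integrable_continuous_real continuous_intros)
    then have "(\<lambda>x. 1 + (f x)\<^sup>2) absolutely_integrable_on {A<..<B}"
      by (intro set_integral_add(1) that(2)) (simp add: absolutely_integrable_open_iff)
    then show "(\<lambda>x. 1 + (f x)\<^sup>2) integrable_on {A<..<B}" by (rule set_lebesgue_integral_eq_integral(1))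
    show "norm (f x) \<le> 1 + (f x)\<^sup>2" for x
    proof -
      have "0 \<le> (\<bar>f x\<bar> - 1)\<^sup>2" by simp
      then have "2 * \<bar>f x\<bar> \<le> 1 + (f x)\<^sup>2" by (simp add: power2_diff)
      then show ?thesis by simp
    qed
  qed auto
  have 3: "f \<in> borel_measurable (lebesgue_on {A<..<B})" if "f absolutely_integrable_on {A<..<B}"
    using that by (intro absolutely_integrable_measurable[THEN iffD1, THEN conjunct1]) auto
  show ?thesis
    unfolding L2_def mem_Collect_eq 1 unfolding absolutely_integrable_open_iff[symmetric]
    using 2 3 by blast
qed

lemma L2_integrable: "f \<in> L2 {A<..<B} \<Longrightarrow> f absolutely_integrable_on {A..B}"
  by (simp add: L2_iff)

lemma L2_mult:
  assumes "f \<in> L2 {A<..<B}" "g \<in> L2 {A<..<B}"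
  shows "(\<lambda>x. f x * g x) absolutely_integrable_on {A<..<B}"
proof (rule measurable_bounded_by_integrable_imp_absolutely_integrable)
  have "f \<in> borel_measurable (lebesgue_on {A<..<B})" "g \<in> borel_measurable (lebesgue_on {A<..<B})"
    using assms by (auto simp: L2_def)
  then show "(\<lambda>x. f x * g x) \<in> borel_measurable (lebesgue_on {A<..<B})" by measurable
  have "(\<lambda>x. (f x)\<^sup>2 + (g x)\<^sup>2) absolutely_integrable_on {A<..<B}"
    using assms unfolding absolutely_integrable_open_iff by (intro set_integral_add(1)) (auto simp: L2_iff)
  then show "(\<lambda>x. (f x)\<^sup>2 + (g x)\<^sup>2) integrable_on {A<..<B}" by (rule set_lebesgue_integral_eq_integral(1))
  show "norm (f x * g x) \<le> (f x)\<^sup>2 + (g x)\<^sup>2" for x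
  proof -
    have "0 \<le> (\<bar>f x\<bar> - \<bar>g x\<bar>)\<^sup>2" by simp
    then have "2 * (\<bar>f x\<bar> * \<bar>g x\<bar>) \<le> (f x)\<^sup>2 + (g x)\<^sup>2" by (simp add: power2_diff)
    moreover have "0 \<le> \<bar>f x\<bar> * \<bar>g x\<bar>" by simp
    ultimately show ?thesis unfolding real_norm_def abs_mult by linarith
  qed
qed auto

lemma L2_lin:
  assumes "f \<in> L2 {A<..<B}" "g \<in> L2 {A<..<B}"
  shows "(\<lambda>x. f x + t * g x) \<in> L2 {A<..<B}"
proof -
  have "(\<lambda>x. (f x)\<^sup>2 + (2 * t) * (f x * g x) + t\<^sup>2 * (g x)\<^sup>2) absolutely_integrable_on {A..B}"
    using assms L2_mult[OF assms] by (intro set_integral_add(1) set_integrable_mult_right)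
      (auto simp: L2_iff absolutely_integrable_open_iff)
  moreover have "(f x)\<^sup>2 + (2 * t) * (f x * g x) + t\<^sup>2 * (g x)\<^sup>2 = (f x + t * g x)\<^sup>2" for x
    by (simp add: power2_eq_square algebra_simps)
  ultimately show ?thesis
    using assms unfolding L2_iff by (auto intro!: set_integral_add(1) set_integrable_mult_right)
qed

lemma L2_AE_cong:
  assumes "f \<in> L2 {A<..<B}" "AE x in lebesgue. x \<in> {A<..<B} \<longrightarrow> f x = g x"
  shows "g \<in> L2 {A<..<B}"
proof -
  have "AE x in lebesgue. x \<in> {A<..<B} \<longrightarrow> (f x)\<^sup>2 = (g x)\<^sup>2" using assms(2) by eventually_elim auto
  then show ?thesis
    using assms(1) absolutely_integrable_AE_cong(1)[OF _ assms(2)]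
      absolutely_integrable_AE_cong(1)[of A B "\<lambda>x. (f x)\<^sup>2" "\<lambda>x. (g x)\<^sup>2"]
    unfolding L2_iff by simp
qed

lemma L2_sub: "f \<in> L2 {A<..<B} \<Longrightarrow> A \<le> c \<Longrightarrow> d \<le> B \<Longrightarrow> f \<in> L2 {c<..<d}"
  unfolding L2_iff by (auto intro: absolutely_integrable_sub)

lemma absolutely_integrable_join:
  fixes f :: "real \<Rightarrow> real"
  assumes "f absolutely_integrable_on {A..m}" "f absolutely_integrable_on {m..B}" "A \<le> m" "m \<le> B"
  shows "f absolutely_integrable_on {A..B}"
proof -
  have "f absolutely_integrable_on ({A..m} \<union> {m..B})"
    by (rule set_integrable_Un[OF assms(1,2)]) auto
  then show ?thesis using assms by (simp add: ivl_disj_un)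
qed

lemma L2_join:
  "f \<in> L2 {A<..<m} \<Longrightarrow> f \<in> L2 {m<..<B} \<Longrightarrow> A \<le> m \<Longrightarrow> m \<le> B \<Longrightarrow> f \<in> L2 {A<..<B}"
  unfolding L2_iff by (auto intro: absolutely_integrable_join)

lemma L2_continuous: "continuous_on {A..B} f \<Longrightarrow> f \<in> L2 {A<..<B}"
  unfolding L2_iff by (auto intro!: absolutely_integrable_continuous_real continuous_intros)

lemma distr_of_AE_cong:
  assumes "f absolutely_integrable_on {A..B}" "AE x in lebesgue. x \<in> {A<..<B} \<longrightarrow> f x = g x" "test_function {A<..<B} \<phi>"
  shows "distr_of f \<phi> = distr_of g \<phi>"
proof -
  have "AE x in lebesgue. x \<in> {A<..<B} \<longrightarrow> f x * \<phi> x = g x * \<phi> x" using assms(2) by eventually_elim auto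
  then show ?thesis
    using absolutely_integrable_AE_cong(2)[of A B "\<lambda>x. f x * \<phi> x" "\<lambda>x. g x * \<phi> x"] assms
    by (simp add: distr_of_eq_integral[of A B] absolutely_integrable_AE_cong(1)[OF assms(1,2)]
        absolutely_integrable_mult_continuous test_function_continuous[OF assms(3)])
qed

lemma is_prim_distr:
  assumes "is_prim A B V g" "A < B" "test_function {A<..<B} \<phi>"
  shows "distr_of V (deriv \<phi>) = - distr_of g \<phi>"
proof -
  have "V absolutely_integrable_on {A..B}"
    by (rule absolutely_integrable_continuous_real[OF is_prim_continuous[OF assms(1)]])
  then show ?thesis
    using is_prim_by_parts[OF assms(1) is_prim_test_function[OF assms(3)]] assms(2) test_function_zero[OF assms(3)]
    by (simp add: distr_of_eq_integral[of A B] test_function_deriv assms is_prim_ac[OF assms(1)])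
qed

lemma is_weak_deriv_prim:
  assumes V: "is_prim A B V g" and "A < B" and v: "AE x in lebesgue. x \<in> {A<..<B} \<longrightarrow> V x = v x"
  shows "is_weak_deriv {A<..<B} v g"
proof -
  have a: "V absolutely_integrable_on {A..B}"
    by (rule absolutely_integrable_continuous_real[OF is_prim_continuous[OF V]])
  have "distr_of v (deriv \<phi>) = - distr_of g \<phi>" if "test_function {A<..<B} \<phi>" for \<phi>
    using is_prim_distr[OF V assms(2) that] distr_of_AE_cong[OF a v test_function_deriv[OF that]] by simp
  then show ?thesis
    unfolding is_weak_deriv_def distr_eq_on_def distr_deriv_def
    using absolutely_integrable_AE_cong(1)[OF a v] is_prim_ac[OF V] by (auto intro: locally_integrableI)
qed

text \<open>The primitive of \<open>g\<close> has the same weak derivative as \<open>v\<close>, so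
  the difference is constant by the lemma of du Bois-Reymond; adding the constant gives the
  continuous representative.\<close>

lemma is_weak_deriv_imp_prim:
  assumes "is_weak_deriv {A<..<B} v g" "v absolutely_integrable_on {A..B}" "g absolutely_integrable_on {A..B}" "A < B"
  obtains V where "is_prim A B V g" "AE x in lebesgue. x \<in> {A<..<B} \<longrightarrow> V x = v x"
proof -
  let ?G = "\<lambda>x. 0 + integral {A..x} g"
  have G: "is_prim A B ?G g" by (rule is_prim_integral[OF assms(3)])
  have Ga: "?G absolutely_integrable_on {A..B}"
    by (rule absolutely_integrable_continuous_real[OF is_prim_continuous[OF G]])
  obtain c where c: "AE x in lebesgue. x \<in> {A<..<B} \<longrightarrow> v x - ?G x = c - 0 * x"
  proof (rule const_if_weak_deriv_const)
    show "(\<lambda>x. v x - ?G x) absolutely_integrable_on {A..B}" by (intro set_integral_diff(1) assms Ga)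
    show "distr_of (\<lambda>x. v x - ?G x) (deriv \<phi>) = 0 * integral {A..B} \<phi>" if \<phi>: "test_function {A<..<B} \<phi>" for \<phi>
    proof -
      have "- distr_of v (deriv \<phi>) = distr_of g \<phi>"
        using assms(1) \<phi> unfolding is_weak_deriv_def distr_eq_on_def distr_deriv_def by blast
      then show ?thesis
        using is_prim_distr[OF G assms(4) \<phi>] distr_of_diff[OF assms(2) Ga test_function_deriv[OF \<phi>]] by simp
    qed
  qed (use assms(4) in auto)
  show ?thesis
  proof
    show "is_prim A B (\<lambda>x. c + integral {A..x} g) g" by (rule is_prim_integral[OF assms(3)])
    show "AE x in lebesgue. x \<in> {A<..<B} \<longrightarrow> c + integral {A..x} g = v x" using c by eventually_elim auto
  qed
qed

text \<open>Both \<open>v\<close> and its weak derivative \<open>g\<close> get continuous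
  representatives \<open>V\<close> and \<open>P\<close>. As \<open>P\<close> agrees with
  \<open>g\<close> almost everywhere, it also serves as the density of \<open>V\<close>.\<close>

lemma sobolev_H2_imp_prim:
  assumes "v \<in> sobolev_H 2 {A<..<B}" "A < B"
  obtains V P h where "is_prim A B V P" "is_prim A B P h" "h \<in> L2 {A<..<B}"
    "AE x in lebesgue. x \<in> {A<..<B} \<longrightarrow> V x = v x"
proof -
  obtain g h where v: "v \<in> L2 {A<..<B}" "is_weak_deriv {A<..<B} v g"
    and g: "g \<in> L2 {A<..<B}" "is_weak_deriv {A<..<B} g h" and h: "h \<in> L2 {A<..<B}"
    using assms(1) by (auto simp: numeral_2_eq_2)
  obtain P where P: "is_prim A B P h" "AE x in lebesgue. x \<in> {A<..<B} \<longrightarrow> P x = g x"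
    using is_weak_deriv_imp_prim[OF g(2) L2_integrable[OF g(1)] L2_integrable[OF h] assms(2)] .
  obtain V where V: "is_prim A B V g" "AE x in lebesgue. x \<in> {A<..<B} \<longrightarrow> V x = v x"
    using is_weak_deriv_imp_prim[OF v(2) L2_integrable[OF v(1)] L2_integrable[OF g(1)] assms(2)] .
  have "AE x in lebesgue. x \<in> {A<..<B} \<longrightarrow> g x = P x" using P(2) by eventually_elim auto
  then show ?thesis using that[OF is_prim_AE_cong[OF V(1)] P(1) h V(2)] by blast
qed

lemma sobolev_H2_if_prim:
  assumes "is_prim A B V P" "is_prim A B P h" "h \<in> L2 {A<..<B}"
    "AE x in lebesgue. x \<in> {A<..<B} \<longrightarrow> V x = v x" "A < B"
  shows "v \<in> sobolev_H 2 {A<..<B}"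
proof -
  have "v \<in> L2 {A<..<B}" "P \<in> L2 {A<..<B}"
    using L2_AE_cong[OF L2_continuous[OF is_prim_continuous[OF assms(1)]] assms(4)]
      L2_continuous[OF is_prim_continuous[OF assms(2)]] by auto
  moreover have "is_weak_deriv {A<..<B} v P" by (rule is_weak_deriv_prim[OF assms(1,5,4)])
  moreover have "is_weak_deriv {A<..<B} P h" by (rule is_weak_deriv_prim[OF assms(2,5)]) auto
  ultimately show ?thesis using assms(3) by (auto simp: numeral_2_eq_2)
qed

section \<open>Piecewise Sobolev functions\<close>

text \<open>The steps are left continuous: with \<open>jump_prim\<close> the left limit at \<open>x\<close> is \<open>V x\<close> and the right
  limit is \<open>V x + j x\<close>.\<close>

definition step :: "real set \<Rightarrow> (real \<Rightarrow> real) \<Rightarrow> real \<Rightarrow> real" where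
  "step D j x = (\<Sum>s\<in>D. if s < x then j s else 0)"

definition jump_prim ::
  "real \<Rightarrow> real \<Rightarrow> real set \<Rightarrow> (real \<Rightarrow> real) \<Rightarrow> (real \<Rightarrow> real) \<Rightarrow> (real \<Rightarrow> real) \<Rightarrow> bool" where
  "jump_prim A B D V g j \<longleftrightarrow> is_prim A B (\<lambda>x. V x - step D j x) g \<and>
     finite D \<and> D \<subseteq> {A<..<B} \<and> (\<forall>s. s \<notin> D \<longrightarrow> j s = 0)"

lemma jump_primD:
  assumes "jump_prim A B D V g j"
  shows "is_prim A B (\<lambda>x. V x - step D j x) g" "finite D" "D \<subseteq> {A<..<B}" "s \<notin> D \<Longrightarrow> j s = 0"
  using assms by (auto simp: jump_prim_def)

lemma jump_prim_empty: "is_prim A B V g \<Longrightarrow> jump_prim A B {} V g (\<lambda>_. 0)"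
  by (simp add: jump_prim_def step_def)

lemma step_superset:
  assumes "finite D'" "D \<subseteq> D'" "\<And>s. s \<notin> D \<Longrightarrow> j s = 0"
  shows "step D' j = step D j"
  unfolding step_def using assms by (intro ext sum.mono_neutral_right) auto

text \<open>\<open>j\<close> may vanish at points of \<open>D\<close>, so \<open>D\<close> is only
  an upper bound for the jump set; this lets two functions be put over a common set.\<close>

lemma jump_prim_superset:
  assumes "jump_prim A B D V g j" "finite D'" "D \<subseteq> D'" "D' \<subseteq> {A<..<B}"
  shows "jump_prim A B D' V g j"
  unfolding jump_prim_def
  using jump_primD[OF assms(1)] step_superset[OF assms(2,3), of j] assms by auto

lemma step_lin: "step D (\<lambda>s. j s + t * k s) x = step D j x + t * step D k x"
  unfolding step_def sum_distrib_left sum.distrib[symmetric] by (rule sum.cong) auto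

lemma jump_prim_lin:
  assumes "jump_prim A B D V g j" "jump_prim A B D W h k"
  shows "jump_prim A B D (\<lambda>x. V x + t * W x) (\<lambda>x. g x + t * h x) (\<lambda>s. j s + t * k s)"
proof -
  have "is_prim A B (\<lambda>x. (V x - step D j x) + t * (W x - step D k x)) (\<lambda>x. g x + t * h x)"
    by (intro is_prim_lin jump_primD(1) assms)
  then have "is_prim A B (\<lambda>x. V x + t * W x - step D (\<lambda>s. j s + t * k s) x) (\<lambda>x. g x + t * h x)"
    by (simp add: step_lin algebra_simps)
  then show ?thesis
    using jump_primD(2-4)[OF assms(1)] jump_primD(2-4)[OF assms(2)] unfolding jump_prim_def by simp
qed

lemma step_L2:
  assumes "finite D" "D \<subseteq> {A<..<B}"
  shows "step D j \<in> L2 {A<..<B}"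
  using assms
proof (induction D rule: finite_induct)
  case empty
  have "step {} j = (\<lambda>x. 0)" by (auto simp: step_def)
  then show ?case using L2_continuous[of A B "\<lambda>x. 0"] by simp
next
  case (insert s D)
  have c: "(\<lambda>x. c) \<in> L2 {a<..<b}" for a b c :: real by (intro L2_continuous continuous_intros)
  have "(\<lambda>x. if s < x then 1 else 0) \<in> L2 {A<..<B}"
  proof (rule L2_join[of _ A s B])
    show "(\<lambda>x. if s < x then 1 else 0) \<in> L2 {A<..<s}" by (rule L2_AE_cong[OF c[of 0]]) auto
    show "(\<lambda>x. if s < x then 1 else 0) \<in> L2 {s<..<B}" by (rule L2_AE_cong[OF c[of 1]]) auto
  qed (use insert in auto)
  then have "(\<lambda>x. step D j x + j s * (if s < x then 1 else 0)) \<in> L2 {A<..<B}"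
    using insert by (intro L2_lin) auto
  moreover have "(\<lambda>x. step D j x + j s * (if s < x then 1 else 0)) = step (insert s D) j"
    using insert by (auto simp: step_def)
  ultimately show ?case by simp
qed

lemma jump_prim_L2:
  assumes "jump_prim A B D V g j" shows "V \<in> L2 {A<..<B}"
proof -
  have "(\<lambda>x. (V x - step D j x) + 1 * step D j x) \<in> L2 {A<..<B}"
    by (intro L2_lin L2_continuous is_prim_continuous[OF jump_primD(1)[OF assms]] step_L2
        jump_primD[OF assms])
  then show ?thesis by simp
qed

text \<open>The unit step at s contributes the integral of \<open>deriv \<phi>\<close> from s to B,
  which is \<open>- \<phi> s\<close>; so each jump becomes a Dirac mass of the distributional
  derivative.\<close>

lemma jump_prim_distr:
  assumes V: "jump_prim A B D V g j" and AB: "A < B" and \<phi>: "test_function {A<..<B} \<phi>"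
  shows "distr_of V (deriv \<phi>) = - distr_of g \<phi> - (\<Sum>s\<in>D. j s * \<phi> s)"
proof -
  note D = jump_primD[OF V]
  have one: "((\<lambda>x. if s < x then deriv \<phi> x else 0) has_integral - \<phi> s) {A..B}" if "s \<in> D" for s
  proof -
    have s: "A < s" "s < B" using that D(3) by auto
    have "(deriv \<phi> has_integral (\<phi> B - \<phi> s)) {s..B}"
      by (rule fundamental_theorem_of_calculus)
        (use s in \<open>auto simp: has_real_derivative_iff_has_vector_derivative[symmetric]
          intro!: has_field_derivative_at_within[OF test_function_has_deriv[OF \<phi>]]\<close>)
    then have "((\<lambda>x. if x \<in> {s..B} then deriv \<phi> x else 0) has_integral (- \<phi> s)) {A..B}"
      using s test_function_zero[OF \<phi>, of B] by (subst has_integral_restrict) auto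
    then show ?thesis
      by (rule has_integral_spike_finite[of "{s}", rotated 2]) auto
  qed
  have "((\<lambda>x. \<Sum>s\<in>D. j s * (if s < x then deriv \<phi> x else 0)) has_integral (\<Sum>s\<in>D. j s * - \<phi> s)) {A..B}"
    by (intro has_integral_sum has_integral_mult_right one D)
  moreover have "(\<lambda>x. \<Sum>s\<in>D. j s * (if s < x then deriv \<phi> x else 0)) = (\<lambda>x. step D j x * deriv \<phi> x)"
    by (auto simp: step_def sum_distrib_right intro!: sum.cong)
  ultimately have "distr_of (step D j) (deriv \<phi>) = (\<Sum>s\<in>D. j s * - \<phi> s)"
    using distr_of_eq_integral[OF L2_integrable[OF step_L2[OF D(2,3)]] test_function_deriv[OF \<phi>]]
    by (simp add: integral_unique)
  moreover have "distr_of (\<lambda>x. V x - step D j x) (deriv \<phi>) = distr_of V (deriv \<phi>) - distr_of (step D j) (deriv \<phi>)"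
    by (intro distr_of_diff[of A B] L2_integrable jump_prim_L2[OF V] step_L2 D test_function_deriv \<phi>)
  ultimately show ?thesis
    using is_prim_distr[OF D(1) AB \<phi>] by (simp add: sum_negf)
qed

text \<open>Realises a finite sum of Dirac masses on the Borel sets. \<open>point_measure\<close>
  lives on the subsets of \<open>D\<close>, hence the push-forward.\<close>

lemma point_masses:
  fixes w :: "real \<Rightarrow> real"
  assumes "finite D" "\<And>s. 0 \<le> w s"
  obtains M :: "real measure" where "finite_measure M" "sets M = sets borel" "emeasure M (- D) = 0"
    "\<And>\<phi>. \<phi> \<in> borel_measurable borel \<Longrightarrow> (LINT x|M. \<phi> x) = (\<Sum>s\<in>D. w s * \<phi> s)"
proof
  let ?P = "point_measure D (\<lambda>s. ennreal (w s))"
  let ?M = "distr ?P borel (\<lambda>x. x)"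
  have m: "(\<lambda>x. x) \<in> measurable ?P borel" by simp
  show "finite_measure ?M"
  proof (rule finite_measure.finite_measure_distr[OF _ m])
    show "finite_measure ?P"
      by (rule finite_measureI) (use assms in \<open>auto simp: space_point_measure emeasure_point_measure_finite\<close>)
  qed
  show "sets ?M = sets borel" by simp
  have "- D \<in> sets borel" using assms(1) by (simp add: finite_imp_closed borel_closed)
  then show "emeasure ?M (- D) = 0" by (simp add: emeasure_distr space_point_measure Int_commute)
  show "(LINT x|?M. \<phi> x) = (\<Sum>s\<in>D. w s * \<phi> s)" if "\<phi> \<in> borel_measurable borel" for \<phi>
    using assms that by (simp add: integral_distr[OF m] lebesgue_integral_point_measure_finite)
qed

text \<open>The jumps split by sign into two positive measures, carried by the finite and hence
  Lebesgue null set \<open>D\<close>.\<close>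

lemma jump_prim_ac_deriv:
  assumes V: "jump_prim A B D V g j" and AB: "A < B"
    and v: "AE x in lebesgue. x \<in> {A<..<B} \<longrightarrow> V x = v x"
  shows "is_ac_deriv {A<..<B} v g"
proof -
  note D = jump_primD[OF V]
  obtain M :: "real measure" where M: "finite_measure M" "sets M = sets borel" "emeasure M (- D) = 0"
    "\<And>\<phi>. \<phi> \<in> borel_measurable borel \<Longrightarrow> (LINT x|M. \<phi> x) = (\<Sum>s\<in>D. max 0 (j s) * \<phi> s)"
    using point_masses[OF D(2), of "\<lambda>s. max 0 (j s)"] by auto
  obtain N :: "real measure" where N: "finite_measure N" "sets N = sets borel" "emeasure N (- D) = 0"
    "\<And>\<phi>. \<phi> \<in> borel_measurable borel \<Longrightarrow> (LINT x|N. \<phi> x) = (\<Sum>s\<in>D. max 0 (- j s) * \<phi> s)"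
    using point_masses[OF D(2), of "\<lambda>s. max 0 (- j s)"] by auto
  have a: "V absolutely_integrable_on {A..B}" by (rule L2_integrable[OF jump_prim_L2[OF V]])
  have eq: "- distr_of v (deriv \<phi>) = distr_of g \<phi> + ((LINT x|M. \<phi> x) - (LINT x|N. \<phi> x))"
    if \<phi>: "test_function {A<..<B} \<phi>" for \<phi>
  proof -
    have b: "\<phi> \<in> borel_measurable borel"
      by (intro borel_measurable_continuous_onI test_function_continuous[OF \<phi>])
    have "(LINT x|M. \<phi> x) - (LINT x|N. \<phi> x) = (\<Sum>s\<in>D. j s * \<phi> s)"
      unfolding M(4)[OF b] N(4)[OF b] sum_subtractf[symmetric]
      by (rule sum.cong) (auto simp: max_def algebra_simps)
    then show ?thesis
      using jump_prim_distr[OF V AB \<phi>] distr_of_AE_cong[OF a v test_function_deriv[OF \<phi>]] by simp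
  qed
  have "D \<in> null_sets lborel" using D(2) by (rule finite_imp_null_set_lborel)
  then show ?thesis
    unfolding is_ac_deriv_def distr_eq_on_def distr_deriv_def
    using M(1-3) N(1-3) eq absolutely_integrable_AE_cong(1)[OF a v] is_prim_ac[OF D(1)]
    by (intro conjI exI[of _ M] exI[of _ N] bexI[of _ D])
      (auto intro: locally_integrableI simp: absolutely_integrable_open_iff)
qed

text \<open>Existence makes the chosen function an absolutely continuous part, uniqueness identifies
  it with the density. From here on the choice operator can be replaced by explicit data.\<close>

lemma ac_deriv_AE:
  assumes "jump_prim A B D V g j" "A < B" "AE x in lebesgue. x \<in> {A<..<B} \<longrightarrow> V x = v x"
  shows "AE x in lebesgue. x \<in> {A<..<B} \<longrightarrow> g x = ac_deriv {A<..<B} v x"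
proof -
  have ac: "is_ac_deriv {A<..<B} v g" by (rule jump_prim_ac_deriv[OF assms])
  then have "is_ac_deriv {A<..<B} v (ac_deriv {A<..<B} v)"
    unfolding ac_deriv_def by (rule someI[of "is_ac_deriv {A<..<B} v"])
  with ac show ?thesis by (rule is_ac_deriv_unique)
qed

section \<open>One-sided limits and discontinuity points\<close>

lemma step_at_right:
  assumes "finite D" "\<And>s. s \<notin> D \<Longrightarrow> j s = 0"
  shows "\<forall>\<^sub>F y in at_right x. step D j y = step D j x + j x"
proof -
  have "\<forall>\<^sub>F y in at_right x. s < y \<longleftrightarrow> s \<le> x" for s
  proof (cases "s \<le> x")
    case True
    then show ?thesis by (auto simp: eventually_at_filter)
  next
    case False
    then show ?thesis
      by (auto simp: eventually_at_right_field intro!: exI[of _ s])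
  qed
  then have "\<forall>\<^sub>F y in at_right x. \<forall>s\<in>D. s < y \<longleftrightarrow> s \<le> x"
    using assms(1) by (simp add: eventually_ball_finite_distrib)
  then show ?thesis
  proof eventually_elim
    case (elim y)
    have "step D j y = (\<Sum>s\<in>D. (if s < x then j s else 0) + (if s = x then j s else 0))"
      unfolding step_def by (rule sum.cong) (use elim in auto)
    also have "\<dots> = step D j x + (if x \<in> D then j x else 0)"
      using assms(1) by (simp add: sum.distrib step_def)
    finally show ?case using assms(2)[of x] by auto
  qed
qed

lemma step_at_left:
  assumes "finite D"
  shows "\<forall>\<^sub>F y in at_left x. step D j y = step D j x"
proof -
  have "\<forall>\<^sub>F y in at_left x. s < y \<longleftrightarrow> s < x" for s
  proof (cases "s < x")
    case True
    then show ?thesis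
      by (auto simp: eventually_at_left_field intro!: exI[of _ s])
  next
    case False
    then show ?thesis by (auto simp: eventually_at_filter)
  qed
  then have "\<forall>\<^sub>F y in at_left x. \<forall>s\<in>D. s < y \<longleftrightarrow> s < x"
    using assms(1) by (simp add: eventually_ball_finite_distrib)
  then show ?thesis by eventually_elim (auto simp: step_def intro!: sum.cong)
qed

lemma jump_prim_at_right:
  assumes "jump_prim A B D V g j" "A \<le> x" "x < B"
  shows "(V \<longlongrightarrow> V x + j x) (at_right x)"
proof -
  note D = jump_primD[OF assms(1)]
  let ?F = "\<lambda>x. V x - step D j x"
  have "continuous_on {x..B} ?F"
    by (rule continuous_on_subset[OF is_prim_continuous[OF D(1)]]) (use assms in auto)
  then have "(?F \<longlongrightarrow> ?F x) (at_right x)" using assms(3) by (rule continuous_on_Icc_at_rightD)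
  then have "((\<lambda>y. ?F y + (step D j x + j x)) \<longlongrightarrow> ?F x + (step D j x + j x)) (at_right x)"
    by (rule tendsto_add[OF _ tendsto_const])
  moreover have "\<forall>\<^sub>F y in at_right x. ?F y + (step D j x + j x) = V y"
  proof -
    have "\<forall>\<^sub>F y in at_right x. step D j y = step D j x + j x"
      by (rule step_at_right[OF D(2)]) (rule D(4))
    then show ?thesis by eventually_elim simp
  qed
  ultimately have "(V \<longlongrightarrow> ?F x + (step D j x + j x)) (at_right x)" by (rule Lim_transform_eventually)
  then show ?thesis by (simp add: add.assoc[symmetric])
qed

lemma jump_prim_at_left:
  assumes "jump_prim A B D V g j" "A < x" "x \<le> B"
  shows "(V \<longlongrightarrow> V x) (at_left x)"
proof -
  note D = jump_primD[OF assms(1)]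
  let ?F = "\<lambda>x. V x - step D j x"
  have "continuous_on {A..x} ?F"
    by (rule continuous_on_subset[OF is_prim_continuous[OF D(1)]]) (use assms in auto)
  then have "(?F \<longlongrightarrow> ?F x) (at_left x)" using assms(2) by (rule continuous_on_Icc_at_leftD)
  then have "((\<lambda>y. ?F y + step D j x) \<longlongrightarrow> ?F x + step D j x) (at_left x)"
    by (rule tendsto_add[OF _ tendsto_const])
  moreover have "\<forall>\<^sub>F y in at_left x. ?F y + step D j x = V y"
    using step_at_left[where x = x and j = j, OF D(2)] by eventually_elim simp
  ultimately have "(V \<longlongrightarrow> ?F x + step D j x) (at_left x)" by (rule Lim_transform_eventually)
  then show ?thesis by simp
qed

text \<open>\<open>ess_tendsto\<close> asks for agreement almost everywhere on the whole line,
  whereas \<open>V\<close> represents \<open>v\<close> on \<open>S\<close> only; the witness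
  therefore switches to \<open>v\<close> itself off \<open>S\<close>.\<close>

lemma ess_tendsto_AE:
  assumes "AE x in lebesgue. x \<in> S \<longrightarrow> V x = v x" "\<forall>\<^sub>F x in F. x \<in> S" "(V \<longlongrightarrow> l) F"
  shows "ess_tendsto v l F"
  unfolding ess_tendsto_def
proof (intro exI conjI)
  show "AE x in lebesgue. (if x \<in> S then V x else v x) = v x" using assms(1) by eventually_elim auto
  show "((\<lambda>x. if x \<in> S then V x else v x) \<longlongrightarrow> l) F"
  proof (rule Lim_transform_eventually[OF assms(3)])
    show "\<forall>\<^sub>F x in F. V x = (if x \<in> S then V x else v x)" using assms(2) by eventually_elim simp
  qed
qed

lemma AE_interval_ex:
  fixes a b :: real
  assumes "AE x in lebesgue. P x" "a < b"
  obtains y where "a < y" "y < b" "P y"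
proof -
  obtain N where N: "N \<in> null_sets lebesgue" "{x. \<not> P x} \<subseteq> N"
    using assms(1) unfolding eventually_ae_filter space_completion by auto
  have "\<not> {a<..<b} \<subseteq> N"
  proof
    assume "{a<..<b} \<subseteq> N"
    then have "emeasure lebesgue {a<..<b} \<le> emeasure lebesgue N" using N(1) by (intro emeasure_mono) auto
    then show False using N(1) assms(2) by (simp add: null_sets_def)
  qed
  then obtain y where "y \<in> {a<..<b}" "y \<notin> N" by blast
  then show ?thesis using N(2) that[of y] by auto
qed

text \<open>A one-sided neighbourhood contains an interval of positive measure. Representatives with
  different limits differ everywhere on such an interval, although they agree almost
  everywhere.\<close>

lemma ess_tendsto_unique:
  assumes "ess_tendsto v l F" "ess_tendsto v l' F" "F = at_right x \<or> F = at_left x"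
  shows "l = l'"
proof (rule ccontr)
  assume ne: "l \<noteq> l'"
  obtain g g' where g: "AE x in lebesgue. g x = v x" "(g \<longlongrightarrow> l) F"
    and g': "AE x in lebesgue. g' x = v x" "(g' \<longlongrightarrow> l') F"
    using assms(1,2) unfolding ess_tendsto_def by blast
  have ae: "AE x in lebesgue. g x - g' x = 0" using g(1) g'(1) by eventually_elim simp
  have "((\<lambda>x. g x - g' x) \<longlongrightarrow> l - l') F" by (intro tendsto_diff g g')
  then have ev: "\<forall>\<^sub>F y in F. g y - g' y \<noteq> 0" using ne by (intro tendsto_imp_eventually_ne) auto
  from assms(3) show False
  proof
    assume "F = at_right x"
    then obtain b where "x < b" "\<forall>y. x < y \<and> y < b \<longrightarrow> g y - g' y \<noteq> 0"
      using ev by (auto simp: eventually_at_right_field)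
    then show False using AE_interval_ex[OF ae] by metis
  next
    assume "F = at_left x"
    then obtain b where "b < x" "\<forall>y. b < y \<and> y < x \<longrightarrow> g y - g' y \<noteq> 0"
      using ev by (auto simp: eventually_at_left_field)
    then show False using AE_interval_ex[OF ae] by metis
  qed
qed

lemma right_lim_jump_prim:
  assumes "jump_prim A B D V g j" "A \<le> x" "x < B"
    and "AE x in lebesgue. x \<in> {A<..<B} \<longrightarrow> V x = v x"
  shows "right_lim v x (V x + j x)"
  unfolding right_lim_def
proof (rule ess_tendsto_AE[OF assms(4) _ jump_prim_at_right[OF assms(1-3)]])
  show "\<forall>\<^sub>F y in at_right x. y \<in> {A<..<B}"
    using assms(2,3) by (auto simp: eventually_at_right_field intro!: exI[of _ B])
qed

lemma left_lim_jump_prim: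
  assumes "jump_prim A B D V g j" "A < x" "x \<le> B"
    and "AE x in lebesgue. x \<in> {A<..<B} \<longrightarrow> V x = v x"
  shows "left_lim v x (V x)"
  unfolding left_lim_def
proof (rule ess_tendsto_AE[OF assms(4) _ jump_prim_at_left[OF assms(1-3)]])
  show "\<forall>\<^sub>F y in at_left x. y \<in> {A<..<B}"
    using assms(2,3) by (auto simp: eventually_at_left_field intro!: exI[of _ A])
qed

text \<open>The one-sided limits are \<open>V x\<close> and \<open>V x + j x\<close>, and essential
  one-sided limits are unique.\<close>

lemma disc_jump_prim:
  assumes V: "jump_prim (- 2) 2 D V g j"
    and v: "AE x in lebesgue. x \<in> {- 2<..<2} \<longrightarrow> V x = v x"
  shows "disc v = {s. j s \<noteq> 0}"
proof -
  have "(\<exists>l. ess_tendsto v l (at x)) \<longleftrightarrow> j x = 0" if x: "x \<in> {- 2<..<2}" for x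
  proof
    assume "\<exists>l. ess_tendsto v l (at x)"
    then obtain l where l: "ess_tendsto v l (at x)" ..
    then have "ess_tendsto v l (at_right x)" "ess_tendsto v l (at_left x)"
      unfolding ess_tendsto_def filterlim_at_split by blast+
    moreover have "ess_tendsto v (V x + j x) (at_right x)" "ess_tendsto v (V x) (at_left x)"
      using right_lim_jump_prim[OF V _ _ v, of x] left_lim_jump_prim[OF V _ _ v, of x] x
      by (auto simp: right_lim_def left_lim_def)
    ultimately have "l = V x + j x" "l = V x"
      using ess_tendsto_unique by blast+
    then show "j x = 0" by simp
  next
    assume "j x = 0"
    then have "(V \<longlongrightarrow> V x) (at x)"
      using jump_prim_at_right[OF V, of x] jump_prim_at_left[OF V, of x] x by (intro filterlim_split_at) auto
    moreover have "\<forall>\<^sub>F y in at x. y \<in> {- 2<..<2}"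
      using x by (intro eventually_at_in_open' ) auto
    ultimately show "\<exists>l. ess_tendsto v l (at x)" using ess_tendsto_AE[OF v] by blast
  qed
  moreover have "x \<in> {- 2<..<2}" if "j x \<noteq> 0" for x
    using that jump_primD(3,4)[OF V] by blast
  ultimately show ?thesis unfolding disc_def by blast
qed

section \<open>Gluing and cutting at the partition points\<close>

lemma is_prim_cong:
  assumes "is_prim a b F f" "\<And>x. x \<in> {a..b} \<Longrightarrow> F x = G x + c"
    and "AE x in lebesgue. x \<in> {a<..<b} \<longrightarrow> f x = g x"
  shows "is_prim a b G g"
proof -
  have "is_prim a b F g" by (rule is_prim_AE_cong[OF assms(1,3)])
  then show ?thesis
    using assms(2) unfolding is_prim_def by (metis add_diff_cancel_right atLeastAtMost_iff order.trans order_refl)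
qed

lemma is_prim_join:
  assumes "is_prim A m F g" "is_prim m B F g" "A \<le> m" "m \<le> B"
  shows "is_prim A B F g"
proof -
  have g: "g absolutely_integrable_on {A..B}"
    by (rule absolutely_integrable_join[OF is_prim_ac[OF assms(1)] is_prim_ac[OF assms(2)] assms(3,4)])
  have "F x - F A = integral {A..x} g" if x: "x \<in> {A..B}" for x
  proof (cases "x \<le> m")
    case True
    then show ?thesis using is_prim_eq[OF assms(1), of x] x by auto
  next
    case False
    have "integral {A..m} g + integral {m..x} g = integral {A..x} g"
      using False assms x by (intro Henstock_Kurzweil_Integration.integral_combine
          set_lebesgue_integral_eq_integral(1) absolutely_integrable_sub[OF g]) auto
    then show ?thesis
      using is_prim_eq[OF assms(1), of m] is_prim_eq[OF assms(2), of x] x False assms(3) by auto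
  qed
  with g show ?thesis unfolding is_prim_def by blast
qed

text \<open>The left piece is kept at the seam, in accordance with the left continuity of the steps;
  so the jump there is the initial value of the right piece minus the final value of the left
  one.\<close>

lemma jump_prim_glue:
  assumes V: "jump_prim A m D V g j" and W: "is_prim m B W h" and "A < m" "m < B"
  shows "jump_prim A B (insert m D) (\<lambda>x. if x \<le> m then V x else W x)
    (\<lambda>x. if x \<le> m then g x else h x) (j(m := W m - V m))"
proof -
  note D = jump_primD[OF V]
  let ?V = "\<lambda>x. if x \<le> m then V x else W x" and ?g = "\<lambda>x. if x \<le> m then g x else h x"
    and ?j = "j(m := W m - V m)"
  let ?F = "\<lambda>x. ?V x - step (insert m D) ?j x"
  have mD: "m \<notin> D" using D(3) by auto
  have st: "step (insert m D) ?j x = (if m < x then W m - V m else 0) + step D j x" for x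
  proof -
    have "(\<Sum>s\<in>D. if s < x then ?j s else 0) = (\<Sum>s\<in>D. if s < x then j s else 0)"
      by (rule sum.cong) (use mD in auto)
    then show ?thesis using D(2) mD by (simp add: step_def)
  qed
  \<comment> \<open>From m on all earlier steps are passed and \<open>step D j\<close> is constant,
    which only shifts the primitive on the second piece.\<close>
  have all: "step D j x = sum j D" if "m \<le> x" for x
    unfolding step_def by (rule sum.cong) (use D(3) that in force)+
  have 1: "is_prim A m ?F ?g"
  proof (rule is_prim_cong[OF D(1), of _ 0])
    show "V x - step D j x = ?F x + 0" if "x \<in> {A..m}" for x using that by (simp add: st)
  qed auto
  have 2: "is_prim m B ?F ?g"
  proof (rule is_prim_cong[OF W, of _ "sum j D + (W m - V m)"])
    show "W x = ?F x + (sum j D + (W m - V m))" if "x \<in> {m..B}" for x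
      using that by (cases "x = m") (auto simp: st all)
  qed auto
  have "is_prim A B ?F ?g" using assms(3,4) by (intro is_prim_join[OF 1 2]) auto
  moreover have "finite (insert m D)" "insert m D \<subseteq> {A<..<B}" using D(2,3) assms(3,4) by auto
  moreover have "?j s = 0" if "s \<notin> insert m D" for s using D(4)[of s] that by auto
  ultimately show ?thesis unfolding jump_prim_def by blast
qed

text \<open>Between consecutive jump points the step function is constant. At l the function
  \<open>V\<close> has the left limit but \<open>W\<close> the right one, hence
  \<open>s \<le> l\<close> in the constant and agreement on the open interval.\<close>

lemma jump_prim_piece:
  assumes V: "jump_prim A B D V g j" and "A \<le> l" "l < r" "r \<le> B" "{l<..<r} \<inter> D = {}"
  obtains W where "is_prim l r W g" "\<And>x. x \<in> {l<..<r} \<Longrightarrow> W x = V x"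
proof
  note D = jump_primD[OF V]
  let ?c = "\<Sum>s\<in>D. if s \<le> l then j s else 0"
  have "is_prim l r (\<lambda>x. V x - step D j x) g" by (rule is_prim_subinterval[OF D(1) assms(2,4)])
  then show "is_prim l r (\<lambda>x. V x - step D j x + ?c) g"
    by (rule is_prim_cong[of _ _ _ _ _ "- ?c"]) auto
  show "V x - step D j x + ?c = V x" if "x \<in> {l<..<r}" for x
  proof -
    have "step D j x = ?c" unfolding step_def
    proof (rule sum.cong)
      fix s assume "s \<in> D"
      then have "s \<notin> {l<..<r}" using assms(5) by blast
      then show "(if s < x then j s else 0) = (if s \<le> l then j s else 0)" using that by auto
    qed simp
    then show ?thesis by simp
  qed
qed

text \<open>\<open>V\<close> and \<open>P\<close> are left continuous representatives of
  \<open>v\<close> and of its absolutely continuous derivative, \<open>h\<close> is the second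
  derivative, \<open>a\<close> and \<open>b\<close> are the jumps at the two levels. One finite set
  \<open>D\<close> serves both, so \<open>a\<close> or \<open>b\<close> may vanish at a point of
  it.\<close>

definition pw_rep where
  "pw_rep A B v D V P h a b \<longleftrightarrow> jump_prim A B D V P a \<and> jump_prim A B D P h b \<and> h \<in> L2 {A<..<B} \<and>
     (AE x in lebesgue. x \<in> {A<..<B} \<longrightarrow> V x = v x)"

text \<open>Induction over the pieces from left to right: the next piece is glued on at both levels
  with the same seam.\<close>

lemma piecewise_H2_imp_rep:
  assumes "v \<in> piecewise_H2 A B" "A < B"
  obtains D V P h a b where "pw_rep A B v D V P h a b"
proof -
  obtain n s where s: "s 0 = A" "s n = B"
    "\<And>i. i < n \<Longrightarrow> s i < s (Suc i)" "\<And>i. i < n \<Longrightarrow> v \<in> sobolev_H 2 {s i<..<s (Suc i)}"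
    using assms(1) unfolding piecewise_H2_def by blast
  have "k < n \<Longrightarrow> A < s (Suc k) \<and> (\<exists>D V P h a b. pw_rep A (s (Suc k)) v D V P h a b)" for k
  proof (induction k)
    case 0
    then obtain V P h where "is_prim A (s 1) V P" "is_prim A (s 1) P h" "h \<in> L2 {A<..<s 1}"
      "AE x in lebesgue. x \<in> {A<..<s 1} \<longrightarrow> V x = v x"
      using sobolev_H2_imp_prim[OF s(4)[of 0] s(3)[of 0]] s(1) by auto
    then have "pw_rep A (s 1) v {} V P h (\<lambda>_. 0) (\<lambda>_. 0)"
      unfolding pw_rep_def by (blast intro: jump_prim_empty)
    then have "pw_rep A (s (Suc 0)) v {} V P h (\<lambda>_. 0) (\<lambda>_. 0)" by simp
    moreover have "A < s (Suc 0)" using s(1) s(3)[OF 0] by simp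
    ultimately show ?case by blast
  next
    case (Suc k)
    let ?m = "s (Suc k)" and ?B = "s (Suc (Suc k))"
    have Am: "A < ?m" and "\<exists>D V P h a b. pw_rep A ?m v D V P h a b"
      using Suc.IH Suc.prems by (meson Suc_lessD)+
    then obtain D V P h a b where "pw_rep A ?m v D V P h a b" by blast
    then have l: "jump_prim A ?m D V P a" "jump_prim A ?m D P h b" "h \<in> L2 {A<..<?m}"
      "AE x in lebesgue. x \<in> {A<..<?m} \<longrightarrow> V x = v x" by (auto simp: pw_rep_def)
    obtain W Q k where r: "is_prim ?m ?B W Q" "is_prim ?m ?B Q k" "k \<in> L2 {?m<..<?B}"
      "AE x in lebesgue. x \<in> {?m<..<?B} \<longrightarrow> W x = v x"
      using sobolev_H2_imp_prim[OF s(4)[of "Suc k"] s(3)[of "Suc k"]] Suc.prems by blast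
    have mB: "?m < ?B" by (rule s(3)[OF Suc.prems])
    let ?V = "\<lambda>x. if x \<le> ?m then V x else W x" and ?P = "\<lambda>x. if x \<le> ?m then P x else Q x"
      and ?h = "\<lambda>x. if x \<le> ?m then h x else k x"
    have "pw_rep A ?B v (insert ?m D) ?V ?P ?h (a(?m := W ?m - V ?m)) (b(?m := Q ?m - P ?m))"
      unfolding pw_rep_def
    proof (intro conjI jump_prim_glue l r Am mB)
      show "?h \<in> L2 {A<..<?B}"
      proof (rule L2_join[of _ A ?m])
        show "?h \<in> L2 {A<..<?m}" by (rule L2_AE_cong[OF l(3)]) auto
        show "?h \<in> L2 {?m<..<?B}" by (rule L2_AE_cong[OF r(3)]) auto
      qed (use Am mB in auto)
      have "AE x in lebesgue. x \<noteq> ?m" by (rule AE_completion[OF AE_lborel_singleton])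
      with l(4) r(4) show "AE x in lebesgue. x \<in> {A<..<?B} \<longrightarrow> ?V x = v x"
        by eventually_elim auto
    qed
    moreover have "A < ?B" using Am mB by simp
    ultimately show ?case by blast
  qed
  note * = this
  obtain m where m: "n = Suc m" using s(1,2) assms(2) by (cases n) auto
  have "\<exists>D V P h a b. pw_rep A B v D V P h a b"
    using *[of m] s(2) m by (metis lessI)
  then show ?thesis using that by blast
qed

text \<open>Cutting at the sorted points of \<open>D\<close> together with the two ends leaves open
  intervals without jumps, on which \<open>jump_prim_piece\<close> gives genuine primitives.\<close>

lemma piecewise_H2_if_rep:
  assumes "pw_rep A B v D V P h a b" "A < B"
  shows "v \<in> piecewise_H2 A B"
proof -
  have r: "jump_prim A B D V P a" "jump_prim A B D P h b" "h \<in> L2 {A<..<B}"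
    "AE x in lebesgue. x \<in> {A<..<B} \<longrightarrow> V x = v x" using assms(1) by (auto simp: pw_rep_def)
  note D = jump_primD[OF r(1)]
  define E where "E = insert A (insert B D)"
  define xs where "xs = sorted_list_of_set E"
  have E: "finite E" "E \<subseteq> {A..B}" using D(2,3) assms(2) by (auto simp: E_def)
  have xs: "set xs = E" "sorted_wrt (<) xs" using E(1) by (auto simp: xs_def)
  have len: "2 \<le> length xs"
  proof -
    have "card {A, B} \<le> card E" using E(1) by (intro card_mono) (auto simp: E_def)
    then show ?thesis using assms(2) E(1) by (simp add: xs_def)
  qed
  define n where "n = length xs - 1"
  have n: "n < length xs" "\<And>i. i < n \<Longrightarrow> Suc i < length xs" using len by (auto simp: n_def)
  have mono: "xs ! i < xs ! j" if "i < j" "j < length xs" for i j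
    using sorted_wrt_nth_less[OF xs(2) that] .
  have inE: "xs ! i \<in> {A..B}" if "i < length xs" for i
    using nth_mem[OF that] xs(1) E(2) by blast
  have s0: "xs ! 0 = A"
  proof -
    obtain i where i: "i < length xs" "xs ! i = A" using xs(1) by (metis E_def in_set_conv_nth insertI1)
    have "A \<le> xs ! 0" using inE[of 0] len by force
    then show ?thesis using mono[of 0 i] i by (cases "i = 0") auto
  qed
  have sn: "xs ! n = B"
  proof -
    obtain i where i: "i < length xs" "xs ! i = B" using xs(1) by (metis E_def in_set_conv_nth insertI1 insertI2)
    have "xs ! n \<le> B" using inE[OF n(1)] by simp
    moreover have "i \<le> n" using i(1) by (simp add: n_def)
    ultimately show ?thesis using mono[of i n] i n(1) by (cases "i = n") auto
  qed
  have piece: "xs ! i < xs ! Suc i \<and> v \<in> sobolev_H 2 {xs ! i<..<xs ! Suc i}" if i: "i < n" for i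
  proof -
    let ?l = "xs ! i" and ?r = "xs ! Suc i"
    have lr: "?l < ?r" "A \<le> ?l" "?r \<le> B"
      using mono[of i "Suc i"] n(2)[OF i] inE[of i] inE[of "Suc i"] by auto
    have empty: "{?l<..<?r} \<inter> D = {}"
    proof (rule ccontr)
      assume "{?l<..<?r} \<inter> D \<noteq> {}"
      then obtain y where y: "?l < y" "y < ?r" "y \<in> D" by auto
      then obtain k where k: "k < length xs" "xs ! k = y"
        using xs(1) by (metis E_def in_set_conv_nth insertI2)
      then show False
      proof -
        consider "k < i" | "k = i" | "k = Suc i" | "Suc i < k" by linarith
        then show False
          using mono[of k i] mono[of "Suc i" k] y k n(2)[OF i] by cases auto
      qed
    qed
    obtain V' where V': "is_prim ?l ?r V' P" "\<And>x. x \<in> {?l<..<?r} \<Longrightarrow> V' x = V x"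
      using jump_prim_piece[OF r(1) lr(2,1,3) empty] by blast
    obtain P' where P': "is_prim ?l ?r P' h" "\<And>x. x \<in> {?l<..<?r} \<Longrightarrow> P' x = P x"
      using jump_prim_piece[OF r(2) lr(2,1,3) empty] by blast
    \<comment> \<open>\<open>P\<close> and \<open>P'\<close> may differ at an end point, which does
      not matter for a density.\<close>
    have "is_prim ?l ?r V' P'" by (rule is_prim_AE_cong[OF V'(1)]) (use P'(2) in auto)
    moreover have "AE x in lebesgue. x \<in> {?l<..<?r} \<longrightarrow> V' x = v x"
      using r(4) by eventually_elim (use V'(2) lr in auto)
    ultimately have "v \<in> sobolev_H 2 {?l<..<?r}"
      using P'(1) L2_sub[OF r(3) lr(2,3)] lr(1) by (intro sobolev_H2_if_prim[of _ _ V' P' h])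
    with lr(1) show ?thesis ..
  qed
  show ?thesis unfolding piecewise_H2_def mem_Collect_eq
    using s0 sn piece by (intro exI[of _ n] exI[of _ "\<lambda>i. xs ! i"]) auto
qed

section \<open>The functionals and their first variation\<close>

definition ip :: "(real \<Rightarrow> real) \<Rightarrow> (real \<Rightarrow> real) \<Rightarrow> real" where
  "ip f g = integral {-1..1} (\<lambda>x. f x * g x)"

lemma L2_mult_integrable:
  assumes "f \<in> L2 {A<..<B}" "g \<in> L2 {A<..<B}"
  shows "(\<lambda>x. f x * g x) integrable_on {A..B}"
  using L2_mult[OF assms] by (intro set_lebesgue_integral_eq_integral(1)) (simp add: absolutely_integrable_open_iff)

lemma ip_commute: "ip f g = ip g f"
  by (simp add: ip_def mult.commute)

lemma ip_lin_left:
  assumes "f \<in> L2 {-1<..<1}" "g \<in> L2 {-1<..<1}" "k \<in> L2 {-1<..<1}"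
  shows "ip (\<lambda>x. f x + t * g x) k = ip f k + t * ip g k"
proof -
  have "ip (\<lambda>x. f x + t * g x) k = integral {-1..1} (\<lambda>x. f x * k x + t * (g x * k x))"
    by (simp add: ip_def algebra_simps)
  also have "\<dots> = integral {-1..1} (\<lambda>x. f x * k x) + integral {-1..1} (\<lambda>x. t * (g x * k x))"
    by (intro Henstock_Kurzweil_Integration.integral_add integrable_on_mult_right L2_mult_integrable assms)
  finally show ?thesis by (simp add: ip_def)
qed

lemma ip_lin_right:
  assumes "f \<in> L2 {-1<..<1}" "g \<in> L2 {-1<..<1}" "k \<in> L2 {-1<..<1}"
  shows "ip k (\<lambda>x. f x + t * g x) = ip k f + t * ip k g"
  using ip_lin_left[OF assms] by (simp add: ip_commute)

lemma ip_square_lin: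
  assumes "f \<in> L2 {-1<..<1}" "g \<in> L2 {-1<..<1}"
  shows "ip (\<lambda>x. f x + t * g x) (\<lambda>x. f x + t * g x) = ip f f + 2 * t * ip f g + t\<^sup>2 * ip g g"
  using assms L2_lin[OF assms, of t]
  by (simp add: ip_lin_left ip_lin_right ip_commute[of g f] power2_eq_square algebra_simps)

lemma distr_of_ip:
  assumes "f \<in> L2 {-1<..<1}" "test_function {-1<..<1} \<phi>"
  shows "distr_of f \<phi> = ip f \<phi>"
  unfolding ip_def by (rule distr_of_eq_integral[OF L2_integrable[OF assms(1)] assms(2)])

lemma set_integral_eq_integral_closed:
  fixes k k' :: "real \<Rightarrow> real"
  assumes "k absolutely_integrable_on {A..B}" "AE x in lebesgue. x \<in> {A<..<B} \<longrightarrow> k x = k' x"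
  shows "(LINT x:{A<..<B}|lebesgue. k' x) = integral {A..B} k"
proof -
  have "k' absolutely_integrable_on {A..B}" by (rule absolutely_integrable_AE_cong(1)[OF assms])
  then have "(LINT x:{A<..<B}|lebesgue. k' x) = integral {A<..<B} k'"
    by (intro set_lebesgue_integral_eq_integral(2)) (simp add: absolutely_integrable_open_iff)
  also have "\<dots> = integral {A..B} k'"
  proof (rule integral_spike_set)
    show "negligible {x \<in> {A<..<B} - {A..B}. k' x \<noteq> 0}" by (rule negligible_subset[of "{}"]) auto
    show "negligible {x \<in> {A..B} - {A<..<B}. k' x \<noteq> 0}" by (rule negligible_subset[of "{A, B}"]) auto
  qed
  also have "\<dots> = integral {A..B} k" by (rule absolutely_integrable_AE_cong(2)[OF assms, symmetric])
  finally show ?thesis .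
qed

text \<open>Meant for \<open>h'\<close> a derivative obtained by choice and \<open>h\<close> an
  explicit representative of it; it serves for \<open>ddot\<close> as well as for the iterated
  \<open>weak_deriv\<close>.\<close>

lemma energy_integral:
  assumes "h \<in> L2 {-1<..<1}" "f \<in> L2 {-1<..<1}" "V \<in> L2 {-1<..<1}"
    and "AE x in lebesgue. x \<in> {-1<..<1} \<longrightarrow> h x = h' x" "AE x in lebesgue. x \<in> {-1<..<1} \<longrightarrow> V x = v x"
  shows "(LINT x:{-1<..<1}|lebesgue. \<eta> * \<bar>h' x\<bar>\<^sup>2 - f x * v x) = \<eta> * ip h h - ip f V"
proof -
  have a: "(\<lambda>x. h x * h x) absolutely_integrable_on {-1..1}" "(\<lambda>x. f x * V x) absolutely_integrable_on {-1..1}"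
    using L2_mult[OF assms(1,1)] L2_mult[OF assms(2,3)] by (auto simp: absolutely_integrable_open_iff)
  have "(\<lambda>x. \<eta> * (h x * h x) - f x * V x) absolutely_integrable_on {-1..1}"
    by (intro set_integral_diff(1) set_integrable_mult_right a)
  moreover have "AE x in lebesgue. x \<in> {-1<..<1} \<longrightarrow> \<eta> * (h x * h x) - f x * V x = \<eta> * \<bar>h' x\<bar>\<^sup>2 - f x * v x"
    using assms(4,5) by eventually_elim (auto simp: power2_eq_square)
  ultimately have "(LINT x:{-1<..<1}|lebesgue. \<eta> * \<bar>h' x\<bar>\<^sup>2 - f x * v x)
      = integral {-1..1} (\<lambda>x. \<eta> * (h x * h x) - f x * V x)"
    by (rule set_integral_eq_integral_closed)
  also have "\<dots> = integral {-1..1} (\<lambda>x. \<eta> * (h x * h x)) - integral {-1..1} (\<lambda>x. f x * V x)"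
    by (intro Henstock_Kurzweil_Integration.integral_diff integrable_on_mult_right
        set_lebesgue_integral_eq_integral(1) a)
  finally show ?thesis by (simp add: ip_def)
qed

lemma fidelity_integral:
  assumes "V \<in> L2 {-1<..<1}" "w \<in> L2 {-1<..<1}" "AE x in lebesgue. x \<in> {-1<..<1} \<longrightarrow> V x = v x"
  shows "(LINT x:{-1<..<1}|lebesgue. \<bar>v x - w x\<bar>\<^sup>2) = ip (\<lambda>x. V x - w x) (\<lambda>x. V x - w x)"
  unfolding ip_def
proof (rule set_integral_eq_integral_closed)
  have "(\<lambda>x. V x - w x) \<in> L2 {-1<..<1}" using L2_lin[OF assms(1,2), of "-1"] by simp
  from L2_mult[OF this this] show "(\<lambda>x. (V x - w x) * (V x - w x)) absolutely_integrable_on {-1..1}"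
    by (simp add: absolutely_integrable_open_iff)
  show "AE x in lebesgue. x \<in> {-1<..<1} \<longrightarrow> (V x - w x) * (V x - w x) = \<bar>v x - w x\<bar>\<^sup>2"
    using assms(3) by eventually_elim (auto simp: power2_eq_square)
qed

section \<open>The functionals in terms of representations\<close>

lemma pw_repD:
  assumes "pw_rep A B v D V P h a b"
  shows "jump_prim A B D V P a" "jump_prim A B D P h b" "h \<in> L2 {A<..<B}"
    "AE x in lebesgue. x \<in> {A<..<B} \<longrightarrow> V x = v x"
  using assms by (auto simp: pw_rep_def)

lemma AE_subset:
  assumes "AE x in lebesgue. x \<in> S \<longrightarrow> P x" "T \<subseteq> S"
  shows "AE x in lebesgue. x \<in> T \<longrightarrow> P x"
  using assms(1) by eventually_elim (use assms(2) in auto)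

lemma dot_AE:
  assumes "pw_rep (-2) 2 v D V P h a b"
  shows "AE x in lebesgue. x \<in> {-2<..<2} \<longrightarrow> P x = dot v x"
  unfolding dot_def by (rule ac_deriv_AE[OF pw_repD(1)[OF assms] _ pw_repD(4)[OF assms]]) simp

lemma ddot_AE:
  assumes "pw_rep (-2) 2 v D V P h a b"
  shows "AE x in lebesgue. x \<in> {-2<..<2} \<longrightarrow> h x = ddot v x"
  unfolding ddot_def by (rule ac_deriv_AE[OF pw_repD(2)[OF assms] _ dot_AE[OF assms]]) simp

lemma disc_rep:
  assumes "pw_rep (-2) 2 v D V P h a b"
  shows "disc v = {s. a s \<noteq> 0}" "disc (dot v) = {s. b s \<noteq> 0}"
  using disc_jump_prim[OF pw_repD(1)[OF assms] pw_repD(4)[OF assms]]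
    disc_jump_prim[OF pw_repD(2)[OF assms] dot_AE[OF assms]] by auto

text \<open>The price of a single point where the function jumps by p and its derivative by q. As a
  sum of such prices the counting terms can be compared with those of a competitor point by
  point.\<close>

definition cost :: "real \<Rightarrow> real \<Rightarrow> real \<Rightarrow> real \<Rightarrow> real" where
  "cost \<alpha> \<beta> p q = (if p \<noteq> 0 then \<alpha> else if q \<noteq> 0 then \<beta> else 0)"

lemma cost_sum:
  fixes a b :: "real \<Rightarrow> real"
  assumes "finite D" "\<And>s. s \<notin> D \<Longrightarrow> a s = 0" "\<And>s. s \<notin> D \<Longrightarrow> b s = 0"
  shows "\<alpha> * real (card {s. a s \<noteq> 0}) + \<beta> * real (card ({s. b s \<noteq> 0} - {s. a s \<noteq> 0}))
    = (\<Sum>s\<in>D. cost \<alpha> \<beta> (a s) (b s))"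
proof -
  have "(\<Sum>s\<in>D. cost \<alpha> \<beta> (a s) (b s))
      = (\<Sum>s\<in>D. (if a s \<noteq> 0 then \<alpha> else 0)) + (\<Sum>s\<in>D. (if b s \<noteq> 0 \<and> a s = 0 then \<beta> else 0))"
    unfolding sum.distrib[symmetric] by (rule sum.cong) (auto simp: cost_def)
  also have "(\<Sum>s\<in>D. (if a s \<noteq> 0 then \<alpha> else 0)) = (\<Sum>s\<in>{s\<in>D. a s \<noteq> 0}. \<alpha>)"
    using assms(1) by (intro sum.inter_filter[symmetric])
  also have "{s\<in>D. a s \<noteq> 0} = {s. a s \<noteq> 0}" using assms(2) by blast
  also have "(\<Sum>s\<in>D. (if b s \<noteq> 0 \<and> a s = 0 then \<beta> else 0)) = (\<Sum>s\<in>{s\<in>D. b s \<noteq> 0 \<and> a s = 0}. \<beta>)"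
    using assms(1) by (intro sum.inter_filter[symmetric])
  also have "{s\<in>D. b s \<noteq> 0 \<and> a s = 0} = {s. b s \<noteq> 0} - {s. a s \<noteq> 0}" using assms(3) by blast
  finally show ?thesis by simp
qed

lemma E1_rep:
  assumes r: "pw_rep (-2) 2 v D V P h a b" and f: "f \<in> L2 {-1<..<1}" and w: "w \<in> L2 {-1<..<1}"
  shows "E1 \<alpha> \<beta> \<eta> \<mu> w f v = (\<Sum>s\<in>D. cost \<alpha> \<beta> (a s) (b s)) + \<eta> * ip h h - ip f V
    + \<mu> * ip (\<lambda>x. V x - w x) (\<lambda>x. V x - w x)"
proof -
  note R = pw_repD[OF r]
  have V: "V \<in> L2 {-1<..<1}" and h: "h \<in> L2 {-1<..<1}"
    using jump_prim_L2[OF R(1)] R(3) by (auto intro: L2_sub)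
  have v: "AE x in lebesgue. x \<in> {-1<..<1} \<longrightarrow> V x = v x" by (rule AE_subset[OF R(4)]) auto
  have dd: "AE x in lebesgue. x \<in> {-1<..<1} \<longrightarrow> h x = ddot v x" by (rule AE_subset[OF ddot_AE[OF r]]) auto
  have c: "\<alpha> * real (card (disc v)) + \<beta> * real (card (disc (dot v) - disc v)) = (\<Sum>s\<in>D. cost \<alpha> \<beta> (a s) (b s))"
    unfolding disc_rep[OF r]
    by (rule cost_sum) (use jump_primD(2,4)[OF R(1)] jump_primD(4)[OF R(2)] in auto)
  show ?thesis
    unfolding E1_def c energy_integral[OF h f V dd v] fidelity_integral[OF V w v] by simp
qed

lemma pw_rep_lin:
  assumes "pw_rep A B u D V P h a b" "pw_rep A B \<phi> D' W Q k c d"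
  shows "pw_rep A B (\<lambda>x. u x + t * \<phi> x) (D \<union> D') (\<lambda>x. V x + t * W x) (\<lambda>x. P x + t * Q x)
    (\<lambda>x. h x + t * k x) (\<lambda>s. a s + t * c s) (\<lambda>s. b s + t * d s)"
proof -
  note r = pw_repD[OF assms(1)] and q = pw_repD[OF assms(2)]
  have DD: "finite (D \<union> D')" "D \<union> D' \<subseteq> {A<..<B}" "D \<subseteq> D \<union> D'" "D' \<subseteq> D \<union> D'"
    using jump_primD(2,3)[OF r(1)] jump_primD(2,3)[OF q(1)] by auto
  have "AE x in lebesgue. x \<in> {A<..<B} \<longrightarrow> V x + t * W x = u x + t * \<phi> x"
    using r(4) q(4) by eventually_elim auto
  then show ?thesis
    unfolding pw_rep_def using DD
    by (intro conjI jump_prim_lin L2_lin r q jump_prim_superset[OF r(1)] jump_prim_superset[OF r(2)]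
        jump_prim_superset[OF q(1)] jump_prim_superset[OF q(2)])
qed

lemma linear_term_zero:
  fixes L Q :: real
  assumes "\<And>t. 0 \<le> t * L + t\<^sup>2 * Q" shows "L = 0"
proof (rule ccontr)
  assume "L \<noteq> 0"
  \<comment> \<open>This q is positive and exceeds Q, so at t = -L/q the linear term -L^2/q
    outweighs the quadratic one.\<close>
  define q where "q = \<bar>Q\<bar> + 1"
  have q: "q > 0" "Q < q" by (auto simp: q_def)
  have "(- L / q) * L + (- L / q)\<^sup>2 * Q = L\<^sup>2 / q\<^sup>2 * (Q - q)"
    using q by (simp add: field_simps power2_eq_square)
  moreover have "L\<^sup>2 / q\<^sup>2 * (Q - q) < 0"
    using q \<open>L \<noteq> 0\<close> by (intro mult_pos_neg) auto
  ultimately show False using assms[of "- L / q"] by linarith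
qed

lemma pw_rep_test_function:
  assumes "test_function S \<phi>"
  shows "pw_rep A B \<phi> {} \<phi> (deriv \<phi>) (deriv (deriv \<phi>)) (\<lambda>_. 0) (\<lambda>_. 0)"
  unfolding pw_rep_def
  by (intro conjI jump_prim_empty is_prim_test_function[OF assms] is_prim_test_function[OF test_function_deriv[OF assms]]
      L2_continuous test_function_continuous[OF test_function_deriv[OF test_function_deriv[OF assms]]]) auto

text \<open>Gluing zero, \<open>q\<close> and zero. Each seam takes the value of the piece to its
  left, so the function lives on the interval from l (excluded) to r (included).\<close>

lemma pw_rep_truncated:
  assumes "A < l" "l < r" "r < B"
    and q: "is_prim l r q q'" "is_prim l r q' q''" "continuous_on {l..r} q''"
  defines "T \<equiv> \<lambda>(k :: real \<Rightarrow> real) x. if x \<le> r then (if x \<le> l then 0 else k x) else 0"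
  shows "pw_rep A B (T q) {r, l} (T q) (T q') (T q'')
    ((\<lambda>_. 0)(l := q l, r := - q r)) ((\<lambda>_. 0)(l := q' l, r := - q' r))"
proof -
  have z: "is_prim c d (\<lambda>_. 0) (\<lambda>_. 0)" for c d by (rule is_prim_FTC) auto
  have one: "jump_prim A B {r, l} (T k) (T k') ((\<lambda>_. 0)(l := k l, r := - k r))"
    if k: "is_prim l r k k'" for k k'
  proof -
    have "jump_prim A r {l} (\<lambda>x. if x \<le> l then 0 else k x) (\<lambda>x. if x \<le> l then 0 else k' x) ((\<lambda>_. 0)(l := k l - 0))"
      by (rule jump_prim_glue[OF jump_prim_empty[OF z] k assms(1,2)])
    from jump_prim_glue[OF this z _ assms(3)] assms(1,2) show ?thesis by (simp add: T_def)
  qed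
  have "T q'' \<in> L2 {A<..<B}"
  proof -
    have z: "(\<lambda>_. 0) \<in> L2 {c<..<d}" for c d by (intro L2_continuous continuous_intros)
    have "T q'' \<in> L2 {A<..<l}" by (rule L2_AE_cong[OF z]) (use assms(2) in \<open>auto simp: T_def\<close>)
    moreover have "T q'' \<in> L2 {l<..<r}" by (rule L2_AE_cong[OF L2_continuous[OF q(3)]]) (auto simp: T_def)
    moreover have "T q'' \<in> L2 {r<..<B}" by (rule L2_AE_cong[OF z]) (auto simp: T_def)
    ultimately show ?thesis using assms(1-3) by (intro L2_join[of _ A r B] L2_join[of _ A l r]) auto
  qed
  then show ?thesis unfolding pw_rep_def using one[OF q(1)] one[OF q(2)] by auto
qed

lemma integral_truncated:
  fixes F :: "real \<Rightarrow> real"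
  assumes "A \<le> l" "l \<le> r" "r \<le> B" "F absolutely_integrable_on {l..r}"
  shows "integral {A..B} (\<lambda>x. if x \<le> r then (if x \<le> l then 0 else F x) else 0) = integral {l..r} F"
proof -
  have "(F has_integral integral {l..r} F) {l..r}"
    using set_lebesgue_integral_eq_integral(1)[OF assms(4)] by (rule integrable_integral)
  then have "((\<lambda>x. if x \<in> {l..r} then F x else 0) has_integral integral {l..r} F) {A..B}"
    using assms(1,3) by (subst has_integral_restrict) auto
  then have "((\<lambda>x. if x \<le> r then (if x \<le> l then 0 else F x) else 0) has_integral integral {l..r} F) {A..B}"
    by (rule has_integral_spike_finite[of "{l}", rotated 2]) auto
  then show ?thesis by (rule integral_unique)
qed

lemma L2_scale:
  assumes "f \<in> L2 {A<..<B}" shows "(\<lambda>x. c * f x) \<in> L2 {A<..<B}"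
proof -
  have "(\<lambda>x. 0 + c * f x) \<in> L2 {A<..<B}"
    by (rule L2_lin[OF L2_continuous[OF continuous_on_const] assms])
  then show ?thesis by simp
qed

lemma ip_scale: "ip (\<lambda>x. c * f x) g = c * ip f g"
  unfolding ip_def mult.assoc by simp

text \<open>Minimality is stated for perturbations that vanish on (-2,-1) and (1,2), and
  \<open>w\<close> is only square integrable, so that the locale also covers the first component of
  part (II) with the second one held fixed as datum.\<close>

locale energy_minimizer =
  fixes \<alpha> \<beta> \<eta> \<mu> :: real and f w u :: "real \<Rightarrow> real" and D V P h a b
  assumes \<eta>: "\<eta> > 0" and \<beta>: "0 < \<beta>" "\<beta> \<le> \<alpha>"
    and f: "f \<in> L2 {-1<..<1}" and w: "w \<in> L2 {-1<..<1}"
    and rep: "pw_rep (-2) 2 u D V P h a b"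
    and minimal: "\<And>\<phi> t. (\<lambda>x. u x + t * \<phi> x) \<in> piecewise_H2 (-2) 2 \<Longrightarrow>
      (\<forall>x \<in> {-2<..<-1} \<union> {1<..<2}. \<phi> x = 0) \<Longrightarrow>
      E1 \<alpha> \<beta> \<eta> \<mu> w f u \<le> E1 \<alpha> \<beta> \<eta> \<mu> w f (\<lambda>x. u x + t * \<phi> x)"
begin

text \<open>What the second derivative of \<open>h\<close> must be according to the Euler
  equation.\<close>

definition rhs :: "real \<Rightarrow> real" where
  "rhs x = (1 / (2 * \<eta>)) * f x + (- \<mu> / \<eta>) * (V x - w x)"

lemma V_L2: "V \<in> L2 {-1<..<1}" and h_L2: "h \<in> L2 {-1<..<1}" and residual_L2: "(\<lambda>x. V x - w x) \<in> L2 {-1<..<1}"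
  and rhs_L2: "rhs \<in> L2 {-1<..<1}"
proof -
  show V: "V \<in> L2 {-1<..<1}" and "h \<in> L2 {-1<..<1}"
    using jump_prim_L2[OF pw_repD(1)[OF rep]] pw_repD(3)[OF rep] by (auto intro: L2_sub)
  show r: "(\<lambda>x. V x - w x) \<in> L2 {-1<..<1}" using L2_lin[OF V w, of "-1"] by simp
  show "rhs \<in> L2 {-1<..<1}" unfolding rhs_def[abs_def] by (intro L2_lin L2_scale f r)
qed

lemma u_AE: "AE x in lebesgue. x \<in> {-1<..<1} \<longrightarrow> V x = u x"
  by (rule AE_subset[OF pw_repD(4)[OF rep]]) auto

lemma ip_rhs:
  assumes "W \<in> L2 {-1<..<1}"
  shows "\<eta> * ip rhs W = ip f W / 2 - \<mu> * ip (\<lambda>x. V x - w x) W"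
proof -
  have "ip rhs W = (1 / (2 * \<eta>)) * ip f W + (- \<mu> / \<eta>) * ip (\<lambda>x. V x - w x) W"
    unfolding rhs_def[abs_def] ip_lin_left[OF L2_scale[OF f] residual_L2 assms] ip_scale ..
  then show ?thesis using \<eta> by (simp add: field_simps)
qed

text \<open>By \<open>le\<close> no point costs more along the variation, so the counting terms drop
  out of the minimality inequality. What remains is a quadratic polynomial in t without constant
  term that is nonnegative for both signs of t, so its linear coefficient is zero.\<close>

lemma first_variation:
  assumes q: "pw_rep (-2) 2 \<phi> D' W Q k c d"
    and out: "\<And>x. x \<in> {-2<..<-1} \<union> {1<..<2} \<Longrightarrow> \<phi> x = 0"
    and le: "\<And>t s. cost \<alpha> \<beta> (a s + t * c s) (b s + t * d s) \<le> cost \<alpha> \<beta> (a s) (b s)"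
  shows "ip h k = ip rhs W"
proof -
  have W: "W \<in> L2 {-1<..<1}" and k: "k \<in> L2 {-1<..<1}"
    using jump_prim_L2[OF pw_repD(1)[OF q]] pw_repD(3)[OF q] by (auto intro: L2_sub)
  let ?r = "\<lambda>x. V x - w x"
  define N where "N t = (\<Sum>s\<in>D \<union> D'. cost \<alpha> \<beta> (a s + t * c s) (b s + t * d s))" for t
  have E: "E1 \<alpha> \<beta> \<eta> \<mu> w f (\<lambda>x. u x + t * \<phi> x) = N t + \<eta> * (ip h h + 2 * t * ip h k + t\<^sup>2 * ip k k)
    - (ip f V + t * ip f W) + \<mu> * (ip ?r ?r + 2 * t * ip ?r W + t\<^sup>2 * ip W W)" for t
  proof -
    have "(\<lambda>x. V x + t * W x - w x) = (\<lambda>x. ?r x + t * W x)" by auto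
    then show ?thesis
      unfolding E1_rep[OF pw_rep_lin[OF rep q] f w] N_def
      by (simp add: ip_square_lin[OF h_L2 k] ip_square_lin[OF residual_L2 W] ip_lin_right[OF V_L2 W f])
  qed
  have "0 \<le> t * (2 * \<eta> * ip h k - ip f W + 2 * \<mu> * ip ?r W) + t\<^sup>2 * (\<eta> * ip k k + \<mu> * ip W W)" for t
  proof -
    have "(\<lambda>x. u x + t * \<phi> x) \<in> piecewise_H2 (-2) 2"
      by (rule piecewise_H2_if_rep[OF pw_rep_lin[OF rep q]]) simp
    then have "E1 \<alpha> \<beta> \<eta> \<mu> w f u \<le> E1 \<alpha> \<beta> \<eta> \<mu> w f (\<lambda>x. u x + t * \<phi> x)"
      using minimal out by blast
    moreover have "E1 \<alpha> \<beta> \<eta> \<mu> w f u = N 0 + \<eta> * ip h h - ip f V + \<mu> * ip ?r ?r"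
      using E[of 0] by simp
    moreover have "N t \<le> N 0" unfolding N_def using le by (intro sum_mono) simp
    ultimately show ?thesis unfolding E[of t] by (simp add: algebra_simps)
  qed
  then have "2 * \<eta> * ip h k - ip f W + 2 * \<mu> * ip ?r W = 0" by (rule linear_term_zero)
  then have "\<eta> * ip h k = \<eta> * ip rhs W" using ip_rhs[OF W] by simp
  then show ?thesis using \<eta> by simp
qed

text \<open>\<open>?K\<close> is a second primitive of \<open>rhs\<close>. By the Euler equation
  \<open>h\<close> minus \<open>?K\<close> has vanishing second distributional derivative, hence is
  affine; \<open>U\<close> is \<open>?K\<close> plus this affine function.\<close>

lemma second_derivative_H2:
  obtains U U' where "is_prim (-1) 1 U U'" "is_prim (-1) 1 U' rhs"
    "AE x in lebesgue. x \<in> {-1<..<1} \<longrightarrow> U x = h x"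
proof -
  let ?K1 = "\<lambda>x. 0 + integral {-1..x} rhs"
  let ?K = "\<lambda>x. 0 + integral {-1..x} ?K1"
  have K1: "is_prim (-1) 1 ?K1 rhs" by (rule is_prim_integral[OF L2_integrable[OF rhs_L2]])
  have K1c: "continuous_on {-1..1} ?K1" by (rule is_prim_continuous[OF K1])
  have K: "is_prim (-1) 1 ?K ?K1"
    by (rule is_prim_integral[OF absolutely_integrable_continuous_real[OF K1c]])
  have Kc: "continuous_on {-1..1} ?K" by (rule is_prim_continuous[OF K])
  have i: "h absolutely_integrable_on {-1..1}" "?K absolutely_integrable_on {-1..1}"
    by (rule L2_integrable[OF h_L2], rule absolutely_integrable_continuous_real[OF Kc])
  obtain c m where cm: "AE x in lebesgue. x \<in> {-1<..<1} \<longrightarrow> h x - ?K x = c + m * x"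
  proof (rule affine_if_second_weak_deriv_zero)
    show "(\<lambda>x. h x - ?K x) absolutely_integrable_on {-1..1}" by (intro set_integral_diff(1) i)
    show "distr_of (\<lambda>x. h x - ?K x) (deriv (deriv \<phi>)) = 0" if \<phi>: "test_function {-1<..<1} \<phi>" for \<phi>
    proof -
      have \<phi>1: "test_function {-1<..<1} (deriv \<phi>)" and \<phi>2: "test_function {-1<..<1} (deriv (deriv \<phi>))"
        by (intro test_function_deriv \<phi>)+
      \<comment> \<open>A test function has no jumps of its own, so every point keeps its
        price.\<close>
      have "ip h (deriv (deriv \<phi>)) = ip rhs \<phi>"
        by (rule first_variation[OF pw_rep_test_function[OF \<phi>]]) (use test_function_zero[OF \<phi>] in auto)
      then have "distr_of h (deriv (deriv \<phi>)) = distr_of rhs \<phi>"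
        by (simp add: distr_of_ip h_L2 rhs_L2 \<phi> \<phi>2)
      moreover have "distr_of ?K (deriv (deriv \<phi>)) = distr_of rhs \<phi>"
        using is_prim_distr[OF K _ \<phi>1] is_prim_distr[OF K1 _ \<phi>] by simp
      ultimately show ?thesis using distr_of_diff[OF i \<phi>2] by simp
    qed
  qed (use that in auto)
  have lin: "is_prim (-1) 1 (\<lambda>x. c + m * x) (\<lambda>_. m)" by (rule is_prim_FTC) (auto intro!: derivative_eq_intros)
  have con: "is_prim (-1) 1 (\<lambda>x. m) (\<lambda>_. 0)" by (rule is_prim_FTC) auto
  show ?thesis
  proof
    show "is_prim (-1) 1 (\<lambda>x. ?K x + 1 * (c + m * x)) (\<lambda>x. ?K1 x + 1 * m)" by (rule is_prim_lin[OF K lin])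
    show "is_prim (-1) 1 (\<lambda>x. ?K1 x + 1 * m) rhs" using is_prim_lin[OF K1 con, of 1] by simp
    show "AE x in lebesgue. x \<in> {-1<..<1} \<longrightarrow> ?K x + 1 * (c + m * x) = h x" using cm by eventually_elim auto
  qed
qed

end

section \<open>Boundary conditions at the jump points\<close>

text \<open>\<open>U\<close> and \<open>U'\<close> are continuous on the closed interval; their
  values at -1 and 1 are the limits from inside.\<close>

locale regular_minimizer = energy_minimizer +
  fixes U U' :: "real \<Rightarrow> real"
  assumes U: "is_prim (-1) 1 U U'" "is_prim (-1) 1 U' rhs"
    and U_AE: "AE x in lebesgue. x \<in> {-1<..<1} \<longrightarrow> U x = h x"
begin

text \<open>The first variation along \<open>q\<close> cut off to [l,r] pairs \<open>U\<close> with
  \<open>q''\<close> and \<open>rhs\<close> with \<open>q\<close>. After two integrations by parts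
  on [l,r] the integrals cancel and only the boundary terms remain.\<close>

lemma boundary_identity:
  assumes lr: "-1 \<le> l" "l < r" "r \<le> 1"
    and q: "is_prim l r q q'" "is_prim l r q' q''" "continuous_on {l..r} q''"
    and le: "\<And>t s. cost \<alpha> \<beta> (a s + t * ((\<lambda>_. 0)(l := q l, r := - q r)) s)
      (b s + t * ((\<lambda>_. 0)(l := q' l, r := - q' r)) s) \<le> cost \<alpha> \<beta> (a s) (b s)"
  shows "U r * q' r - U' r * q r = U l * q' l - U' l * q l"
proof -
  define T where "T k x = (if x \<le> r then (if x \<le> l then 0 else k x) else 0)" for k :: "real \<Rightarrow> real" and x
  have tr: "pw_rep (-2) 2 (T q) {r, l} (T q) (T q') (T q'')
    ((\<lambda>_. 0)(l := q l, r := - q r)) ((\<lambda>_. 0)(l := q' l, r := - q' r))"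
    using pw_rep_truncated[of "-2" l r 2 q q' q''] lr q unfolding T_def[abs_def] by simp
  have "ip h (T q'') = ip rhs (T q)"
    by (rule first_variation[OF tr _ le]) (use lr in \<open>auto simp: T_def\<close>)
  moreover have "ip h (T q'') = integral {l..r} (\<lambda>x. U x * q'' x)"
  proof -
    have T2: "T q'' \<in> L2 {-1<..<1}" using L2_sub[OF pw_repD(3)[OF tr]] by auto
    have "(\<lambda>x. h x * T q'' x) absolutely_integrable_on {-1..1}"
      using L2_mult[OF h_L2 T2] by (simp add: absolutely_integrable_open_iff)
    moreover have "AE x in lebesgue. x \<in> {-1<..<1} \<longrightarrow> h x * T q'' x = U x * T q'' x"
      using U_AE by eventually_elim auto
    ultimately have "ip h (T q'') = integral {-1..1} (\<lambda>x. U x * T q'' x)"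
      unfolding ip_def by (rule absolutely_integrable_AE_cong(2))
    also have "(\<lambda>x. U x * T q'' x) = (\<lambda>x. if x \<le> r then (if x \<le> l then 0 else U x * q'' x) else 0)"
      by (auto simp: T_def)
    also have "integral {-1..1} \<dots> = integral {l..r} (\<lambda>x. U x * q'' x)"
    proof (rule integral_truncated)
      have "continuous_on {l..r} U" by (rule continuous_on_subset[OF is_prim_continuous[OF U(1)]]) (use lr in auto)
      then show "(\<lambda>x. U x * q'' x) absolutely_integrable_on {l..r}"
        by (intro absolutely_integrable_continuous_real continuous_on_mult q(3))
    qed (use lr in auto)
    finally show ?thesis .
  qed
  moreover have "ip rhs (T q) = integral {l..r} (\<lambda>x. rhs x * q x)"
  proof -
    have "(\<lambda>x. rhs x * T q x) = (\<lambda>x. if x \<le> r then (if x \<le> l then 0 else rhs x * q x) else 0)"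
      by (auto simp: T_def)
    moreover have "integral {-1..1} \<dots> = integral {l..r} (\<lambda>x. rhs x * q x)"
      by (rule integral_truncated) (use lr in \<open>auto intro!: absolutely_integrable_mult_continuous
          is_prim_continuous[OF q(1)] L2_integrable[OF L2_sub[OF rhs_L2]]\<close>)
    ultimately show ?thesis by (simp add: ip_def)
  qed
  moreover have "integral {l..r} (\<lambda>x. U x * q'' x) = U r * q' r - U l * q' l - integral {l..r} (\<lambda>x. U' x * q' x)"
    by (rule is_prim_by_parts[OF is_prim_subinterval[OF U(1)] q(2)]) (use lr in auto)
  moreover have "integral {l..r} (\<lambda>x. U' x * q' x) = U' r * q r - U' l * q l - integral {l..r} (\<lambda>x. rhs x * q x)"
    by (rule is_prim_by_parts[OF is_prim_subinterval[OF U(2)] q(1)]) (use lr in auto)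
  ultimately show ?thesis by simp
qed

lemma cubic_prims:
  fixes e p c0 c1 :: real
  defines "q \<equiv> \<lambda>y. (y - e)\<^sup>2 * (c0 + c1 * (y - p))"
    and "q' \<equiv> \<lambda>y. 2 * (y - e) * (c0 + c1 * (y - p)) + (y - e)\<^sup>2 * c1"
    and "q'' \<equiv> \<lambda>y. 2 * (c0 + c1 * (y - p)) + 4 * (y - e) * c1"
  shows "is_prim l r q q'" "is_prim l r q' q''" "continuous_on {l..r} q''"
proof -
  show "is_prim l r q q'"
    unfolding q_def q'_def
    by (rule is_prim_FTC) (auto intro!: derivative_eq_intros continuous_intros simp: power2_eq_square algebra_simps)
  show "is_prim l r q' q''"
    unfolding q'_def q''_def
    by (rule is_prim_FTC) (auto intro!: derivative_eq_intros continuous_intros simp: power2_eq_square algebra_simps)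
  show "continuous_on {l..r} q''" unfolding q''_def by (intro continuous_intros)
qed

text \<open>The cubic \<open>(y - e)\<^sup>2 (c\<^sub>0 + c\<^sub>1 (y - x))\<close> vanishes to second order at the far end \<open>e\<close>, so that
  the truncated competitor jumps at \<open>x\<close> only.\<close>

lemma cubic_identity:
  assumes x: "-1 \<le> x" "x < 1 \<and> e = 1 \<or> x = 1 \<and> e = -1"
    and le: "\<And>t. cost \<alpha> \<beta> (a x + t * ((x - e)\<^sup>2 * c0)) (b x + t * (2 * (x - e) * c0 + (x - e)\<^sup>2 * c1)) \<le> cost \<alpha> \<beta> (a x) (b x)"
  shows "U x * (2 * (x - e) * c0 + (x - e)\<^sup>2 * c1) = U' x * ((x - e)\<^sup>2 * c0)"
proof -
  let ?q = "\<lambda>y. (y - e)\<^sup>2 * (c0 + c1 * (y - x))"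
  let ?q' = "\<lambda>y. 2 * (y - e) * (c0 + c1 * (y - x)) + (y - e)\<^sup>2 * c1"
  note pr = cubic_prims[where e = e and ?c0.0 = c0 and ?c1.0 = c1 and p = x]
  \<comment> \<open>For x = 1 the cut-off function lies to the left of x and its jumps there have
    the opposite sign.\<close>
  have le': "cost \<alpha> \<beta> (a x - t * ((x - e)\<^sup>2 * c0)) (b x - t * (2 * (x - e) * c0 + (x - e)\<^sup>2 * c1)) \<le> cost \<alpha> \<beta> (a x) (b x)" for t
    using le[of "- t"] by simp
  from x(2) show ?thesis
  proof
    assume e: "x < 1 \<and> e = 1"
    have "U 1 * ?q' 1 - U' 1 * ?q 1 = U x * ?q' x - U' x * ?q x"
      by (rule boundary_identity[OF x(1) _ _ pr]) (use e le in auto)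
    then show ?thesis using e by simp
  next
    assume e: "x = 1 \<and> e = -1"
    have "U x * ?q' x - U' x * ?q x = U (-1) * ?q' (-1) - U' (-1) * ?q (-1)"
      by (rule boundary_identity[OF _ _ _ pr]) (use e le' in \<open>auto simp: algebra_simps\<close>)
    then show ?thesis using e by simp
  qed
qed

text \<open>With \<open>c0 = 0\<close> the competitor affects only the jump of the derivative at x,
  not that of the function. A point with a jump or a crease already costs at least \<beta>, and its
  price cannot rise.\<close>

lemma U_zero:
  assumes "x \<in> {-1..1}" "a x \<noteq> 0 \<or> b x \<noteq> 0"
  shows "U x = 0"
proof -
  define e :: real where "e = (if x < 1 then 1 else -1)"
  have e: "x < 1 \<and> e = 1 \<or> x = 1 \<and> e = -1" using assms(1) by (auto simp: e_def)
  have "U x * (2 * (x - e) * 0 + (x - e)\<^sup>2 * 1) = U' x * ((x - e)\<^sup>2 * 0)"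
    by (rule cubic_identity[OF _ e]) (use assms \<beta> in \<open>auto simp: cost_def\<close>)
  then show ?thesis using e by auto
qed

text \<open>The value \<open>- 2 / (x - e)\<close> of \<open>c1\<close> cancels the derivative of
  the cubic at x, so the competitor affects only the jump of the function. This does not raise the
  price where \<open>u\<close> already jumps, nor at a crease when \<alpha> = \<beta>.\<close>

lemma U'_zero:
  assumes "x \<in> {-1..1}" "a x \<noteq> 0 \<or> \<alpha> = \<beta> \<and> b x \<noteq> 0"
  shows "U' x = 0"
proof -
  define e :: real where "e = (if x < 1 then 1 else -1)"
  have e: "x < 1 \<and> e = 1 \<or> x = 1 \<and> e = -1" using assms(1) by (auto simp: e_def)
  then have ne: "x - e \<noteq> 0" by auto
  then have z: "2 * (x - e) * 1 + (x - e)\<^sup>2 * (- 2 / (x - e)) = 0" by (simp add: power2_eq_square)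
  have "U x * (2 * (x - e) * 1 + (x - e)\<^sup>2 * (- 2 / (x - e))) = U' x * ((x - e)\<^sup>2 * 1)"
    by (rule cubic_identity[OF _ e]) (use assms \<beta> in \<open>auto simp: cost_def\<close>)
  then show ?thesis using ne unfolding z by auto
qed

section \<open>From \<open>U\<close> and \<open>U'\<close> back to \<open>ddot u\<close> and
  \<open>dddot u\<close>\<close>

lemma disc_u: "disc u = {s. a s \<noteq> 0}" "disc (dot u) = {s. b s \<noteq> 0}"
  by (rule disc_rep[OF rep])+

lemma ddot_U_AE: "AE x in lebesgue. x \<in> {-1<..<1} \<longrightarrow> U x = ddot u x"
proof -
  have "AE x in lebesgue. x \<in> {-1<..<1} \<longrightarrow> h x = ddot u x" by (rule AE_subset[OF ddot_AE[OF rep]]) auto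
  with U_AE show ?thesis by eventually_elim auto
qed

lemma dddot_U'_AE: "AE x in lebesgue. x \<in> {-1<..<1} \<longrightarrow> U' x = dddot u x"
  unfolding dddot_def by (rule ac_deriv_AE[OF jump_prim_empty[OF U(1)] _ ddot_U_AE]) simp

lemma limits:
  shows "-1 \<le> x \<Longrightarrow> x < 1 \<Longrightarrow> right_lim (ddot u) x (U x)"
    and "-1 < x \<Longrightarrow> x \<le> 1 \<Longrightarrow> left_lim (ddot u) x (U x)"
    and "-1 \<le> x \<Longrightarrow> x < 1 \<Longrightarrow> right_lim (dddot u) x (U' x)"
    and "-1 < x \<Longrightarrow> x \<le> 1 \<Longrightarrow> left_lim (dddot u) x (U' x)"
  using right_lim_jump_prim[OF jump_prim_empty[OF U(1)] _ _ ddot_U_AE, of x]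
    left_lim_jump_prim[OF jump_prim_empty[OF U(1)] _ _ ddot_U_AE, of x]
    right_lim_jump_prim[OF jump_prim_empty[OF U(2)] _ _ dddot_U'_AE, of x]
    left_lim_jump_prim[OF jump_prim_empty[OF U(2)] _ _ dddot_U'_AE, of x] by auto

lemma ddot_H2: "ddot u \<in> sobolev_H 2 {-1<..<1}"
  by (rule sobolev_H2_if_prim[OF U rhs_L2 ddot_U_AE]) simp

lemma ddot_distr:
  assumes \<phi>: "test_function {-1<..<1} \<phi>"
  shows "distr_of (ddot u) (deriv (deriv \<phi>)) = distr_of rhs \<phi>"
proof -
  have "U absolutely_integrable_on {-1..1}"
    by (rule absolutely_integrable_continuous_real[OF is_prim_continuous[OF U(1)]])
  then have "distr_of (ddot u) (deriv (deriv \<phi>)) = distr_of U (deriv (deriv \<phi>))"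
    by (intro distr_of_AE_cong[symmetric, OF _ ddot_U_AE] test_function_deriv \<phi>)
  also have "\<dots> = distr_of rhs \<phi>"
    using is_prim_distr[OF U(1) _ test_function_deriv[OF \<phi>]] is_prim_distr[OF U(2) _ \<phi>] by simp
  finally show ?thesis .
qed

lemma euler_equation_test:
  assumes \<phi>: "test_function {-1<..<1} \<phi>"
  shows "\<eta> * distr_of (ddot u) (deriv (deriv \<phi>)) + \<mu> * distr_of (\<lambda>x. u x - w x) \<phi> = distr_of (\<lambda>x. f x / 2) \<phi>"
proof -
  have \<phi>L: "\<phi> \<in> L2 {-1<..<1}" by (rule L2_continuous[OF test_function_continuous[OF \<phi>]])
  have ae: "AE x in lebesgue. x \<in> {-1<..<1} \<longrightarrow> V x - w x = u x - w x" using u_AE by eventually_elim auto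
  have "distr_of (\<lambda>x. u x - w x) \<phi> = ip (\<lambda>x. V x - w x) \<phi>"
    using distr_of_AE_cong[OF L2_integrable[OF residual_L2] ae \<phi>] distr_of_ip[OF residual_L2 \<phi>] by simp
  moreover have "distr_of (\<lambda>x. f x / 2) \<phi> = ip f \<phi> / 2"
    using distr_of_ip[OF L2_scale[OF f, of "1/2"] \<phi>] ip_scale[of "1/2" f \<phi>] by simp
  moreover have "\<eta> * distr_of rhs \<phi> = ip f \<phi> / 2 - \<mu> * ip (\<lambda>x. V x - w x) \<phi>"
    using distr_of_ip[OF rhs_L2 \<phi>] ip_rhs[OF \<phi>L] by simp
  ultimately show ?thesis unfolding ddot_distr[OF \<phi>] by simp
qed

lemma euler_equation:
  "distr_eq_on {-1<..<1}
     (\<lambda>\<phi>. \<eta> * (distr_deriv ^^ 2) (distr_of (ddot u)) \<phi> + \<mu> * distr_of (\<lambda>x. u x - w x) \<phi>)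
     (distr_of (\<lambda>x. f x / 2))"
  unfolding distr_eq_on_def using euler_equation_test by (simp add: numeral_2_eq_2 distr_deriv_def)

text \<open>The first two differentiations create Dirac masses at the jumps of \<open>u\<close> and
  of \<open>dot u\<close> only, and the test functions vanish there together with their
  derivatives.\<close>

lemma fourth_derivative:
  assumes \<phi>: "test_function ({-1<..<1} - (disc u \<union> disc (dot u))) \<phi>"
  shows "distr_of u (deriv (deriv (deriv (deriv \<phi>)))) = distr_of (ddot u) (deriv (deriv \<phi>))"
proof -
  note r = pw_repD[OF rep]
  let ?S = "{-1<..<1} - (disc u \<union> disc (dot u))"
  have t: "test_function ?S (deriv \<phi>)" "test_function ?S (deriv (deriv \<phi>))"
    "test_function ?S (deriv (deriv (deriv \<phi>)))" "test_function ?S (deriv (deriv (deriv (deriv \<phi>))))"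
    by (intro test_function_deriv \<phi>)+
  note t2 = t[THEN test_function_mono, of "{-2<..<2}"]
  have sub: "?S \<subseteq> {-2<..<2}" by auto
  have za: "a s * deriv (deriv (deriv \<phi>)) s = 0" for s
    using test_function_zero[OF t(3), of s] disc_u(1) by auto
  have zb: "b s * deriv (deriv \<phi>) s = 0" for s
    using test_function_zero[OF t(2), of s] disc_u(2) by auto
  have "distr_of u (deriv (deriv (deriv (deriv \<phi>)))) = distr_of V (deriv (deriv (deriv (deriv \<phi>))))"
    by (rule distr_of_AE_cong[OF L2_integrable[OF jump_prim_L2[OF r(1)]] r(4) t2(4)[OF sub], symmetric])
  also have "\<dots> = - distr_of P (deriv (deriv (deriv \<phi>)))"
    using jump_prim_distr[OF r(1) _ t2(3)[OF sub]] za by simp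
  also have "\<dots> = distr_of h (deriv (deriv \<phi>))"
    using jump_prim_distr[OF r(2) _ t2(2)[OF sub]] zb by simp
  also have "\<dots> = distr_of (ddot u) (deriv (deriv \<phi>))"
    by (rule distr_of_AE_cong[OF L2_integrable[OF r(3)] ddot_AE[OF rep] t2(2)[OF sub]])
  finally show ?thesis .
qed

lemma euler_equation_fourth:
  "distr_eq_on ({-1<..<1} - (disc u \<union> disc (dot u)))
     (\<lambda>\<phi>. \<eta> * (distr_deriv ^^ 4) (distr_of u) \<phi> + \<mu> * distr_of (\<lambda>x. u x - w x) \<phi>)
     (distr_of (\<lambda>x. f x / 2))"
  unfolding distr_eq_on_def
proof (intro allI impI)
  fix \<phi> assume \<phi>: "test_function ({-1<..<1} - (disc u \<union> disc (dot u))) \<phi>"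
  have "test_function {-1<..<1} \<phi>" by (rule test_function_mono[OF \<phi>]) auto
  from euler_equation_test[OF this] fourth_derivative[OF \<phi>]
  show "\<eta> * (distr_deriv ^^ 4) (distr_of u) \<phi> + \<mu> * distr_of (\<lambda>x. u x - w x) \<phi> = distr_of (\<lambda>x. f x / 2) \<phi>"
    by (simp add: numeral_eq_Suc distr_deriv_def)
qed

end

section \<open>Regular data for a minimizer and the equation for the smooth component\<close>

lemma regular_minimizer_exists:
  assumes "\<eta> > 0" "0 < \<beta>" "\<beta> \<le> \<alpha>" "f \<in> L2 {-1<..<1}" "w \<in> L2 {-1<..<1}" "u \<in> piecewise_H2 (-2) 2"
    and "\<And>\<phi> t. (\<lambda>x. u x + t * \<phi> x) \<in> piecewise_H2 (-2) 2 \<Longrightarrow>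
      (\<forall>x \<in> {-2<..<-1} \<union> {1<..<2}. \<phi> x = 0) \<Longrightarrow>
      E1 \<alpha> \<beta> \<eta> \<mu> w f u \<le> E1 \<alpha> \<beta> \<eta> \<mu> w f (\<lambda>x. u x + t * \<phi> x)"
  obtains D V P h a b U U' where "regular_minimizer \<alpha> \<beta> \<eta> \<mu> f w u D V P h a b U U'"
proof -
  obtain D V P h a b where rep: "pw_rep (-2) 2 u D V P h a b"
    by (rule piecewise_H2_imp_rep[OF assms(6)]) simp
  have E: "energy_minimizer \<alpha> \<beta> \<eta> \<mu> f w u D V P h a b"
    by unfold_locales (use assms(1-5) rep in simp_all, rule assms(7))
  obtain U U' where "is_prim (-1) 1 U U'" "is_prim (-1) 1 U' (energy_minimizer.rhs \<eta> \<mu> f w V)"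
    "AE x in lebesgue. x \<in> {-1<..<1} \<longrightarrow> U x = h x"
    by (rule energy_minimizer.second_derivative_H2[OF E])
  with E have "regular_minimizer \<alpha> \<beta> \<eta> \<mu> f w u D V P h a b U U'"
    by (simp add: regular_minimizer_def regular_minimizer_axioms_def)
  then show ?thesis using that by blast
qed

text \<open>The inner choice agrees with \<open>P\<close> almost everywhere, and weak derivatives do
  not notice null sets, so \<open>h\<close> is also a weak derivative of the chosen
  function.\<close>

lemma weak_deriv2_AE:
  assumes V: "is_prim A B V P" and P: "is_prim A B P h" and "A < B"
    and v: "AE x in lebesgue. x \<in> {A<..<B} \<longrightarrow> V x = v x"
  shows "AE x in lebesgue. x \<in> {A<..<B} \<longrightarrow> h x = weak_deriv {A<..<B} (weak_deriv {A<..<B} v) x"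
proof -
  have 1: "is_weak_deriv {A<..<B} v P" by (rule is_weak_deriv_prim[OF V assms(3) v])
  then have "is_weak_deriv {A<..<B} v (weak_deriv {A<..<B} v)"
    unfolding weak_deriv_def by (rule someI[of "is_weak_deriv {A<..<B} v"])
  then have ae: "AE x in lebesgue. x \<in> {A<..<B} \<longrightarrow> P x = weak_deriv {A<..<B} v x"
    by (rule is_weak_deriv_unique[OF 1])
  let ?g = "weak_deriv {A<..<B} v"
  have 2: "is_weak_deriv {A<..<B} ?g h" by (rule is_weak_deriv_prim[OF P assms(3) ae])
  then have "is_weak_deriv {A<..<B} ?g (weak_deriv {A<..<B} ?g)"
    unfolding weak_deriv_def[of _ ?g] by (rule someI[of "is_weak_deriv {A<..<B} ?g"])
  then show ?thesis by (rule is_weak_deriv_unique[OF 2])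
qed

text \<open>Only \<open>up\<close> is varied, by test functions in (-1,1). The counting terms and
  all other terms in \<open>ur\<close> alone form the constant \<open>C\<close>; the rest is a
  quadratic polynomial in t, treated as in \<open>first_variation\<close>.\<close>

lemma smooth_component_equation:
  assumes up: "up \<in> sobolev_H 2 {-2<..<2}" and ur: "ur \<in> L2 {-1<..<1}" and fp: "fp \<in> L2 {-1<..<1}"
    and minimal: "\<And>\<phi> t. test_function {-1<..<1} \<phi> \<Longrightarrow> (\<lambda>x. up x + t * \<phi> x) \<in> sobolev_H 2 {-2<..<2} \<Longrightarrow>
      F1 \<alpha> \<beta> \<eta> \<mu> \<gamma> fr fp (ur, up) \<le> F1 \<alpha> \<beta> \<eta> \<mu> \<gamma> fr fp (ur, \<lambda>x. up x + t * \<phi> x)"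
  shows "distr_eq_on {-1<..<1}
    (\<lambda>\<phi>. \<gamma> * (distr_deriv ^^ 4) (distr_of up) \<phi> + \<mu> * distr_of (\<lambda>x. up x - ur x) \<phi>)
    (distr_of (\<lambda>x. fp x / 2))"
  unfolding distr_eq_on_def
proof (intro allI impI)
  fix \<phi> assume \<phi>: "test_function {-1<..<1} \<phi>"
  obtain V P h where V: "is_prim (-2) 2 V P" and P: "is_prim (-2) 2 P h" and h2: "h \<in> L2 {-2<..<2}"
    and v: "AE x in lebesgue. x \<in> {-2<..<2} \<longrightarrow> V x = up x"
    using sobolev_H2_imp_prim[OF up] by auto
  let ?k = "deriv (deriv \<phi>)" and ?r = "\<lambda>x. V x - ur x"
  have pr: "is_prim (-2) 2 (\<lambda>x. V x + t * \<phi> x) (\<lambda>x. P x + t * deriv \<phi> x)"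
    "is_prim (-2) 2 (\<lambda>x. P x + t * deriv \<phi> x) (\<lambda>x. h x + t * ?k x)" for t
    by (intro is_prim_lin V P is_prim_test_function[OF \<phi>] is_prim_test_function[OF test_function_deriv[OF \<phi>]])+
  have kL: "?k \<in> L2 {A<..<B}" and \<phi>L: "\<phi> \<in> L2 {A<..<B}" for A B
    by (intro L2_continuous test_function_continuous[OF test_function_deriv[OF test_function_deriv[OF \<phi>]]]
        test_function_continuous[OF \<phi>])+
  have hL: "h \<in> L2 {-1<..<1}" by (rule L2_sub[OF h2]) auto
  have VL: "V \<in> L2 {-1<..<1}" by (rule L2_sub[OF L2_continuous[OF is_prim_continuous[OF V]]]) auto
  have rL: "?r \<in> L2 {-1<..<1}" using L2_lin[OF VL ur, of "-1"] by simp
  define C where "C = \<alpha> * real (card (disc ur)) + \<beta> * real (card (disc (dot ur) - disc ur))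
     + (LINT x:{-1<..<1}|lebesgue. \<eta> * \<bar>ddot ur x\<bar>\<^sup>2 - fr x * ur x)"
  have vt: "AE x in lebesgue. x \<in> {-2<..<2} \<longrightarrow> V x + t * \<phi> x = up x + t * \<phi> x" for t
    using v by eventually_elim auto
  have F: "F1 \<alpha> \<beta> \<eta> \<mu> \<gamma> fr fp (ur, \<lambda>x. up x + t * \<phi> x)
    = C + \<mu> * (ip ?r ?r + 2 * t * ip ?r \<phi> + t\<^sup>2 * ip \<phi> \<phi>)
      + (\<gamma> * (ip h h + 2 * t * ip h ?k + t\<^sup>2 * ip ?k ?k) - (ip fp V + t * ip fp \<phi>))" for t
  proof -
    have VtL: "(\<lambda>x. V x + t * \<phi> x) \<in> L2 {-1<..<1}" and htL: "(\<lambda>x. h x + t * ?k x) \<in> L2 {-1<..<1}"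
      by (intro L2_lin VL \<phi>L hL kL)+
    have vt1: "AE x in lebesgue. x \<in> {-1<..<1} \<longrightarrow> V x + t * \<phi> x = up x + t * \<phi> x"
      by (rule AE_subset[OF vt]) auto
    have "AE x in lebesgue. x \<in> {-2<..<2} \<longrightarrow> h x + t * ?k x
        = weak_deriv {-2<..<2} (weak_deriv {-2<..<2} (\<lambda>x. up x + t * \<phi> x)) x"
      by (rule weak_deriv2_AE[OF pr _ vt]) simp
    then have ht: "AE x in lebesgue. x \<in> {-1<..<1} \<longrightarrow> h x + t * ?k x
        = weak_deriv {-2<..<2} (weak_deriv {-2<..<2} (\<lambda>x. up x + t * \<phi> x)) x"
      by (rule AE_subset) auto
    have "(\<lambda>x. V x + t * \<phi> x - ur x) = (\<lambda>x. ?r x + t * \<phi> x)" by auto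
    then have "(LINT x:{-1<..<1}|lebesgue. \<bar>ur x - (up x + t * \<phi> x)\<bar>\<^sup>2)
        = ip ?r ?r + 2 * t * ip ?r \<phi> + t\<^sup>2 * ip \<phi> \<phi>"
      using fidelity_integral[OF VtL ur vt1] ip_square_lin[OF rL \<phi>L] by (simp add: abs_minus_commute)
    moreover have "(LINT x:{-1<..<1}|lebesgue.
          \<gamma> * \<bar>weak_deriv {-2<..<2} (weak_deriv {-2<..<2} (\<lambda>x. up x + t * \<phi> x)) x\<bar>\<^sup>2 - fp x * (up x + t * \<phi> x))
        = \<gamma> * (ip h h + 2 * t * ip h ?k + t\<^sup>2 * ip ?k ?k) - (ip fp V + t * ip fp \<phi>)"
      using energy_integral[OF htL fp VtL ht vt1]
      by (simp add: ip_square_lin[OF hL kL] ip_lin_right[OF VL \<phi>L fp])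
    ultimately show ?thesis unfolding F1_def C_def by simp
  qed
  have "0 \<le> t * (2 * \<gamma> * ip h ?k - ip fp \<phi> + 2 * \<mu> * ip ?r \<phi>) + t\<^sup>2 * (\<gamma> * ip ?k ?k + \<mu> * ip \<phi> \<phi>)" for t
  proof -
    have "(\<lambda>x. up x + t * \<phi> x) \<in> sobolev_H 2 {-2<..<2}"
      by (rule sobolev_H2_if_prim[OF pr L2_lin[OF h2 kL] vt]) simp
    then have "F1 \<alpha> \<beta> \<eta> \<mu> \<gamma> fr fp (ur, \<lambda>x. up x + 0 * \<phi> x) \<le> F1 \<alpha> \<beta> \<eta> \<mu> \<gamma> fr fp (ur, \<lambda>x. up x + t * \<phi> x)"
      using minimal[OF \<phi>] by simp
    then show ?thesis unfolding F by (simp add: algebra_simps)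
  qed
  then have "2 * \<gamma> * ip h ?k - ip fp \<phi> + 2 * \<mu> * ip ?r \<phi> = 0" by (rule linear_term_zero)
  moreover have "distr_of up (deriv (deriv ?k)) = ip h ?k"
  proof -
    have t: "test_function {-1<..<1} ?k" by (intro test_function_deriv \<phi>)
    have s: "{-1<..<1} \<subseteq> {-2<..<2::real}" by auto
    note t2 = test_function_mono[OF t s]
    have "V absolutely_integrable_on {-2..2}"
      by (rule absolutely_integrable_continuous_real[OF is_prim_continuous[OF V]])
    then have "distr_of up (deriv (deriv ?k)) = distr_of V (deriv (deriv ?k))"
      by (rule distr_of_AE_cong[OF _ v test_function_deriv[OF test_function_deriv[OF t2]], symmetric])
    also have "\<dots> = distr_of h ?k"
      using is_prim_distr[OF V _ test_function_deriv[OF t2]] is_prim_distr[OF P _ t2] by simp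
    finally show ?thesis by (simp add: distr_of_ip[OF hL t])
  qed
  moreover have "distr_of (\<lambda>x. up x - ur x) \<phi> = ip ?r \<phi>"
  proof -
    have "AE x in lebesgue. x \<in> {-1<..<1} \<longrightarrow> ?r x = up x - ur x" using v by eventually_elim auto
    from distr_of_AE_cong[OF L2_integrable[OF rL] this \<phi>] show ?thesis
      by (simp add: distr_of_ip[OF rL \<phi>])
  qed
  moreover have "distr_of (\<lambda>x. fp x / 2) \<phi> = ip fp \<phi> / 2"
    using distr_of_ip[OF L2_scale[OF fp, of "1/2"] \<phi>] ip_scale[of "1/2" fp \<phi>] by simp
  ultimately show "\<gamma> * (distr_deriv ^^ 4) (distr_of up) \<phi> + \<mu> * distr_of (\<lambda>x. up x - ur x) \<phi> = distr_of (\<lambda>x. fp x / 2) \<phi>"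
    by (simp add: numeral_eq_Suc distr_deriv_def)
qed

lemma distr_of_lin:
  assumes "f \<in> L2 {-1<..<1}" "g \<in> L2 {-1<..<1}" "test_function {-1<..<1} \<phi>"
  shows "distr_of (\<lambda>x. f x + t * g x) \<phi> = distr_of f \<phi> + t * distr_of g \<phi>"
  using ip_lin_left[OF assms(1,2) L2_continuous[OF test_function_continuous[OF assms(3)]], of t]
  by (simp add: distr_of_ip[OF _ assms(3)] assms L2_lin)

text \<open>Where \<open>u\<close> agrees with \<open>w\<close>, continuity of \<open>w\<close>
  rules out jumps of \<open>u\<close>. Without jumps \<open>P\<close> is the weak derivative of
  \<open>u\<close>, hence agrees with the continuous function \<open>deriv w\<close>, which rules
  out creases.\<close>

lemma disc_outside:
  assumes w: "Ck_on 2 {-2<..<2} w" and rep: "pw_rep (-2) 2 u D V P h a b"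
    and eq: "AE x in lebesgue. x \<in> {c<..<d} \<longrightarrow> u x = w x" and cd: "-2 \<le> c" "d \<le> 2" and x: "c < x" "x < d"
  shows "x \<notin> disc u \<union> disc (dot u)"
proof -
  have w1: "w differentiable (at y)" and w2: "deriv w differentiable (at y)" if "y \<in> {c<..<d}" for y
  proof -
    have "\<forall>j<2. \<forall>x\<in>{-2<..<2}. ((deriv ^^ j) w) differentiable (at x)" using w by (simp add: Ck_on_def)
    from this[rule_format, of 0 y] this[rule_format, of 1 y]
    show "w differentiable (at y)" "deriv w differentiable (at y)" using that cd by auto
  qed
  have c1: "continuous (at y) w" and c2: "continuous (at y) (deriv w)" if "y \<in> {c<..<d}" for y
    using w1[OF that] w2[OF that] by (auto intro: differentiable_imp_continuous_within)
  have "AE x in lebesgue. x \<in> {c<..<d} \<longrightarrow> w x = u x" using eq by eventually_elim auto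
  from ess_tendsto_AE[OF this] have nu: "y \<notin> disc u" if "y \<in> {c<..<d}" for y
    using c1[OF that] eventually_at_in_open'[of "{c<..<d}" y] that
    unfolding disc_def continuous_at by fastforce
  \<comment> \<open>On a compact subinterval \<open>deriv w\<close> is continuous up to the ends,
    while nothing is known about \<open>w\<close> at -2 and 2.\<close>
  obtain c' d' where cd': "c < c'" "c' < x" "x < d'" "d' < d"
    using dense[OF x(1)] dense[OF x(2)] by auto
  have sub: "{c'<..<d'} \<subseteq> {c<..<d}" "{c'<..<d'} \<subseteq> {-2<..<2}" "-2 \<le> c'" "d' \<le> 2" using cd cd' by auto
  note r = pw_repD[OF rep]
  have weakP: "is_weak_deriv {c'<..<d'} u P"
    unfolding is_weak_deriv_def distr_eq_on_def distr_deriv_def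
  proof (intro conjI allI impI)
    have V: "V absolutely_integrable_on {-2..2}" by (rule L2_integrable[OF jump_prim_L2[OF r(1)]])
    show "locally_integrable {c'<..<d'} u"
      by (rule locally_integrableI[OF absolutely_integrable_sub[OF absolutely_integrable_AE_cong(1)[OF V r(4)] sub(3,4)]])
    show "locally_integrable {c'<..<d'} P"
      by (rule locally_integrableI[OF absolutely_integrable_sub[OF L2_integrable[OF jump_prim_L2[OF r(2)]] sub(3,4)]])
    fix \<phi> assume \<phi>: "test_function {c'<..<d'} \<phi>"
    have \<phi>2: "test_function {-2<..<2} \<phi>" by (rule test_function_mono[OF \<phi> sub(2)])
    have z: "a s * \<phi> s = 0" for s
      using test_function_interval[OF \<phi>, of s] nu[of s] sub(1) disc_rep(1)[OF rep] by fastforce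
    have "(\<Sum>s\<in>D. a s * \<phi> s) = 0" unfolding z by simp
    then show "- distr_of u (deriv \<phi>) = distr_of P \<phi>"
      using jump_prim_distr[OF r(1) _ \<phi>2] distr_of_AE_cong[OF V r(4) test_function_deriv[OF \<phi>2]] by simp
  qed
  have "is_prim c' d' w (deriv w)"
  proof (rule is_prim_FTC)
    show "(w has_real_derivative deriv w y) (at y within {c'..d'})" if "y \<in> {c'..d'}" for y
      by (rule has_field_derivative_at_within[OF DERIV_deriv_iff_real_differentiable[THEN iffD2, OF w1]])
        (use that cd' in auto)
    show "continuous_on {c'..d'} (deriv w)"
      by (intro continuous_at_imp_continuous_on ballI c2) (use cd' in auto)
  qed
  moreover have "AE x in lebesgue. x \<in> {c'<..<d'} \<longrightarrow> w x = u x"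
    using eq by eventually_elim (use sub(1) in auto)
  ultimately have "is_weak_deriv {c'<..<d'} u (deriv w)"
    using cd' by (intro is_weak_deriv_prim) auto
  then have "AE x in lebesgue. x \<in> {c'<..<d'} \<longrightarrow> deriv w x = P x" by (rule is_weak_deriv_unique[OF _ weakP])
  then have "AE x in lebesgue. x \<in> {c'<..<d'} \<longrightarrow> deriv w x = dot u x"
    using dot_AE[OF rep] by eventually_elim (use sub(2) in auto)
  moreover have "\<forall>\<^sub>F y in at x. y \<in> {c'<..<d'}" using cd' by (intro eventually_at_in_open') auto
  moreover have "(deriv w \<longlongrightarrow> deriv w x) (at x)" using c2[of x] x by (simp add: continuous_at)
  ultimately have "ess_tendsto (dot u) (deriv w x) (at x)" by (rule ess_tendsto_AE)
  then show ?thesis using nu[of x] x by (auto simp: disc_def)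
qed

section \<open>The natural conditions at jumps and creases\<close>

context regular_minimizer begin

lemma disc_subset:
  assumes "Ck_on 2 {-2<..<2} g" "AE x in lebesgue. x \<in> {-2<..<-1} \<union> {1<..<2} \<longrightarrow> u x = g x"
  shows "disc u \<union> disc (dot u) \<subseteq> {-1..1}"
proof
  fix x assume x: "x \<in> disc u \<union> disc (dot u)"
  then have "x \<in> {-2<..<2}" by (auto simp: disc_def)
  moreover have "x \<notin> {-2<..<-1}"
    using disc_outside[OF assms(1) rep AE_subset[OF assms(2)], of "-2" "-1" x] x by auto
  moreover have "x \<notin> {1<..<2}"
    using disc_outside[OF assms(1) rep AE_subset[OF assms(2)], of 1 2 x] x by auto
  ultimately show "x \<in> {-1..1}" by auto
qed

lemma zero_limits:
  assumes "x \<in> {-1..1}" "x \<in> disc u \<union> disc (dot u)"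
  shows "x < 1 \<Longrightarrow> right_lim (ddot u) x 0" "-1 < x \<Longrightarrow> left_lim (ddot u) x 0"
    "x \<in> disc u \<or> \<alpha> = \<beta> \<Longrightarrow> x < 1 \<Longrightarrow> right_lim (dddot u) x 0"
    "x \<in> disc u \<or> \<alpha> = \<beta> \<Longrightarrow> -1 < x \<Longrightarrow> left_lim (dddot u) x 0"
    "x \<noteq> 1 \<Longrightarrow> x \<noteq> -1 \<Longrightarrow> jump (dddot u) x 0"
proof -
  have U0: "U x = 0" using U_zero[OF assms(1)] assms(2) disc_u by auto
  have U'0: "U' x = 0" if "x \<in> disc u \<or> \<alpha> = \<beta>" using U'_zero[OF assms(1)] assms(2) disc_u that by auto
  show "x < 1 \<Longrightarrow> right_lim (ddot u) x 0" "-1 < x \<Longrightarrow> left_lim (ddot u) x 0"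
    using limits(1,2)[of x] assms(1) U0 by auto
  show "x \<in> disc u \<or> \<alpha> = \<beta> \<Longrightarrow> x < 1 \<Longrightarrow> right_lim (dddot u) x 0"
    "x \<in> disc u \<or> \<alpha> = \<beta> \<Longrightarrow> -1 < x \<Longrightarrow> left_lim (dddot u) x 0"
    using limits(3,4)[of x] assms(1) U'0 by auto
  \<comment> \<open>At a crease the third derivative need not vanish; both its one-sided limits are
    \<open>U' x\<close>, so its jump does.\<close>
  show "x \<noteq> 1 \<Longrightarrow> x \<noteq> -1 \<Longrightarrow> jump (dddot u) x 0"
    unfolding jump_def using limits(3,4)[of x] assms(1) by (intro exI[of _ "U' x"]) auto
qed

lemma natural_conditions:
  assumes "disc u \<union> disc (dot u) \<subseteq> {-1..1}"
  shows "\<forall>x \<in> disc u - {-1, 1}.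
         right_lim (ddot u) x 0 \<and> left_lim (ddot u) x 0 \<and>
         right_lim (dddot u) x 0 \<and> left_lim (dddot u) x 0"
    and "\<forall>x \<in> disc (dot u) - (disc u \<union> {-1, 1}).
         right_lim (ddot u) x 0 \<and> left_lim (ddot u) x 0 \<and> jump (dddot u) x 0"
    and "(-1 \<in> disc u - disc (dot u) \<longrightarrow> right_lim (ddot u) (-1) 0 \<and> right_lim (dddot u) (-1) 0) \<and>
       (1 \<in> disc u - disc (dot u) \<longrightarrow> left_lim (ddot u) 1 0 \<and> left_lim (dddot u) 1 0)"
    and "(-1 \<in> disc (dot u) - disc u \<longrightarrow> right_lim (ddot u) (-1) 0) \<and>
       (1 \<in> disc (dot u) - disc u \<longrightarrow> left_lim (ddot u) 1 0)"
    and "\<alpha> = \<beta> \<longrightarrow>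
         (\<forall>x \<in> (disc u \<union> disc (dot u)) - {-1, 1}.
            right_lim (ddot u) x 0 \<and> left_lim (ddot u) x 0 \<and>
            right_lim (dddot u) x 0 \<and> left_lim (dddot u) x 0) \<and>
         (-1 \<in> disc u \<union> disc (dot u) \<longrightarrow>
            right_lim (ddot u) (-1) 0 \<and> right_lim (dddot u) (-1) 0) \<and>
         (1 \<in> disc u \<union> disc (dot u) \<longrightarrow>
            left_lim (ddot u) 1 0 \<and> left_lim (dddot u) 1 0)"
proof -
  have inner: "x \<in> {-1..1} \<and> -1 < x \<and> x < 1 \<and> x \<noteq> 1 \<and> x \<noteq> -1" if "x \<in> disc u \<union> disc (dot u)" "x \<notin> {-1, 1}" for x
    using assms that by (cases "x = -1"; cases "x = 1") (auto simp: less_le)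
  note z = zero_limits
  show "\<forall>x \<in> disc u - {-1, 1}.
         right_lim (ddot u) x 0 \<and> left_lim (ddot u) x 0 \<and>
         right_lim (dddot u) x 0 \<and> left_lim (dddot u) x 0"
    using inner z by blast
  show "\<forall>x \<in> disc (dot u) - (disc u \<union> {-1, 1}).
         right_lim (ddot u) x 0 \<and> left_lim (ddot u) x 0 \<and> jump (dddot u) x 0"
    using inner z by blast
  show "(-1 \<in> disc u - disc (dot u) \<longrightarrow> right_lim (ddot u) (-1) 0 \<and> right_lim (dddot u) (-1) 0) \<and>
       (1 \<in> disc u - disc (dot u) \<longrightarrow> left_lim (ddot u) 1 0 \<and> left_lim (dddot u) 1 0)"
    using z[of "-1"] z[of 1] by auto
  show "(-1 \<in> disc (dot u) - disc u \<longrightarrow> right_lim (ddot u) (-1) 0) \<and>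
       (1 \<in> disc (dot u) - disc u \<longrightarrow> left_lim (ddot u) 1 0)"
    using z[of "-1"] z[of 1] by auto
  show "\<alpha> = \<beta> \<longrightarrow>
         (\<forall>x \<in> (disc u \<union> disc (dot u)) - {-1, 1}.
            right_lim (ddot u) x 0 \<and> left_lim (ddot u) x 0 \<and>
            right_lim (dddot u) x 0 \<and> left_lim (dddot u) x 0) \<and>
         (-1 \<in> disc u \<union> disc (dot u) \<longrightarrow>
            right_lim (ddot u) (-1) 0 \<and> right_lim (dddot u) (-1) 0) \<and>
         (1 \<in> disc u \<union> disc (dot u) \<longrightarrow>
            left_lim (ddot u) 1 0 \<and> left_lim (dddot u) 1 0)"
  proof (intro impI conjI ballI)
    fix x assume "\<alpha> = \<beta>" and x: "x \<in> (disc u \<union> disc (dot u)) - {-1, 1}"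
    then have x': "x \<in> disc u \<union> disc (dot u)" "x \<notin> {-1, 1}" by auto
    from \<open>\<alpha> = \<beta>\<close> inner[OF x'] zero_limits[of x, OF _ x'(1)]
    show "right_lim (ddot u) x 0" "left_lim (ddot u) x 0" "right_lim (dddot u) x 0" "left_lim (dddot u) x 0"
      by blast+
  qed (use zero_limits[of "-1"] zero_limits[of 1] in auto)
qed

end

section \<open>Minimizers of the two functionals\<close>

lemma E1_minimizer_regular:
  assumes w: "Ck_on 2 {-2<..<2} w" and pos: "\<eta> > 0" "0 < \<beta>" "\<beta> \<le> \<alpha>" and f: "f \<in> L2 {-1<..<1}"
    and min: "is_arg_min (E1 \<alpha> \<beta> \<eta> \<mu> w f) (admissible_E1 w) u"
  obtains D V P h a b U U' where "regular_minimizer \<alpha> \<beta> \<eta> \<mu> f w u D V P h a b U U'"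
    "disc u \<union> disc (dot u) \<subseteq> {-1..1}"
proof -
  have wL: "w \<in> L2 {-1<..<1}"
  proof (intro L2_continuous continuous_at_imp_continuous_on ballI)
    fix x :: real assume "x \<in> {-1..1}"
    moreover have "\<forall>j<2. \<forall>x\<in>{-2<..<2}. ((deriv ^^ j) w) differentiable (at x)"
      using w by (simp add: Ck_on_def)
    from this[rule_format, of 0 x] calculation have "w differentiable (at x)" by auto
    then show "isCont w x" by (rule differentiable_imp_continuous_within)
  qed
  have u: "u \<in> piecewise_H2 (-2) 2" and uw: "AE x in lebesgue. x \<in> {-2<..<-1} \<union> {1<..<2} \<longrightarrow> u x = w x"
    and le: "\<And>v. admissible_E1 w v \<Longrightarrow> E1 \<alpha> \<beta> \<eta> \<mu> w f u \<le> E1 \<alpha> \<beta> \<eta> \<mu> w f v"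
    using min unfolding is_arg_min_linorder admissible_E1_def by blast+
  obtain D V P h a b U U' where reg: "regular_minimizer \<alpha> \<beta> \<eta> \<mu> f w u D V P h a b U U'"
  proof (rule regular_minimizer_exists[OF pos f wL u])
    fix \<phi> t assume *: "(\<lambda>x. u x + t * \<phi> x) \<in> piecewise_H2 (-2) 2" "\<forall>x \<in> {-2<..<-1} \<union> {1<..<2}. \<phi> x = 0"
    have "AE x in lebesgue. x \<in> {-2<..<-1} \<union> {1<..<2} \<longrightarrow> u x + t * \<phi> x = w x"
      using uw by eventually_elim (use *(2) in auto)
    with *(1) show "E1 \<alpha> \<beta> \<eta> \<mu> w f u \<le> E1 \<alpha> \<beta> \<eta> \<mu> w f (\<lambda>x. u x + t * \<phi> x)"
      by (intro le) (simp add: admissible_E1_def)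
  qed
  show ?thesis by (rule that[OF reg regular_minimizer.disc_subset[OF reg w uw]])
qed

lemma F1_minimizer_regular:
  assumes w: "Ck_on 2 {-2<..<2} w" and pos: "\<eta> > 0" "0 < \<beta>" "\<beta> \<le> \<alpha>"
    and fr: "fr \<in> L2 {-1<..<1}" and fp: "fp \<in> L2 {-1<..<1}"
    and min: "is_arg_min (F1 \<alpha> \<beta> \<eta> \<mu> \<gamma> fr fp) (admissible_F1 w) (ur, up)"
  obtains D V P h a b U U' where "regular_minimizer \<alpha> \<beta> \<eta> \<mu> fr up ur D V P h a b U U'"
    "disc ur \<union> disc (dot ur) \<subseteq> {-1..1}"
    "distr_eq_on {-1<..<1}
       (\<lambda>\<phi>. \<gamma> * (distr_deriv ^^ 4) (distr_of up) \<phi> + \<mu> * distr_of (\<lambda>x. up x - ur x) \<phi>)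
       (distr_of (\<lambda>x. fp x / 2))"
proof -
  let ?O = "{-2<..<-1} \<union> {1<..<2::real}"
  have ur: "ur \<in> piecewise_H2 (-2) 2" and up: "up \<in> sobolev_H 2 {-2<..<2}"
    and uw: "AE x in lebesgue. x \<in> ?O \<longrightarrow> ur x = w x \<and> up x = w x"
    and le: "\<And>vr vp. admissible_F1 w (vr, vp) \<Longrightarrow> F1 \<alpha> \<beta> \<eta> \<mu> \<gamma> fr fp (ur, up) \<le> F1 \<alpha> \<beta> \<eta> \<mu> \<gamma> fr fp (vr, vp)"
    using min unfolding is_arg_min_linorder admissible_F1_def by blast+
  have "up \<in> L2 {-2<..<2}" using up by (simp add: numeral_2_eq_2)
  then have upL: "up \<in> L2 {-1<..<1}" by (rule L2_sub) simp_all
  obtain D V P h a b U U' where reg: "regular_minimizer \<alpha> \<beta> \<eta> \<mu> fr up ur D V P h a b U U'"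
  proof (rule regular_minimizer_exists[OF pos fr upL ur])
    fix \<phi> t assume *: "(\<lambda>x. ur x + t * \<phi> x) \<in> piecewise_H2 (-2) 2" "\<forall>x \<in> ?O. \<phi> x = 0"
    have "AE x in lebesgue. x \<in> ?O \<longrightarrow> ur x + t * \<phi> x = w x \<and> up x = w x"
      using uw by eventually_elim (use *(2) in auto)
    with *(1) up have "F1 \<alpha> \<beta> \<eta> \<mu> \<gamma> fr fp (ur, up) \<le> F1 \<alpha> \<beta> \<eta> \<mu> \<gamma> fr fp (\<lambda>x. ur x + t * \<phi> x, up)"
      by (intro le) (simp add: admissible_F1_def)
    \<comment> \<open>With the second component fixed, \<open>F1\<close> is \<open>E1\<close> with
      datum \<open>up\<close> plus a term that does not depend on the first component.\<close>
    then show "E1 \<alpha> \<beta> \<eta> \<mu> up fr ur \<le> E1 \<alpha> \<beta> \<eta> \<mu> up fr (\<lambda>x. ur x + t * \<phi> x)"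
      by (simp add: F1_def E1_def)
  qed
  have "AE x in lebesgue. x \<in> ?O \<longrightarrow> ur x = w x" using uw by eventually_elim auto
  then have sub: "disc ur \<union> disc (dot ur) \<subseteq> {-1..1}" by (rule regular_minimizer.disc_subset[OF reg w])
  interpret regular_minimizer \<alpha> \<beta> \<eta> \<mu> fr up ur D V P h a b U U' by (rule reg)
  have "distr_eq_on {-1<..<1}
       (\<lambda>\<phi>. \<gamma> * (distr_deriv ^^ 4) (distr_of up) \<phi> + \<mu> * distr_of (\<lambda>x. up x - ur x) \<phi>)
       (distr_of (\<lambda>x. fp x / 2))"
  proof (rule smooth_component_equation[OF up L2_AE_cong[OF V_L2 u_AE] fp])
    fix \<phi> t assume \<phi>: "test_function {-1<..<1} \<phi>" and s: "(\<lambda>x. up x + t * \<phi> x) \<in> sobolev_H 2 {-2<..<2}"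
    have "AE x in lebesgue. x \<in> ?O \<longrightarrow> ur x = w x \<and> up x + t * \<phi> x = w x"
      using uw by eventually_elim (use test_function_zero[OF \<phi>] in auto)
    with s ur show "F1 \<alpha> \<beta> \<eta> \<mu> \<gamma> fr fp (ur, up) \<le> F1 \<alpha> \<beta> \<eta> \<mu> \<gamma> fr fp (ur, \<lambda>x. up x + t * \<phi> x)"
      by (intro le) (simp add: admissible_F1_def)
  qed
  with reg sub show ?thesis by (rule that)
qed

theorem proposition3p9:
  fixes w f fr fp :: "real \<Rightarrow> real" and \<alpha> \<beta> \<eta> \<mu> \<gamma> :: real
  assumes "Ck_on 2 {-2<..<2} w"
    and "\<eta> > 0" and "\<mu> > 0" and "\<gamma> > 0"
    and "f \<in> L2 {-1<..<1}" and "fr \<in> L2 {-1<..<1}" and "fp \<in> L2 {-1<..<1}"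
    and "0 < \<beta>" and "\<beta> \<le> \<alpha>" and "\<alpha> \<le> 2 * \<beta>"
  shows "(\<forall>u. is_arg_min (E1 \<alpha> \<beta> \<eta> \<mu> w f) (admissible_E1 w) u \<longrightarrow>
      distr_eq_on ({-1<..<1} - (disc u \<union> disc (dot u)))
         (\<lambda>\<phi>. \<eta> * (distr_deriv ^^ 4) (distr_of u) \<phi> + \<mu> * distr_of (\<lambda>x. u x - w x) \<phi>)
         (distr_of (\<lambda>x. f x / 2)) \<and>
      (\<forall>x \<in> disc u - {-1, 1}.
         right_lim (ddot u) x 0 \<and> left_lim (ddot u) x 0 \<and>
         right_lim (dddot u) x 0 \<and> left_lim (dddot u) x 0) \<and>
      (\<forall>x \<in> disc (dot u) - (disc u \<union> {-1, 1}).
         right_lim (ddot u) x 0 \<and> left_lim (ddot u) x 0 \<and> jump (dddot u) x 0) \<and>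
      (ddot u \<in> sobolev_H 2 {-1<..<1} \<and>
       distr_eq_on {-1<..<1}
         (\<lambda>\<phi>. \<eta> * (distr_deriv ^^ 2) (distr_of (ddot u)) \<phi> + \<mu> * distr_of (\<lambda>x. u x - w x) \<phi>)
         (distr_of (\<lambda>x. f x / 2))) \<and>
      ((-1 \<in> disc u - disc (dot u) \<longrightarrow>
         right_lim (ddot u) (-1) 0 \<and> right_lim (dddot u) (-1) 0) \<and>
       (1 \<in> disc u - disc (dot u) \<longrightarrow>
         left_lim (ddot u) 1 0 \<and> left_lim (dddot u) 1 0)) \<and>
      ((-1 \<in> disc (dot u) - disc u \<longrightarrow> right_lim (ddot u) (-1) 0) \<and>
       (1 \<in> disc (dot u) - disc u \<longrightarrow> left_lim (ddot u) 1 0)) \<and>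
      (\<alpha> = \<beta> \<longrightarrow>
         (\<forall>x \<in> (disc u \<union> disc (dot u)) - {-1, 1}.
            right_lim (ddot u) x 0 \<and> left_lim (ddot u) x 0 \<and>
            right_lim (dddot u) x 0 \<and> left_lim (dddot u) x 0) \<and>
         (-1 \<in> disc u \<union> disc (dot u) \<longrightarrow>
            right_lim (ddot u) (-1) 0 \<and> right_lim (dddot u) (-1) 0) \<and>
         (1 \<in> disc u \<union> disc (dot u) \<longrightarrow>
            left_lim (ddot u) 1 0 \<and> left_lim (dddot u) 1 0)))
    \<and> (\<forall>ur up. is_arg_min (F1 \<alpha> \<beta> \<eta> \<mu> \<gamma> fr fp) (admissible_F1 w) (ur, up) \<longrightarrow>
      distr_eq_on ({-1<..<1} - (disc ur \<union> disc (dot ur)))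
         (\<lambda>\<phi>. \<eta> * (distr_deriv ^^ 4) (distr_of ur) \<phi> + \<mu> * distr_of (\<lambda>x. ur x - up x) \<phi>)
         (distr_of (\<lambda>x. fr x / 2)) \<and>
      distr_eq_on {-1<..<1}
         (\<lambda>\<phi>. \<gamma> * (distr_deriv ^^ 4) (distr_of up) \<phi> + \<mu> * distr_of (\<lambda>x. up x - ur x) \<phi>)
         (distr_of (\<lambda>x. fp x / 2)) \<and>
      distr_eq_on ({-1<..<1} - (disc ur \<union> disc (dot ur)))
         (\<lambda>\<phi>. \<eta> * (distr_deriv ^^ 4) (distr_of ur) \<phi> + \<gamma> * (distr_deriv ^^ 4) (distr_of up) \<phi>)
         (distr_of (\<lambda>x. (fr x + fp x) / 2)) \<and>
      (\<forall>x \<in> disc ur - {-1, 1}.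
         right_lim (ddot ur) x 0 \<and> left_lim (ddot ur) x 0 \<and>
         right_lim (dddot ur) x 0 \<and> left_lim (dddot ur) x 0) \<and>
      (\<forall>x \<in> disc (dot ur) - (disc ur \<union> {-1, 1}).
         right_lim (ddot ur) x 0 \<and> left_lim (ddot ur) x 0 \<and> jump (dddot ur) x 0) \<and>
      (ddot ur \<in> sobolev_H 2 {-1<..<1} \<and>
       distr_eq_on {-1<..<1}
         (\<lambda>\<phi>. \<eta> * (distr_deriv ^^ 2) (distr_of (ddot ur)) \<phi> + \<mu> * distr_of (\<lambda>x. ur x - up x) \<phi>)
         (distr_of (\<lambda>x. fr x / 2)) \<and>
       distr_eq_on {-1<..<1}
         (\<lambda>\<phi>. \<eta> * (distr_deriv ^^ 2) (distr_of (ddot ur)) \<phi> + \<gamma> * (distr_deriv ^^ 4) (distr_of up) \<phi>)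
         (distr_of (\<lambda>x. (fr x + fp x) / 2)) \<and>
       distr_eq_on {-1<..<1}
         (\<lambda>\<phi>. 2 * \<eta> * (distr_deriv ^^ 2) (distr_of (ddot ur)) \<phi> + \<mu> * distr_of (\<lambda>x. ur x - up x) \<phi>
               + \<gamma> * (distr_deriv ^^ 4) (distr_of up) \<phi>)
         (distr_of (\<lambda>x. fr x + fp x / 2))) \<and>
      ((-1 \<in> disc ur - disc (dot ur) \<longrightarrow>
         right_lim (ddot ur) (-1) 0 \<and> right_lim (dddot ur) (-1) 0) \<and>
       (1 \<in> disc ur - disc (dot ur) \<longrightarrow>
         left_lim (ddot ur) 1 0 \<and> left_lim (dddot ur) 1 0)) \<and>
      ((-1 \<in> disc (dot ur) - disc ur \<longrightarrow> right_lim (ddot ur) (-1) 0) \<and>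
       (1 \<in> disc (dot ur) - disc ur \<longrightarrow> left_lim (ddot ur) 1 0)) \<and>
      (\<alpha> = \<beta> \<longrightarrow>
         (\<forall>x \<in> (disc ur \<union> disc (dot ur)) - {-1, 1}.
            right_lim (ddot ur) x 0 \<and> left_lim (ddot ur) x 0 \<and>
            right_lim (dddot ur) x 0 \<and> left_lim (dddot ur) x 0) \<and>
         (-1 \<in> disc ur \<union> disc (dot ur) \<longrightarrow>
            right_lim (ddot ur) (-1) 0 \<and> right_lim (dddot ur) (-1) 0) \<and>
         (1 \<in> disc ur \<union> disc (dot ur) \<longrightarrow>
            left_lim (ddot ur) 1 0 \<and> left_lim (dddot ur) 1 0)))"
proof (rule conjI; intro allI impI)
  fix u assume "is_arg_min (E1 \<alpha> \<beta> \<eta> \<mu> w f) (admissible_E1 w) u"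
  then obtain D V P h a b U U' where reg: "regular_minimizer \<alpha> \<beta> \<eta> \<mu> f w u D V P h a b U U'"
    and sub: "disc u \<union> disc (dot u) \<subseteq> {-1..1}"
    by (rule E1_minimizer_regular[OF assms(1,2,8,9,5)])
  interpret regular_minimizer \<alpha> \<beta> \<eta> \<mu> f w u D V P h a b U U' by (rule reg)
  note n = natural_conditions[OF sub]
  show "distr_eq_on ({-1<..<1} - (disc u \<union> disc (dot u)))
         (\<lambda>\<phi>. \<eta> * (distr_deriv ^^ 4) (distr_of u) \<phi> + \<mu> * distr_of (\<lambda>x. u x - w x) \<phi>)
         (distr_of (\<lambda>x. f x / 2)) \<and>
      (\<forall>x \<in> disc u - {-1, 1}.
         right_lim (ddot u) x 0 \<and> left_lim (ddot u) x 0 \<and>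
         right_lim (dddot u) x 0 \<and> left_lim (dddot u) x 0) \<and>
      (\<forall>x \<in> disc (dot u) - (disc u \<union> {-1, 1}).
         right_lim (ddot u) x 0 \<and> left_lim (ddot u) x 0 \<and> jump (dddot u) x 0) \<and>
      (ddot u \<in> sobolev_H 2 {-1<..<1} \<and>
       distr_eq_on {-1<..<1}
         (\<lambda>\<phi>. \<eta> * (distr_deriv ^^ 2) (distr_of (ddot u)) \<phi> + \<mu> * distr_of (\<lambda>x. u x - w x) \<phi>)
         (distr_of (\<lambda>x. f x / 2))) \<and>
      ((-1 \<in> disc u - disc (dot u) \<longrightarrow>
         right_lim (ddot u) (-1) 0 \<and> right_lim (dddot u) (-1) 0) \<and>
       (1 \<in> disc u - disc (dot u) \<longrightarrow>
         left_lim (ddot u) 1 0 \<and> left_lim (dddot u) 1 0)) \<and>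
      ((-1 \<in> disc (dot u) - disc u \<longrightarrow> right_lim (ddot u) (-1) 0) \<and>
       (1 \<in> disc (dot u) - disc u \<longrightarrow> left_lim (ddot u) 1 0)) \<and>
      (\<alpha> = \<beta> \<longrightarrow>
         (\<forall>x \<in> (disc u \<union> disc (dot u)) - {-1, 1}.
            right_lim (ddot u) x 0 \<and> left_lim (ddot u) x 0 \<and>
            right_lim (dddot u) x 0 \<and> left_lim (dddot u) x 0) \<and>
         (-1 \<in> disc u \<union> disc (dot u) \<longrightarrow>
            right_lim (ddot u) (-1) 0 \<and> right_lim (dddot u) (-1) 0) \<and>
         (1 \<in> disc u \<union> disc (dot u) \<longrightarrow>
            left_lim (ddot u) 1 0 \<and> left_lim (dddot u) 1 0))"
    by (rule conjI[OF euler_equation_fourth conjI[OF n(1) conjI[OF n(2)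
            conjI[OF conjI[OF ddot_H2 euler_equation] conjI[OF n(3) conjI[OF n(4) n(5)]]]]]])
next
  fix ur up assume "is_arg_min (F1 \<alpha> \<beta> \<eta> \<mu> \<gamma> fr fp) (admissible_F1 w) (ur, up)"
  then obtain D V P h a b U U' where reg: "regular_minimizer \<alpha> \<beta> \<eta> \<mu> fr up ur D V P h a b U U'"
    and sub: "disc ur \<union> disc (dot ur) \<subseteq> {-1..1}"
    and smooth_eq: "distr_eq_on {-1<..<1}
       (\<lambda>\<phi>. \<gamma> * (distr_deriv ^^ 4) (distr_of up) \<phi> + \<mu> * distr_of (\<lambda>x. up x - ur x) \<phi>)
       (distr_of (\<lambda>x. fp x / 2))"
    by (rule F1_minimizer_regular[OF assms(1,2,8,9,6,7)])
  interpret regular_minimizer \<alpha> \<beta> \<eta> \<mu> fr up ur D V P h a b U U' by (rule reg)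
  note n = natural_conditions[OF sub]
  have swap: "distr_of (\<lambda>x. up x - ur x) \<phi> = - distr_of (\<lambda>x. ur x - up x) \<phi>" for \<phi>
    unfolding distr_of_def Bochner_Integration.integral_minus[symmetric]
    by (rule Bochner_Integration.integral_cong) (simp_all add: algebra_simps)
  have rhs_sum: "distr_of (\<lambda>x. (fr x + fp x) / 2) \<phi> = distr_of (\<lambda>x. fr x / 2) \<phi> + distr_of (\<lambda>x. fp x / 2) \<phi>"
      "distr_of (\<lambda>x. fr x + fp x / 2) \<phi> = 2 * distr_of (\<lambda>x. fr x / 2) \<phi> + distr_of (\<lambda>x. fp x / 2) \<phi>"
    if \<phi>: "test_function {-1<..<1} \<phi>" for \<phi>
  proof -
    have L: "(\<lambda>x. fr x / 2) \<in> L2 {-1<..<1}" "(\<lambda>x. fp x / 2) \<in> L2 {-1<..<1}"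
      using L2_scale[OF assms(6), of "1/2"] L2_scale[OF assms(7), of "1/2"] by simp_all
    show "distr_of (\<lambda>x. (fr x + fp x) / 2) \<phi> = distr_of (\<lambda>x. fr x / 2) \<phi> + distr_of (\<lambda>x. fp x / 2) \<phi>"
      using distr_of_lin[OF L \<phi>, of 1] by (simp add: add_divide_distrib)
    have "(\<lambda>x. fp x / 2 + 2 * (fr x / 2)) = (\<lambda>x. fr x + fp x / 2)" by auto
    then show "distr_of (\<lambda>x. fr x + fp x / 2) \<phi> = 2 * distr_of (\<lambda>x. fr x / 2) \<phi> + distr_of (\<lambda>x. fp x / 2) \<phi>"
      using distr_of_lin[OF L(2,1) \<phi>, of 2] by simp
  qed
  \<comment> \<open>The fidelity terms of the two Euler equations cancel by
    \<open>swap\<close>.\<close>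
  have sum_fourth: "distr_eq_on ({-1<..<1} - (disc ur \<union> disc (dot ur)))
         (\<lambda>\<phi>. \<eta> * (distr_deriv ^^ 4) (distr_of ur) \<phi> + \<gamma> * (distr_deriv ^^ 4) (distr_of up) \<phi>)
         (distr_of (\<lambda>x. (fr x + fp x) / 2))"
    unfolding distr_eq_on_def
  proof (intro allI impI)
    fix \<phi> assume \<phi>: "test_function ({-1<..<1} - (disc ur \<union> disc (dot ur))) \<phi>"
    have \<phi>1: "test_function {-1<..<1} \<phi>" by (rule test_function_mono[OF \<phi>]) auto
    show "\<eta> * (distr_deriv ^^ 4) (distr_of ur) \<phi> + \<gamma> * (distr_deriv ^^ 4) (distr_of up) \<phi>
        = distr_of (\<lambda>x. (fr x + fp x) / 2) \<phi>"
      using euler_equation_fourth[unfolded distr_eq_on_def, rule_format, OF \<phi>]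
        smooth_eq[unfolded distr_eq_on_def, rule_format, OF \<phi>1] rhs_sum(1)[OF \<phi>1] swap[of \<phi>] by simp
  qed
  have sum_second: "distr_eq_on {-1<..<1}
         (\<lambda>\<phi>. \<eta> * (distr_deriv ^^ 2) (distr_of (ddot ur)) \<phi> + \<gamma> * (distr_deriv ^^ 4) (distr_of up) \<phi>)
         (distr_of (\<lambda>x. (fr x + fp x) / 2))"
    unfolding distr_eq_on_def
  proof (intro allI impI)
    fix \<phi> assume \<phi>: "test_function {-1<..<1} \<phi>"
    show "\<eta> * (distr_deriv ^^ 2) (distr_of (ddot ur)) \<phi> + \<gamma> * (distr_deriv ^^ 4) (distr_of up) \<phi>
        = distr_of (\<lambda>x. (fr x + fp x) / 2) \<phi>"
      using euler_equation[unfolded distr_eq_on_def, rule_format, OF \<phi>]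
        smooth_eq[unfolded distr_eq_on_def, rule_format, OF \<phi>] rhs_sum(1)[OF \<phi>] swap[of \<phi>] by simp
  qed
  \<comment> \<open>Twice the equation for \<open>ur\<close> plus the equation for
    \<open>up\<close>, in which the fidelity term has the opposite sign.\<close>
  have sum_total: "distr_eq_on {-1<..<1}
         (\<lambda>\<phi>. 2 * \<eta> * (distr_deriv ^^ 2) (distr_of (ddot ur)) \<phi> + \<mu> * distr_of (\<lambda>x. ur x - up x) \<phi>
               + \<gamma> * (distr_deriv ^^ 4) (distr_of up) \<phi>)
         (distr_of (\<lambda>x. fr x + fp x / 2))"
    unfolding distr_eq_on_def
  proof (intro allI impI)
    fix \<phi> assume \<phi>: "test_function {-1<..<1} \<phi>"
    show "2 * \<eta> * (distr_deriv ^^ 2) (distr_of (ddot ur)) \<phi> + \<mu> * distr_of (\<lambda>x. ur x - up x) \<phi>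
        + \<gamma> * (distr_deriv ^^ 4) (distr_of up) \<phi> = distr_of (\<lambda>x. fr x + fp x / 2) \<phi>"
      using euler_equation[unfolded distr_eq_on_def, rule_format, OF \<phi>]
        smooth_eq[unfolded distr_eq_on_def, rule_format, OF \<phi>] rhs_sum(2)[OF \<phi>] swap[of \<phi>] by simp
  qed
  show "distr_eq_on ({-1<..<1} - (disc ur \<union> disc (dot ur)))
         (\<lambda>\<phi>. \<eta> * (distr_deriv ^^ 4) (distr_of ur) \<phi> + \<mu> * distr_of (\<lambda>x. ur x - up x) \<phi>)
         (distr_of (\<lambda>x. fr x / 2)) \<and>
      distr_eq_on {-1<..<1}
         (\<lambda>\<phi>. \<gamma> * (distr_deriv ^^ 4) (distr_of up) \<phi> + \<mu> * distr_of (\<lambda>x. up x - ur x) \<phi>)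
         (distr_of (\<lambda>x. fp x / 2)) \<and>
      distr_eq_on ({-1<..<1} - (disc ur \<union> disc (dot ur)))
         (\<lambda>\<phi>. \<eta> * (distr_deriv ^^ 4) (distr_of ur) \<phi> + \<gamma> * (distr_deriv ^^ 4) (distr_of up) \<phi>)
         (distr_of (\<lambda>x. (fr x + fp x) / 2)) \<and>
      (\<forall>x \<in> disc ur - {-1, 1}.
         right_lim (ddot ur) x 0 \<and> left_lim (ddot ur) x 0 \<and>
         right_lim (dddot ur) x 0 \<and> left_lim (dddot ur) x 0) \<and>
      (\<forall>x \<in> disc (dot ur) - (disc ur \<union> {-1, 1}).
         right_lim (ddot ur) x 0 \<and> left_lim (ddot ur) x 0 \<and> jump (dddot ur) x 0) \<and>
      (ddot ur \<in> sobolev_H 2 {-1<..<1} \<and>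
       distr_eq_on {-1<..<1}
         (\<lambda>\<phi>. \<eta> * (distr_deriv ^^ 2) (distr_of (ddot ur)) \<phi> + \<mu> * distr_of (\<lambda>x. ur x - up x) \<phi>)
         (distr_of (\<lambda>x. fr x / 2)) \<and>
       distr_eq_on {-1<..<1}
         (\<lambda>\<phi>. \<eta> * (distr_deriv ^^ 2) (distr_of (ddot ur)) \<phi> + \<gamma> * (distr_deriv ^^ 4) (distr_of up) \<phi>)
         (distr_of (\<lambda>x. (fr x + fp x) / 2)) \<and>
       distr_eq_on {-1<..<1}
         (\<lambda>\<phi>. 2 * \<eta> * (distr_deriv ^^ 2) (distr_of (ddot ur)) \<phi> + \<mu> * distr_of (\<lambda>x. ur x - up x) \<phi>
               + \<gamma> * (distr_deriv ^^ 4) (distr_of up) \<phi>)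
         (distr_of (\<lambda>x. fr x + fp x / 2))) \<and>
      ((-1 \<in> disc ur - disc (dot ur) \<longrightarrow>
         right_lim (ddot ur) (-1) 0 \<and> right_lim (dddot ur) (-1) 0) \<and>
       (1 \<in> disc ur - disc (dot ur) \<longrightarrow>
         left_lim (ddot ur) 1 0 \<and> left_lim (dddot ur) 1 0)) \<and>
      ((-1 \<in> disc (dot ur) - disc ur \<longrightarrow> right_lim (ddot ur) (-1) 0) \<and>
       (1 \<in> disc (dot ur) - disc ur \<longrightarrow> left_lim (ddot ur) 1 0)) \<and>
      (\<alpha> = \<beta> \<longrightarrow>
         (\<forall>x \<in> (disc ur \<union> disc (dot ur)) - {-1, 1}.
            right_lim (ddot ur) x 0 \<and> left_lim (ddot ur) x 0 \<and>
            right_lim (dddot ur) x 0 \<and> left_lim (dddot ur) x 0) \<and>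
         (-1 \<in> disc ur \<union> disc (dot ur) \<longrightarrow>
            right_lim (ddot ur) (-1) 0 \<and> right_lim (dddot ur) (-1) 0) \<and>
         (1 \<in> disc ur \<union> disc (dot ur) \<longrightarrow>
            left_lim (ddot ur) 1 0 \<and> left_lim (dddot ur) 1 0))"
    by (rule conjI[OF euler_equation_fourth conjI[OF smooth_eq conjI[OF sum_fourth conjI[OF n(1) conjI[OF n(2)
            conjI[OF conjI[OF ddot_H2 conjI[OF euler_equation conjI[OF sum_second sum_total]]]
              conjI[OF n(3) conjI[OF n(4) n(5)]]]]]]]])
qed

end
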